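(* Define power series $\rho^{(k)}(\mathbf u)$ in $\mathbf u=(u_1,u_2,\dots)$ for $k\ge0$ by the generating series $$\sum_{k=0}^\infty\rho^{(k)}(\mathbf u)\,\frac{v^k}{k!}\;=\;\int_v^{v+1}e^{U(t)-U(t-1)}\,dt,\qquad U(t)=\sum_{n\ge1}u_nt^n,$$ and let $\rho^{(k)}_{i,j}$ for $i,j\ge0$ be the part of $\rho^{(k)}$ of degree $j$ and weight $i+2j+k$, where $u_\ell$ has degree $1$ and weight $\ell+1$. Define the operator $\rho_{i,j}:\mathcal R\to\mathcal R$ by $$\rho_{i,j}=\sum_{k=0}^\infty Q_k\,\rho^{(k)}_{i,j}\Bigl(\frac{\partial}{\partial p_1},\frac{\partial}{\partial p_2},\dots\Bigr).$$ Then for every $f\in\mathcal R$ $$\langle\widetilde T_p\,f\rangle_q\;=\;\sum_{i,j\ge0}\langle\rho_{i,j}(f)\rangle_q\;G^{(j)}_{p+i+1}\qquad\text{for all odd }p\ge1.$$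
   Context: Define $\beta_k\in\mathbb Q$ by $\frac{z/2}{\sinh(z/2)}=\sum_{k\ge0}\beta_kz^k$. For a partition $\lambda$ put $Q_0(\lambda)=1$ and $Q_k(\lambda)=\frac{1}{(k-1)!}\sum_{i\ge1}\bigl[(\lambda_i-i+\tfrac12)^{k-1}-(-i+\tfrac12)^{k-1}\bigr]+\beta_k$ for $k\ge1$. Let $\mathcal R=\mathbb Q[Q_1,Q_2,\dots]$ be the polynomial ring in these symbols ($Q_0=1$); elements of $\mathcal R$ are regarded as functions on the set of all partitions. Put $p_\ell=\ell!\,Q_{\ell+1}$ for $\ell\ge1$, so $\frac{\partial}{\partial p_\ell}=\frac1{\ell!}\frac{\partial}{\partial Q_{\ell+1}}$ as derivations of $\mathcal R$; in $\rho_{i,j}$ the multiplication by $Q_k$ is applied after the derivations. The $q$-bracket of a function $f$ on partitions is $\langle f\rangle_q=\sum_\lambda f(\lambda)q^{|\lambda|}\big/\sum_\lambda q^{|\lambda|}\in\mathbb Q[[q]]$. For $p\ge1$ odd, $\widetilde T_p(\lambda)=\sum_{\xi\in Y_\lambda}h(\xi)^{p-1}+\frac12\zeta(-p)$, where $Y_\lambda$ is the Young diagram of $\lambda$ and $h(\xi)$ the hook-length of the cell $\xi$. $G_k=-\frac{B_k}{2k}+\sum_{n\ge1}\sigma_{k-1}(n)q^n$ for $k\ge2$ even, $G_k=0$ for $k$ odd, and $G_k^{(j)}=\bigl(q\frac{d}{dq}\bigr)^jG_k$. *)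

theory Defs
  imports
    "HOL-Complex_Analysis.Complex_Analysis"
    "HOL-Computational_Algebra.Computational_Algebra"
    "HOL-Library.Poly_Mapping"
begin

section \<open>Partitions and \<open>q\<close>-brackets\<close>

text \<open>A partition is the weakly decreasing list of its (positive) parts, so that
  the part \<open>\<lambda>\<^sub>i\<close> is \<open>l ! (i - 1)\<close> for \<open>1 \<le> i \<le> length l\<close>, and \<open>\<lambda>\<^sub>i = 0\<close> for \<open>i > length l\<close>.\<close>

definition is_partition :: "nat list \<Rightarrow> bool" where
  "is_partition l \<longleftrightarrow> sorted_wrt (\<ge>) l \<and> 0 \<notin> set l"

definition partitions_of :: "nat \<Rightarrow> nat list set" where
  "partitions_of n = {l. is_partition l \<and> sum_list l = n}"

definition partition_series :: "(nat list \<Rightarrow> rat) \<Rightarrow> rat fps" where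
  "partition_series f = Abs_fps (\<lambda>n. \<Sum>l\<in>partitions_of n. f l)"

definition q_bracket :: "(nat list \<Rightarrow> rat) \<Rightarrow> rat fps" where
  "q_bracket f = partition_series f / partition_series (\<lambda>_. 1)"

definition young_diagram :: "nat list \<Rightarrow> (nat \<times> nat) set" where
  "young_diagram l = {(i, j). 1 \<le> i \<and> i \<le> length l \<and> 1 \<le> j \<and> j \<le> l ! (i - 1)}"

definition hook_length :: "nat list \<Rightarrow> nat \<times> nat \<Rightarrow> nat" where
  "hook_length l = (\<lambda>(i, j). card {(i', j') \<in> young_diagram l.
     (i' = i \<and> j \<le> j') \<or> (j' = j \<and> i \<le> i')})"


section \<open>The functions \<open>Q\<^sub>k\<close> on partitions\<close>

definition beta :: "nat \<Rightarrow> rat" where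
  "beta k = fps_nth
     ((fps_const (1/2) * fps_X) / (fps_const (1/2) * (fps_exp (1/2) - fps_exp (- (1/2))))) k"

text \<open>The summands with \<open>i > length l\<close> vanish since \<open>\<lambda>\<^sub>i = 0\<close> there.\<close>

definition Q_fun :: "nat \<Rightarrow> nat list \<Rightarrow> rat" where
  "Q_fun k l = (if k = 0 then 1 else
     1 / fact (k - 1) *
       (\<Sum>i = 1..length l. (of_nat (l ! (i - 1)) - of_nat i + 1/2) ^ (k - 1)
                         - (- of_nat i + 1/2) ^ (k - 1))
     + beta k)"


section \<open>The polynomial ring \<open>\<rat>[Q\<^sub>1, Q\<^sub>2, \<dots>]\<close>\<close>

text \<open>Monomials in variables indexed by natural numbers are finitely supported exponent
  functions, and polynomials are finitely supported functions on monomials. In \<open>R_poly\<close>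
  the variable with index \<open>n\<close> is the symbol \<open>Q\<^bsub>n+1\<^esub>\<close>. This is a free polynomial ring:
  its elements are not identified with the functions on partitions that they induce
  (the function \<open>Q\<^sub>1\<close> is zero, the symbol is not).\<close>

type_synonym monomial = "nat \<Rightarrow>\<^sub>0 nat"
type_synonym R_poly = "monomial \<Rightarrow>\<^sub>0 rat"

definition R_const :: "rat \<Rightarrow> R_poly" where
  "R_const c = Poly_Mapping.single 0 c"

definition Q_sym :: "nat \<Rightarrow> R_poly" where
  "Q_sym k = (if k = 0 then 1
     else Poly_Mapping.single (Poly_Mapping.single (k - 1) 1) 1)"

definition R_eval :: "R_poly \<Rightarrow> nat list \<Rightarrow> rat" where
  "R_eval f l = (\<Sum>m\<in>Poly_Mapping.keys f.
     Poly_Mapping.lookup f m *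
       (\<Prod>n\<in>Poly_Mapping.keys m. Q_fun (n + 1) l ^ Poly_Mapping.lookup m n))"

text \<open>The partial derivative with respect to \<open>Q\<^sub>k\<close>, for \<open>k \<ge> 1\<close>.\<close>

definition deriv_Q :: "nat \<Rightarrow> R_poly \<Rightarrow> R_poly" where
  "deriv_Q k f = (\<Sum>m\<in>Poly_Mapping.keys f.
     Poly_Mapping.single (m - Poly_Mapping.single (k - 1) 1)
       (of_nat (Poly_Mapping.lookup m (k - 1)) * Poly_Mapping.lookup f m))"

text \<open>The partial derivative with respect to \<open>p\<^sub>r = r! Q\<^bsub>r+1\<^esub>\<close>, for \<open>r \<ge> 1\<close>.\<close>

definition deriv_p :: "nat \<Rightarrow> R_poly \<Rightarrow> R_poly" where
  "deriv_p r f = R_const (1 / fact r) * deriv_Q (r + 1) f"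

text \<open>The monomial \<open>\<Prod>\<^sub>r u\<^sub>r ^ m\<^sub>r\<close> evaluated at \<open>u\<^sub>r = \<partial>/\<partial>p\<^sub>r\<close>; these derivations commute, so
  the order of composition is immaterial.\<close>

definition deriv_monomial :: "monomial \<Rightarrow> R_poly \<Rightarrow> R_poly" where
  "deriv_monomial m =
     fold (\<lambda>r. deriv_p r ^^ Poly_Mapping.lookup m r) (sorted_list_of_set (Poly_Mapping.keys m))"


section \<open>The power series \<open>\<rho>\<^sup>(\<^sup>k\<^sup>)(\<^bold>u)\<close>\<close>

text \<open>A formal power series in \<open>u\<^sub>0, u\<^sub>1, u\<^sub>2, \<dots>\<close> is an arbitrary function from monomials to
  coefficients; here the variable with index \<open>n\<close> is \<open>u\<^sub>n\<close>, and \<open>u\<^sub>0\<close> never occurs in the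
  series below.\<close>

type_synonym 'a useries = "monomial \<Rightarrow> 'a"

definition useries_one :: "'a::comm_ring_1 useries" where
  "useries_one m = (if m = 0 then 1 else 0)"

definition useries_mult :: "'a::comm_ring_1 useries \<Rightarrow> 'a useries \<Rightarrow> 'a useries" where
  "useries_mult F G m = (\<Sum>(a, b) | a + b = m. F a * G b)"

text \<open>The exponential of a series without constant term: then, for each monomial, only
  finitely many powers contribute to the coefficient, so that \<^const>\<open>Sum_any\<close> (the sum over all
  indices of a family with finite support) is the sum of the exponential series.\<close>

definition useries_exp :: "rat poly useries \<Rightarrow> rat poly useries" where
  "useries_exp F m =
     Sum_any (\<lambda>d::nat. Polynomial.smult (1 / fact d) ((useries_mult F ^^ d) useries_one m))"

text \<open>\<open>U(s) = \<Sum>\<^sub>n\<^sub>\<ge>\<^sub>1 u\<^sub>n s^n\<close>, for a polynomial \<open>s\<close>; the sum has at most one term for each monomial.\<close>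

definition U_series :: "rat poly \<Rightarrow> rat poly useries" where
  "U_series s m = (\<Sum>n | 1 \<le> n \<and> m = Poly_Mapping.single n 1. s ^ n)"

text \<open>\<open>\<integral>\<^sub>a\<^sup>b P(t) dt\<close> for polynomials \<open>P\<close>, \<open>a\<close>, \<open>b\<close>.\<close>

definition poly_antideriv :: "rat poly \<Rightarrow> rat poly" where
  "poly_antideriv P =
     (\<Sum>i\<le>Polynomial.degree P. Polynomial.monom (Polynomial.coeff P i / of_nat (i + 1)) (i + 1))"

definition poly_integral :: "rat poly \<Rightarrow> rat poly \<Rightarrow> rat poly \<Rightarrow> rat poly" where
  "poly_integral a b P = pcompose (poly_antideriv P) b - pcompose (poly_antideriv P) a"

text \<open>\<open>\<integral>\<^sub>v\<^sup>v\<^sup>+\<^sup>1 exp(U(t) - U(t-1)) dt\<close>: the coefficients of the integrand are polynomials in \<open>t\<close>,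
  those of the result are polynomials in \<open>v\<close>; in both cases the polynomial variable is \<open>[:0, 1:]\<close>.\<close>

definition rho_gen :: "rat poly useries" where
  "rho_gen m = poly_integral [:0, 1:] [:1, 1:]
     (useries_exp (\<lambda>m'. U_series [:0, 1:] m' - U_series [:-1, 1:] m') m)"

definition rho_series :: "nat \<Rightarrow> rat useries" where
  "rho_series k m = fact k * Polynomial.coeff (rho_gen m) k"

definition u_degree :: "monomial \<Rightarrow> nat" where
  "u_degree m = (\<Sum>r\<in>Poly_Mapping.keys m. Poly_Mapping.lookup m r)"

definition u_weight :: "monomial \<Rightarrow> nat" where
  "u_weight m = (\<Sum>r\<in>Poly_Mapping.keys m. (r + 1) * Poly_Mapping.lookup m r)"

definition rho_part :: "nat \<Rightarrow> nat \<Rightarrow> nat \<Rightarrow> rat useries" where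
  "rho_part k i j m =
     (if u_degree m = j \<and> u_weight m = i + 2 * j + k then rho_series k m else 0)"

text \<open>There are only finitely many monomials of a given weight, so \<open>\<rho>\<^sup>(\<^sup>k\<^sup>)\<^sub>i\<^sub>,\<^sub>j\<close> is a polynomial
  in the \<open>u\<^sub>r\<close>. Applied to a given \<open>f\<close>, it is nonzero for finitely many \<open>(i, j, k)\<close> only,
  because a monomial of weight \<open>w\<close> in the \<open>\<partial>/\<partial>p\<^sub>r\<close> lowers the weight (\<open>Q\<^sub>k\<close> having weight \<open>k\<close>)
  by \<open>w\<close>.\<close>

definition rho_op :: "nat \<Rightarrow> nat \<Rightarrow> R_poly \<Rightarrow> R_poly" where
  "rho_op i j f = Sum_any (\<lambda>k. Q_sym k *
     (\<Sum>m | rho_part k i j m \<noteq> 0. R_const (rho_part k i j m) * deriv_monomial m f))"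


section \<open>Zeta values, Eisenstein series, hook-length moments\<close>

text \<open>The Riemann zeta function: the analytic continuation to \<open>\<complex> - {1}\<close> of the Dirichlet
  series. By the identity theorem the choice is unique up to the irrelevant value at \<open>1\<close>.\<close>

definition riemann_zeta :: "complex \<Rightarrow> complex" where
  "riemann_zeta = (SOME f. f holomorphic_on - {1} \<and>
     (\<forall>s. 1 < Re s \<longrightarrow> (\<lambda>n. of_nat (Suc n) powr (- s)) sums f s))"

text \<open>The value \<open>\<zeta>(-p)\<close>, which is rational, as a rational number.\<close>

definition zeta_neg :: "nat \<Rightarrow> rat" where
  "zeta_neg p = (THE r. of_rat r = riemann_zeta (- of_nat p))"

definition T_tilde :: "nat \<Rightarrow> nat list \<Rightarrow> rat" where
  "T_tilde p l = (\<Sum>\<xi>\<in>young_diagram l. of_nat (hook_length l \<xi>) ^ (p - 1)) + 1/2 * zeta_neg p"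

text \<open>\<open>B\<^sub>k\<close>, from \<open>z / (e^z - 1) = \<Sum>\<^sub>k B\<^sub>k z^k / k!\<close>.\<close>

definition bernoulli_num :: "nat \<Rightarrow> rat" where
  "bernoulli_num k = fact k * fps_nth (fps_X / (fps_exp 1 - 1)) k"

definition divisor_sigma :: "nat \<Rightarrow> nat \<Rightarrow> nat" where
  "divisor_sigma r n = (\<Sum>d | d dvd n. d ^ r)"

text \<open>Only used for \<open>k \<ge> 2\<close>.\<close>

definition eisenstein_G :: "nat \<Rightarrow> rat fps" where
  "eisenstein_G k = (if even k
     then Abs_fps (\<lambda>n. if n = 0 then - bernoulli_num k / (2 * of_nat k)
                       else of_nat (divisor_sigma (k - 1) n))
     else 0)"

definition eisenstein_G_deriv :: "nat \<Rightarrow> nat \<Rightarrow> rat fps" where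
  "eisenstein_G_deriv j k = ((\<lambda>F. fps_X * fps_deriv F) ^^ j) (eisenstein_G k)"

end

theory Submission
  imports Defs
begin

text \<open>A partition with at most \<open>N\<close> parts is encoded by its beta set, an \<open>N\<close>-element set \<open>X\<close> of
  natural numbers; hooks of length \<open>h\<close> are then the \<open>a \<in> X\<close> with \<open>a \<ge> h\<close> and \<open>a - h \<notin> X\<close>, and
  removing such a hook replaces \<open>a\<close> by \<open>a - h\<close>. This lowers the size of the partition by \<open>h\<close> and \<open>p\<^sub>n\<close> by
  \<open>t\<^sup>n - (t - h)\<^sup>n\<close>, where \<open>t = a - N + 1/2\<close>. Summing \<open>f\<close>, with its arguments translated by \<open>r\<close> times
  this vector, over all partitions with a marked hook of length \<open>h\<close>, and removing the hooks, one
  obtains the sum over partitions with a marked place where a hook can be added, and \<open>r + 1\<close> in place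
  of \<open>r\<close>. For a fixed partition, adding and removing differ by a telescoping sum
  which is linear in the \<open>Q\<^sub>k\<close>. Iterating in \<open>r\<close> gives a double sum over \<open>h\<close> and \<open>r\<close> weighted by \<open>q\<^bsup>rh\<^esup>\<close>.
  Taylor's formula for \<open>f\<close> and the substitution \<open>t \<mapsto> t/h\<close> turn its summands into
  \<open>\<rho>\<^sub>i\<^sub>,\<^sub>j\<close> with the coefficient \<open>r\<^sup>j h\<^bsup>p+i+j\<^esup>\<close>, that is, into the coefficients of the derivatives of the
  Eisenstein series. For odd \<open>i\<close> the symmetry \<open>t \<mapsto> 1 - t\<close> makes \<open>\<rho>\<^sub>i\<^sub>,\<^sub>j\<close> vanish, and the constant term
  of \<open>G\<^bsub>p+1\<^esub>\<close> is \<open>\<zeta>(-p)/2\<close>, by repeated integration by parts against Bernoulli polynomials.\<close>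

section \<open>The zeta function at negative integers\<close>

definition bernoulli_coeff :: "nat \<Rightarrow> rat" where
  "bernoulli_coeff k = fps_nth (fps_X / (fps_exp 1 - 1)) k"

lemma bernoulli_num_eq: "bernoulli_num k = fact k * bernoulli_coeff k"
  by (simp add: bernoulli_num_def bernoulli_coeff_def)

lemma fps_exp_minus_one_nth:
  "fps_nth (fps_exp (1::rat) - 1) j = (if j = 0 then 0 else 1 / fact j)"
  by simp

lemma subdegree_exp_minus_one: "subdegree (fps_exp (1::rat) - 1) = 1"
proof (rule subdegreeI)
  show "fps_nth (fps_exp (1::rat) - 1) 1 \<noteq> 0" by simp
  show "fps_nth (fps_exp (1::rat) - 1) i = 0" if "i < 1" for i using that by simp
qed

lemma bernoulli_recurrence_fps:
  "fps_X / (fps_exp (1::rat) - 1) * (fps_exp 1 - 1) = fps_X"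
proof (rule fps_times_divide_eq)
  show "fps_exp (1::rat) - 1 \<noteq> 0"
    using subdegree_exp_minus_one by force
  show "subdegree (fps_exp (1::rat) - 1) \<le> subdegree (fps_X :: rat fps)"
    unfolding subdegree_exp_minus_one by simp
qed

text \<open>Compare coefficients of degree \<open>Suc k\<close> in
  \<open>bernoulli_recurrence_fps\<close>; since the exponential series minus 1 has no constant
  term, the top summand drops out.\<close>

lemma bernoulli_coeff_recurrence:
  "(\<Sum>i\<le>k. bernoulli_coeff i / fact (Suc k - i)) = (if k = 0 then 1 else 0)"
proof -
  have "fps_nth (fps_X / (fps_exp (1::rat) - 1) * (fps_exp 1 - 1)) (Suc k)
      = (\<Sum>i=0..Suc k. bernoulli_coeff i * (if Suc k - i = 0 then 0 else 1 / fact (Suc k - i)))"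
    unfolding fps_mult_nth fps_exp_minus_one_nth bernoulli_coeff_def ..
  also have "\<dots> = (\<Sum>i\<le>k. bernoulli_coeff i / fact (Suc k - i))"
    unfolding atLeast0AtMost sum.atMost_Suc by (simp add: field_simps Suc_diff_le)
  finally show ?thesis by (simp add: bernoulli_recurrence_fps)
qed

lemma bernoulli_coeff_0 [simp]: "bernoulli_coeff 0 = 1"
  using bernoulli_coeff_recurrence[of 0] by simp

lemma bernoulli_coeff_1 [simp]: "bernoulli_coeff (Suc 0) = - 1 / 2"
  using bernoulli_coeff_recurrence[of 1] by (simp add: fact_2)

text \<open>Write B(z) = z / (e^z - 1). Substituting -z into B(z) (e^z - 1) = z and multiplying by
  e^z gives B(-z) = B(z) + z. In particular the coefficients of odd index other than 1
  vanish.\<close>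

lemma bernoulli_coeff_uminus:
  "(-1) ^ k * bernoulli_coeff k = bernoulli_coeff k + (if k = 1 then 1 else 0)"
proof -
  let ?E = "fps_exp (1::rat)" and ?B = "fps_X / (fps_exp (1::rat) - 1)"
  let ?C = "fps_compose ?B (- fps_X)"
  have fps_X_neg0: "fps_nth (- fps_X :: rat fps) 0 = 0" by simp
  have "fps_compose ?E (- fps_X) = fps_exp (-1)"
    by (simp add: fps_eq_iff fps_compose_uminus')
  hence "fps_compose (?B * (?E - 1)) (- fps_X) = ?C * (fps_exp (-1) - 1)"
    by (simp only: fps_compose_mult_distrib fps_compose_sub_distrib fps_compose_1 fps_X_neg0 fps_compose_mult_distrib[OF fps_X_neg0])
  hence "?C * (fps_exp (-1) - 1) = - fps_X"
    by (simp add: bernoulli_recurrence_fps)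
  hence "?C * (fps_exp (-1) - 1) * ?E = - fps_X * ?E" by simp
  moreover have "fps_exp (-1) * ?E = 1"
    by (simp flip: fps_exp_add_mult)
  moreover have "?C * (fps_exp (-1) - 1) * ?E = ?C * (fps_exp (-1) * ?E - ?E)"
    by (simp only: mult.assoc mult_1_left left_diff_distrib)
  ultimately have "?C * (1 - ?E) = - fps_X * ?E"
    by (simp only:)
  hence "?C * (?E - 1) = fps_X * ?E"
    by (simp add: algebra_simps)
  also have "\<dots> = (?B + fps_X) * (?E - 1)"
  proof -
    have "?B * ?E = fps_X + ?B"
      using bernoulli_recurrence_fps by (simp add: right_diff_distrib diff_eq_eq)
    thus ?thesis by (simp add: algebra_simps)
  qed
  finally have "?C = ?B + fps_X"
    using subdegree_exp_minus_one by force
  hence "fps_nth ?C k = bernoulli_coeff k + (if k = 1 then 1 else 0)"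
    by (simp add: bernoulli_coeff_def)
  moreover have "fps_nth ?C k = (-1) ^ k * bernoulli_coeff k"
    by (simp add: bernoulli_coeff_def fps_compose_uminus')
  ultimately show ?thesis by simp
qed

section \<open>Bernoulli polynomials and complex powers of positive reals\<close>

lemma of_rat_fact: "of_rat (fact n) = (fact n :: 'a :: field_char_0)"
  by (metis of_nat_fact of_rat_of_nat_eq)

text \<open>These are the Bernoulli polynomials divided by \<open>k!\<close>, so that each is the derivative of the next.\<close>

definition bern_poly :: "nat \<Rightarrow> complex \<Rightarrow> complex" where
  "bern_poly k z = (\<Sum>i\<le>k. of_rat (bernoulli_coeff (k - i)) * z ^ i / fact i)"

lemma bern_poly_0 [simp]: "bern_poly 0 z = 1"
  by (simp add: bern_poly_def)

lemma bern_poly_at_0: "bern_poly k 0 = of_rat (bernoulli_coeff k)"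
  by (simp add: bern_poly_def power_0_left if_distrib[of "\<lambda>x. _ * x / _"] sum.delta cong: if_cong)

text \<open>Read backwards, the sum is the Bernoulli recurrence plus its top term. So only the
  linear polynomial takes different values at 0 and 1, and for all higher ones the boundary terms of
  an integration by parts will telescope.\<close>

lemma bern_poly_at_1: "bern_poly (Suc k) 1 = of_rat (bernoulli_coeff (Suc k)) + (if k = 0 then 1 else 0)"
proof -
  have "bern_poly (Suc k) 1 = of_rat (\<Sum>i\<le>Suc k. bernoulli_coeff (Suc k - i) / fact i)"
    by (simp add: bern_poly_def of_rat_sum of_rat_divide of_rat_fact del: sum.atMost_Suc)
  also have "(\<Sum>i\<le>Suc k. bernoulli_coeff (Suc k - i) / fact i) =
      (\<Sum>i\<le>Suc k. bernoulli_coeff i / fact (Suc k - i))"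
    by (subst sum.nat_diff_reindex[symmetric, of _ "Suc (Suc k)", unfolded lessThan_Suc_atMost])
       (auto intro!: sum.cong)
  also have "\<dots> = bernoulli_coeff (Suc k) + (if k = 0 then 1 else 0)"
    by (simp add: bernoulli_coeff_recurrence)
  finally show ?thesis by (simp add: of_rat_add)
qed

lemma bern_poly_deriv: "(bern_poly (Suc k) has_field_derivative bern_poly k z) (at z)"
proof -
  have pow: "((\<lambda>z. z ^ Suc i) has_field_derivative of_nat (Suc i) * z ^ i) (at z)" for i and z :: complex
    using DERIV_power[OF DERIV_ident, where n = "Suc i" and x = z and s = UNIV] by simp
  have "((\<lambda>z. of_rat (bernoulli_coeff (Suc k)) +
      (\<Sum>i\<le>k. of_rat (bernoulli_coeff (k - i)) * z ^ Suc i / fact (Suc i)))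
      has_field_derivative 0 + (\<Sum>i\<le>k. of_rat (bernoulli_coeff (k - i)) *
        (of_nat (Suc i) * z ^ i) / fact (Suc i))) (at z)"
    by (intro DERIV_add DERIV_const DERIV_sum DERIV_cdivide DERIV_cmult pow)
  moreover have "0 + (\<Sum>i\<le>k. of_rat (bernoulli_coeff (k - i)) *
        (of_nat (Suc i) * z ^ i) / fact (Suc i)) = bern_poly k z"
    unfolding bern_poly_def by (auto intro!: sum.cong simp: field_simps simp del: of_nat_Suc)
  moreover have "(\<lambda>z. of_rat (bernoulli_coeff (Suc k)) +
      (\<Sum>i\<le>k. of_rat (bernoulli_coeff (k - i)) * z ^ Suc i / fact (Suc i))) = bern_poly (Suc k)"
    unfolding bern_poly_def sum.atMost_Suc_shift by (simp add: fun_eq_iff)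
  ultimately show ?thesis by simp
qed

lemma continuous_on_bern_poly [continuous_intros]:
  "continuous_on A f \<Longrightarrow> continuous_on A (\<lambda>x. bern_poly k (f x))"
  unfolding bern_poly_def by (intro continuous_intros) auto

text \<open>The power \<open>x\<^sup>w\<close> for \<open>x > 0\<close>, written without a case distinction at \<open>x = 0\<close> so that it is
  visibly holomorphic in \<open>w\<close> and jointly continuous.\<close>

definition rpow :: "real \<Rightarrow> complex \<Rightarrow> complex" where
  "rpow x w = exp (w * of_real (ln x))"

lemma norm_rpow: "x > 0 \<Longrightarrow> norm (rpow x w) = x powr Re w"
  by (simp add: rpow_def powr_def)

lemma rpow_1 [simp]: "rpow 1 w = 1"
  by (simp add: rpow_def)

lemma rpow_of_nat: "n > 0 \<Longrightarrow> rpow (real n) w = of_nat n powr w"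
  by (simp add: rpow_def powr_def Ln_of_nat)

lemma rpow_deriv:
  assumes "x + t > 0"
  shows "((\<lambda>t. rpow (x + t) w) has_vector_derivative w * rpow (x + t) (w - 1)) (at t within A)"
proof -
  have "((\<lambda>t. w * of_real (ln (x + t))) has_vector_derivative w * of_real (1 / (x + t))) (at t within A)"
    using assms
    by (intro has_vector_derivative_mult_right has_vector_derivative_of_real)
       (auto intro!: derivative_eq_intros simp flip: has_real_derivative_iff_has_vector_derivative)
  hence "(exp \<circ> (\<lambda>t. w * of_real (ln (x + t))) has_vector_derivative
      w * of_real (1 / (x + t)) * exp (w * of_real (ln (x + t)))) (at t within A)"
    by (rule field_vector_diff_chain_within) (rule has_field_derivative_at_within, rule DERIV_exp)
  moreover have "exp ((w - 1) * of_real (ln (x + t))) = exp (w * of_real (ln (x + t))) / of_real (x + t)"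
    using assms by (simp add: ring_distribs exp_diff exp_of_real)
  ultimately show ?thesis
    by (simp add: rpow_def o_def field_simps)
qed

section \<open>Remainder integrals of Euler-Maclaurin summation\<close>

definition bern_int :: "nat \<Rightarrow> real \<Rightarrow> complex \<Rightarrow> complex" where
  "bern_int k x s = integral {0..1} (\<lambda>t. bern_poly k (of_real t) * rpow (x + t) (- s - of_nat k))"

lemma continuous_on_rpow:
  assumes "continuous_on A f" "continuous_on A g" "\<And>y. y \<in> A \<Longrightarrow> f y > 0"
  shows "continuous_on A (\<lambda>y. rpow (f y) (g y))"
  unfolding rpow_def by (intro continuous_intros assms) (use assms(3) in force)

lemma bern_int_integrable:
  assumes "x > 0"
  shows "(\<lambda>t. bern_poly k (of_real t) * rpow (x + t) w) integrable_on {0..1}"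
  by (intro integrable_continuous_real continuous_intros continuous_on_rpow) (use assms in auto)

text \<open>Differentiation under the integral sign; \<open>x > 0\<close> keeps
  \<open>ln (x + t)\<close> continuous on the whole closed interval.\<close>

lemma bern_int_holomorphic:
  assumes "x > 0"
  shows "bern_int k x holomorphic_on UNIV"
proof -
  have "(\<lambda>s. integral (cbox 0 1) (\<lambda>t. bern_poly k (of_real t) * rpow (x + t) (- s - of_nat k)))
      holomorphic_on UNIV"
  proof (rule leibniz_rule_holomorphic)
    show "((\<lambda>s. bern_poly k (of_real t) * rpow (x + t) (- s - of_nat k)) has_field_derivative
       bern_poly k (of_real t) * (- of_real (ln (x + t)) * rpow (x + t) (- s - of_nat k))) (at s within UNIV)"
      for s t unfolding rpow_def by (auto intro!: derivative_eq_intros)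
    show "(\<lambda>t. bern_poly k (of_real t) * rpow (x + t) (- s - of_nat k)) integrable_on cbox 0 1" for s
      using bern_int_integrable[OF assms] by simp
    show "continuous_on (UNIV \<times> cbox 0 1) (\<lambda>(s, t). bern_poly k (of_real t) *
        (- of_real (ln (x + t)) * rpow (x + t) (- s - of_nat k)))"
      unfolding case_prod_unfold
      by (intro continuous_intros continuous_on_rpow) (use assms in auto)
  qed auto
  thus ?thesis by (simp add: bern_int_def[abs_def])
qed

text \<open>Integration by parts with the antiderivative \<open>bern_poly (Suc k)\<close>. Up to
  sign, \<open>bern_int k x s\<close> is the Euler-Maclaurin remainder of the power with exponent
  \<open>-s\<close> between \<open>x\<close> and \<open>x + 1\<close>, stripped of the factor s (s +
  1) ... (s + k - 1); one further such factor is split off here.\<close>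

lemma bern_int_step:
  assumes "x > 0"
  shows "bern_int k x s = bern_poly (Suc k) 1 * rpow (x + 1) (- s - of_nat k)
      - bern_poly (Suc k) 0 * rpow x (- s - of_nat k) + (s + of_nat k) * bern_int (Suc k) x s"
proof -
  let ?w = "- s - of_nat k"
  have "((\<lambda>t. bern_poly (Suc k) (of_real t) * rpow (x + t) ?w) has_vector_derivative
     bern_poly (Suc k) (of_real t) * (?w * rpow (x + t) (?w - 1)) + bern_poly k (of_real t) * rpow (x + t) ?w)
       (at t within {0..1})" if "t \<in> {0..1}" for t
    using that assms
    by (intro has_vector_derivative_mult has_vector_derivative_real_field rpow_deriv bern_poly_deriv) auto
  from fundamental_theorem_of_calculus[OF _ this]
  have "((\<lambda>t. bern_poly (Suc k) (of_real t) * (?w * rpow (x + t) (?w - 1)) +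
      bern_poly k (of_real t) * rpow (x + t) ?w) has_integral
      bern_poly (Suc k) 1 * rpow (x + 1) ?w - bern_poly (Suc k) 0 * rpow x ?w) {0..1}"
    by simp
  moreover have "((\<lambda>t. bern_poly (Suc k) (of_real t) * rpow (x + t) (- s - of_nat (Suc k))) has_integral
      bern_int (Suc k) x s) {0..1}"
    unfolding bern_int_def by (intro integrable_integral bern_int_integrable assms)
  hence "((\<lambda>t. ?w * (bern_poly (Suc k) (of_real t) * rpow (x + t) (- s - of_nat (Suc k)))) has_integral
      ?w * bern_int (Suc k) x s) {0..1}"
    by (rule has_integral_mult_right)
  ultimately have "((\<lambda>t. (bern_poly (Suc k) (of_real t) * (?w * rpow (x + t) (?w - 1)) +
      bern_poly k (of_real t) * rpow (x + t) ?w) -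
      ?w * (bern_poly (Suc k) (of_real t) * rpow (x + t) (- s - of_nat (Suc k)))) has_integral
      (bern_poly (Suc k) 1 * rpow (x + 1) ?w - bern_poly (Suc k) 0 * rpow x ?w) -
      ?w * bern_int (Suc k) x s) {0..1}"
    by (rule has_integral_diff)
  moreover have "?w - 1 = - s - of_nat (Suc k)" by simp
  ultimately have "((\<lambda>t. bern_poly k (of_real t) * rpow (x + t) ?w) has_integral
      (bern_poly (Suc k) 1 * rpow (x + 1) ?w - bern_poly (Suc k) 0 * rpow x ?w) -
      ?w * bern_int (Suc k) x s) {0..1}"
    by (simp add: algebra_simps)
  thus ?thesis unfolding bern_int_def
    by (simp add: integral_unique algebra_simps)
qed

text \<open>\<open>M\<close> bounds the Bernoulli polynomial on the unit interval, and the power is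
  largest at \<open>t = 0\<close> because its exponent has nonpositive real part. That
  \<open>M\<close> depends neither on \<open>x\<close> nor on \<open>s\<close> is what the uniform
  convergence below rests on.\<close>

lemma bern_int_bound:
  obtains M where "M \<ge> 0"
    "\<And>x s. \<lbrakk>x > 0; Re s + real k \<ge> 0\<rbrakk> \<Longrightarrow> norm (bern_int k x s) \<le> M * x powr (- Re s - real k)"
proof -
  have "compact ((\<lambda>t. bern_poly k (of_real t)) ` {0..1})"
    by (intro compact_continuous_image continuous_intros) auto
  then obtain M where M: "\<And>t. t \<in> {0..1} \<Longrightarrow> norm (bern_poly k (of_real t)) \<le> M"
    by (force dest!: compact_imp_bounded simp: bounded_iff)
  from M[of 0] have "M \<ge> 0" by (smt (verit) norm_ge_zero atLeastAtMost_iff)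
  show ?thesis
  proof (rule that[OF \<open>M \<ge> 0\<close>])
    fix x :: real and s :: complex assume x: "x > 0" and s: "Re s + real k \<ge> 0"
    have "norm (bern_int k x s) \<le> (M * x powr (- Re s - real k)) * measure lborel (cbox 0 (1::real))"
    proof (rule has_integral_bound)
      show "((\<lambda>t. bern_poly k (of_real t) * rpow (x + t) (- s - of_nat k)) has_integral bern_int k x s) (cbox 0 1)"
        unfolding bern_int_def using bern_int_integrable[OF x] by (simp add: integrable_integral)
      fix t :: real assume "t \<in> cbox 0 1"
      hence t: "0 \<le> t" "t \<le> 1" by auto
      have "(x + t) powr (- Re s - real k) \<le> x powr (- Re s - real k)"
        using x t s by (intro powr_mono2') auto
      thus "norm (bern_poly k (of_real t) * rpow (x + t) (- s - of_nat k)) \<le> M * x powr (- Re s - real k)"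
        using M[of t] t x \<open>M \<ge> 0\<close> by (simp add: norm_mult norm_rpow mult_mono)
    qed (use \<open>M \<ge> 0\<close> in auto)
    thus "norm (bern_int k x s) \<le> M * x powr (- Re s - real k)" by simp
  qed
qed

section \<open>Summing the remainders over the positive integers\<close>

lemma summable_Suc_powr: "a < - 1 \<Longrightarrow> summable (\<lambda>n. real (Suc n) powr a)"
  using summable_real_powr_iff[of a] by (subst summable_Suc_iff) simp

definition bern_sum :: "nat \<Rightarrow> complex \<Rightarrow> complex" where
  "bern_sum k s = suminf (\<lambda>n. bern_int k (real (Suc n)) s)"

lemma bern_sum_sums:
  assumes "Re s > 1 - real k"
  shows "(\<lambda>n. bern_int k (real (Suc n)) s) sums bern_sum k s"
proof -
  obtain M where M: "\<And>x s. \<lbrakk>x > 0; Re s + real k \<ge> 0\<rbrakk> \<Longrightarrow> norm (bern_int k x s) \<le> M * x powr (- Re s - real k)"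
    using bern_int_bound by blast
  have "summable (\<lambda>n. M * real (Suc n) powr (- Re s - real k))"
    by (intro summable_mult summable_Suc_powr) (use assms in auto)
  hence "summable (\<lambda>n. bern_int k (real (Suc n)) s)"
    by (rule summable_comparison_test') (use assms in \<open>auto intro!: M\<close>)
  thus ?thesis unfolding bern_sum_def by (rule summable_sums)
qed

text \<open>The partial sums are holomorphic and converge uniformly on small closed discs by the
  Weierstrass test.\<close>

lemma bern_sum_holomorphic: "bern_sum k holomorphic_on {s. Re s > 1 - real k}"
proof (rule holomorphic_uniform_sequence)
  show "open {s. Re s > 1 - real k}" by (simp add: open_halfspace_Re_gt)
  show "(\<lambda>s. \<Sum>i<n. bern_int k (real (Suc i)) s) holomorphic_on {s. Re s > 1 - real k}" for n
    by (intro holomorphic_intros holomorphic_on_subset[OF bern_int_holomorphic]) auto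
  fix s0 assume "s0 \<in> {s. Re s > 1 - real k}"
  \<comment> \<open>Half the distance from \<open>s0\<close> to the line bounding the half-plane, so
    that \<open>Re s + k\<close> stays at least \<open>1 + d\<close> on the disc and the majorant
    has exponent \<open>- 1 - d\<close>.\<close>
  define d where "d = (Re s0 + real k - 1) / 2"
  have d: "d > 0" "Re s0 = 1 + 2 * d - real k" using \<open>s0 \<in> _\<close> by (auto simp: d_def field_simps)
  have cb: "Re s + real k \<ge> 1 + d" if "s \<in> cball s0 d" for s
  proof -
    have "\<bar>Re (s0 - s)\<bar> \<le> norm (s0 - s)" by (rule abs_Re_le_cmod)
    thus ?thesis using that d(2) by (simp add: dist_norm)
  qed
  obtain M where M: "M \<ge> 0" "\<And>x s. \<lbrakk>x > 0; Re s + real k \<ge> 0\<rbrakk> \<Longrightarrow> norm (bern_int k x s) \<le> M * x powr (- Re s - real k)"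
    using bern_int_bound by blast
  have "uniform_limit (cball s0 d) (\<lambda>n s. \<Sum>i<n. bern_int k (real (Suc i)) s)
          (\<lambda>s. suminf (\<lambda>n. bern_int k (real (Suc n)) s)) sequentially"
  proof (rule Weierstrass_m_test)
    show "summable (\<lambda>n. M * real (Suc n) powr (- 1 - d))"
      by (intro summable_mult summable_Suc_powr) (use d in auto)
    fix n s assume "s \<in> cball s0 d"
    hence "Re s + real k \<ge> 1 + d" by (rule cb)
    moreover from this d have "norm (bern_int k (real (Suc n)) s) \<le> M * real (Suc n) powr (- Re s - real k)"
      by (intro M) auto
    ultimately show "norm (bern_int k (real (Suc n)) s) \<le> M * real (Suc n) powr (- 1 - d)"
      using M(1) by (elim order.trans) (intro mult_left_mono powr_mono, auto)
  qed
  thus "\<exists>d>0. cball s0 d \<subseteq> {s. Re s > 1 - real k} \<and>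
      uniform_limit (cball s0 d) (\<lambda>n s. \<Sum>i<n. bern_int k (real (Suc i)) s) (bern_sum k) sequentially"
    using d cb by (intro exI[of _ d]) (force simp: bern_sum_def[abs_def])
qed

lemma rpow_tendsto_0:
  assumes "Re w < 0"
  shows "(\<lambda>n. rpow (real (Suc n)) w) \<longlonglongrightarrow> 0"
proof (rule tendsto_norm_zero_cancel)
  have "(\<lambda>n. real (Suc n) powr Re w) \<longlonglongrightarrow> 0"
    using assms by (intro tendsto_neg_powr filterlim_compose[OF filterlim_real_sequentially filterlim_Suc])
  thus "(\<lambda>n. norm (rpow (real (Suc n)) w)) \<longlonglongrightarrow> 0"
    by (subst norm_rpow) auto
qed

lemma rpow_telescope:
  assumes "Re w < 0"
  shows "(\<lambda>n. rpow (real (Suc n) + 1) w - rpow (real (Suc n)) w) sums (- 1)"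
  using telescope_sums[OF rpow_tendsto_0[OF assms]] by (simp add: add_ac)

text \<open>Sum \<open>bern_int_step\<close> over the integers. For \<open>k > 0\<close> the two
  boundary values of \<open>bern_poly (Suc k)\<close> coincide, so the boundary terms
  telescope.\<close>

lemma bern_sum_step:
  assumes "Re s > 1 - real k" "k > 0"
  shows "bern_sum k s = - of_rat (bernoulli_coeff (Suc k)) + (s + of_nat k) * bern_sum (Suc k) s"
proof -
  let ?b = "of_rat (bernoulli_coeff (Suc k)) :: complex" and ?w = "- s - of_nat k"
  have "(\<lambda>n. ?b * (rpow (real (Suc n) + 1) ?w - rpow (real (Suc n)) ?w) +
      (s + of_nat k) * bern_int (Suc k) (real (Suc n)) s) sums
      (?b * (- 1) + (s + of_nat k) * bern_sum (Suc k) s)"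
    by (intro sums_add sums_mult rpow_telescope bern_sum_sums) (use assms in auto)
  moreover have "?b * (rpow (real (Suc n) + 1) ?w - rpow (real (Suc n)) ?w) +
      (s + of_nat k) * bern_int (Suc k) (real (Suc n)) s = bern_int k (real (Suc n)) s" for n
    using assms by (subst bern_int_step[of _ k]) (auto simp: bern_poly_at_0 bern_poly_at_1 algebra_simps)
  ultimately show ?thesis
    using bern_sum_sums[OF assms(1)] by (auto dest: sums_unique2)
qed

text \<open>For \<open>k = 0\<close> the boundary values are 1/2 and -1/2, so
  \<open>bern_int_step\<close> can be solved for the single power of \<open>n + 1\<close>. The
  integral \<open>bern_int 0\<close> has an elementary antiderivative and telescopes to
  \<open>1 / (s - 1)\<close>, and the difference of boundary powers to 1/2.\<close>

lemma zeta_sum_eq: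
  assumes "Re s > 1"
  shows "(\<lambda>n. of_nat (Suc n) powr (- s)) sums (1 / (s - 1) + 1 / 2 - s * bern_sum 1 s)"
proof -
  have s1: "s \<noteq> 1" using assms by auto
  let ?g = "\<lambda>n. rpow (real (Suc n)) (- s)"
  have *: "((\<lambda>t. rpow (x + t) (- s)) has_integral
     (rpow (x + 1) (1 - s) / (1 - s) - rpow x (1 - s) / (1 - s))) {0..1}" if "x > 0" for x
  proof -
    have "((\<lambda>t. rpow (x + t) (1 - s) / (1 - s)) has_vector_derivative
        ((1 - s) * rpow (x + t) (1 - s - 1)) / (1 - s)) (at t within {0..1})" if "t \<in> {0..1}" for t
      using that \<open>x > 0\<close> by (intro has_vector_derivative_divide rpow_deriv) auto
    from fundamental_theorem_of_calculus[OF _ this] show ?thesis using s1 by simp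
  qed
  have int0: "bern_int 0 x s = (-1 / (s - 1)) * (rpow (x + 1) (1 - s) - rpow x (1 - s))" if "x > 0" for x
    using integral_unique[OF *[OF that]] s1 by (simp add: bern_int_def divide_simps) (simp add: algebra_simps)
  have "(\<lambda>n. bern_int 0 (real (Suc n)) s) sums ((-1 / (s - 1)) * (-1))"
    unfolding int0[OF of_nat_0_less_iff[THEN iffD2, OF zero_less_Suc]]
    by (intro sums_mult rpow_telescope) (use assms in auto)
  moreover have "(\<lambda>n. s * bern_int 1 (real (Suc n)) s) sums (s * bern_sum 1 s)"
    by (intro sums_mult bern_sum_sums) (use assms in auto)
  moreover have "(\<lambda>n. 1/2 * (rpow (real (Suc n) + 1) (-s) - rpow (real (Suc n)) (-s))) sums (1/2 * (-1))"
    by (intro sums_mult rpow_telescope) (use assms in auto)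
  ultimately have "(\<lambda>n. bern_int 0 (real (Suc n)) s - s * bern_int 1 (real (Suc n)) s
      - 1/2 * (rpow (real (Suc n) + 1) (-s) - rpow (real (Suc n)) (-s))) sums
      ((-1 / (s - 1)) * (-1) - s * bern_sum 1 s - 1/2 * (-1))"
    by (intro sums_diff)
  moreover have "bern_int 0 (real (Suc n)) s - s * bern_int 1 (real (Suc n)) s
      - 1/2 * (rpow (real (Suc n) + 1) (-s) - rpow (real (Suc n)) (-s)) = of_nat (Suc n) powr (- s)" for n
    unfolding rpow_of_nat[OF zero_less_Suc, symmetric]
    by (subst bern_int_step[of _ 0])
       (simp_all add: bern_poly_at_0 bern_poly_at_1 of_rat_divide of_rat_minus algebra_simps)
  ultimately have "(\<lambda>n. of_nat (Suc n) powr (- s)) sums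
      ((-1 / (s - 1)) * (-1) - s * bern_sum 1 s - 1/2 * (-1))"
    by (simp only:)
  moreover have "(-1 / (s - 1)) * (-1) - s * bern_sum 1 s - 1/2 * (-1) = 1 / (s - 1) + 1 / 2 - s * bern_sum 1 s"
    by simp
  ultimately show ?thesis by (simp only:)
qed

section \<open>Analytic continuation to the whole plane and values at negative integers\<close>

fun bern_ext :: "nat \<Rightarrow> nat \<Rightarrow> complex \<Rightarrow> complex" where
  "bern_ext 0 k s = bern_sum k s"
| "bern_ext (Suc m) k s = - of_rat (bernoulli_coeff (Suc k)) + (s + of_nat k) * bern_ext m (Suc k) s"

text \<open>\<open>bern_ext m k\<close> is \<open>bern_sum_step\<close> unrolled \<open>m\<close>
  times starting from index \<open>k\<close>. Only \<open>bern_sum (k + m)\<close> remains at the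
  bottom, and each unrolling moves the boundary of its half-plane one unit to the left.\<close>

lemma bern_ext_holomorphic: "bern_ext m k holomorphic_on {s. Re s > 1 - real (k + m)}"
proof (induction m arbitrary: k)
  case 0
  show ?case using bern_sum_holomorphic[of k] by (simp add: bern_ext.simps(1)[abs_def] cong: holomorphic_cong)
next
  case (Suc m)
  show ?case unfolding bern_ext.simps
    by (intro holomorphic_intros holomorphic_on_subset[OF Suc]) auto
qed

text \<open>One more unrolling changes only the innermost \<open>bern_sum\<close>, to which
  \<open>bern_sum_step\<close> applies on the given half-plane.\<close>

lemma bern_ext_Suc: "k > 0 \<Longrightarrow> Re s > 1 - real (k + m) \<Longrightarrow> bern_ext (Suc m) k s = bern_ext m k s"
proof (induction m arbitrary: k)
  case 0
  thus ?case using bern_sum_step[of k s] by simp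
next
  case (Suc m)
  from Suc.IH[of "Suc k"] Suc.prems show ?case by simp
qed

lemma bern_ext_mono:
  assumes "m \<le> m'" "k > 0" "Re s > 1 - real (k + m)"
  shows "bern_ext m' k s = bern_ext m k s"
  using assms(1)
proof (induction m' rule: dec_induct)
  case (step m')
  thus ?case using bern_ext_Suc[of k m' s] assms by simp
qed auto

text \<open>The number of unrollings is chosen from \<open>s\<close> just so that, for
  \<open>k > 0\<close>, the point \<open>s\<close> lies in the half-plane where
  \<open>bern_ext\<close> is holomorphic.\<close>

definition bern_cont :: "nat \<Rightarrow> complex \<Rightarrow> complex" where
  "bern_cont k s = bern_ext (nat (\<lceil>- Re s\<rceil> + 1)) k s"

lemma bern_cont_eq:
  assumes "k > 0" "Re s > 1 - real (k + m)"
  shows "bern_cont k s = bern_ext m k s"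
proof -
  let ?m = "nat (\<lceil>- Re s\<rceil> + 1)"
  have "real ?m \<ge> - Re s + 1" by linarith
  hence "Re s > 1 - real (k + ?m)" using assms by auto
  thus ?thesis unfolding bern_cont_def
    using assms bern_ext_mono[of m ?m] bern_ext_mono[of ?m m] by (metis nle_le)
qed

text \<open>Holomorphy is local, and on each of the half-planes, which exhaust the plane,
  \<open>bern_cont\<close> agrees with one fixed \<open>bern_ext m\<close>.\<close>

lemma bern_cont_holomorphic: "k > 0 \<Longrightarrow> bern_cont k holomorphic_on UNIV"
proof -
  assume k: "k > 0"
  have "bern_cont k holomorphic_on (\<Union>m. {s. Re s > 1 - real (k + m)})"
  proof (rule holomorphic_on_UN_open)
    fix m
    have "bern_cont k holomorphic_on {s. Re s > 1 - real (k + m)} \<longleftrightarrow>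
       bern_ext m k holomorphic_on {s. Re s > 1 - real (k + m)}"
      by (rule holomorphic_cong) (use bern_cont_eq[OF k] in auto)
    thus "bern_cont k holomorphic_on {s. Re s > 1 - real (k + m)}"
      using bern_ext_holomorphic by blast
    show "open {s. Re s > 1 - real (k + m)}" by (rule open_halfspace_Re_gt)
  qed
  moreover have "(\<Union>m. {s. Re s > 1 - real (k + m)}) = UNIV"
  proof (intro equalityI subsetI UNIV_I)
    fix s :: complex
    obtain m where "1 - Re s < real m" using reals_Archimedean2 by blast
    hence "Re s > 1 - real (k + m)" by auto
    thus "s \<in> (\<Union>m. {s. Re s > 1 - real (k + m)})" by blast
  qed
  ultimately show ?thesis by simp
qed

lemma bern_cont_step:
  assumes "k > 0"
  shows "bern_cont k s = - of_rat (bernoulli_coeff (Suc k)) + (s + of_nat k) * bern_cont (Suc k) s"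
proof -
  obtain m where "1 - Re s < real m" using reals_Archimedean2 by blast
  thus ?thesis
    using bern_cont_eq[where k=k and s=s and m="Suc m"] bern_cont_eq[where k="Suc k" and s=s and m=m] assms by auto
qed

text \<open>The recursion \<open>bern_cont_step\<close> stops at these points: with
  \<open>s = - (k + d)\<close>, raising \<open>k\<close> by \<open>d\<close> makes the factor
  \<open>s + k\<close> vanish, so no transcendental remainder survives.\<close>

lemma bern_cont_neg:
  assumes "k > 0"
  shows "bern_cont k (- of_nat (k + d)) =
    of_rat (- (\<Sum>j\<le>d. (-1) ^ j * fact d / fact (d - j) * bernoulli_coeff (Suc (k + j))))"
  using assms
proof (induction d arbitrary: k)
  case 0
  thus ?case by (subst bern_cont_step) (auto simp: of_rat_minus)
next
  case (Suc d)
  have "bern_cont k (- of_nat (k + Suc d)) = - of_rat (bernoulli_coeff (Suc k))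
     - of_nat (Suc d) * bern_cont (Suc k) (- of_nat (Suc k + d))"
    using Suc.prems by (subst bern_cont_step) (auto simp: algebra_simps)
  also have "\<dots> = of_rat (- (bernoulli_coeff (Suc k) - of_nat (Suc d) *
     (\<Sum>j\<le>d. (-1) ^ j * fact d / fact (d - j) * bernoulli_coeff (Suc (Suc k + j)))))"
    by (subst Suc.IH) (simp_all add: of_rat_minus of_rat_mult of_rat_diff of_rat_add)
  also have "bernoulli_coeff (Suc k) - of_nat (Suc d) *
     (\<Sum>j\<le>d. (-1) ^ j * fact d / fact (d - j) * bernoulli_coeff (Suc (Suc k + j))) =
     (\<Sum>j\<le>Suc d. (-1) ^ j * fact (Suc d) / fact (Suc d - j) * bernoulli_coeff (Suc (k + j)))"
    unfolding sum.atMost_Suc_shift by (simp add: sum_distrib_left sum_negf[symmetric] mult_ac)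
  finally show ?case .
qed

text \<open>In the finite sum of \<open>bern_cont_neg\<close> the signs may be dropped, since the
  indices are at least 2 and odd ones contribute nothing. The sum is then the Bernoulli recurrence
  without its first two terms and with one extra term. Those two terms cancel
  \<open>1 / (s - 1) + 1 / 2\<close>, leaving the extra one.\<close>

lemma zeta_cont_neg:
  assumes "p > 0"
  shows "1 / (- of_nat p - 1) + 1 / 2 - (- of_nat p) * bern_cont 1 (- of_nat p) =
    (of_rat ((-1) ^ p * bernoulli_num (p + 1) / of_nat (p + 1)) :: complex)"
proof -
  obtain d where p: "p = Suc d" using assms gr0_implies_Suc by blast
  let ?b = bernoulli_coeff
  let ?s = "\<lambda>i::nat. (if i = 1 then 1 else 0) :: rat"
  have "of_nat p * (\<Sum>j\<le>d. (-1) ^ j * fact d / fact (d - j) * ?b (Suc (1 + j))) =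
      fact p * (\<Sum>j\<le>d. (-1) ^ j * ?b (Suc (Suc j)) / fact (d - j))"
    by (simp add: sum_distrib_left p mult_ac)
  also have "(\<Sum>j\<le>d. (-1) ^ j * ?b (Suc (Suc j)) / fact (d - j)) =
      (\<Sum>j\<le>d. ?b (Suc (Suc j)) / fact (d - j))"
  proof (rule sum.cong[OF refl])
    fix j
    show "(-1) ^ j * ?b (Suc (Suc j)) / fact (d - j) = ?b (Suc (Suc j)) / fact (d - j)"
      using bernoulli_coeff_uminus[of "Suc (Suc j)"] by simp
  qed
  also have "\<dots> = (\<Sum>i\<le>p. ?b i / fact (Suc p - i)) + ?b (Suc p) - 1 / fact (Suc p) + 1 / 2 / fact p"
  proof -
    have "(\<Sum>i\<le>Suc p. ?b i / fact (Suc p - i)) = (\<Sum>j\<le>d. ?b (Suc (Suc j)) / fact (d - j))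
       + 1 / fact (Suc p) - 1 / 2 / fact p"
      unfolding p sum.atMost_Suc_shift[of _ "Suc _"] sum.atMost_Suc_shift[of _ d] by simp
    thus ?thesis by simp
  qed
  also have "\<dots> = ?b (Suc p) - 1 / fact (Suc p) + 1 / 2 / fact p"
    using assms by (simp add: bernoulli_coeff_recurrence)
  finally have "of_nat p * (\<Sum>j\<le>d. (-1) ^ j * fact d / fact (d - j) * ?b (Suc (1 + j))) =
     fact p * (?b (Suc p) - 1 / fact (Suc p) + 1 / 2 / fact p)" .
  also have "\<dots> = fact p * ?b (Suc p) - fact p / fact (Suc p) + 1 / 2"
    by (simp add: ring_distribs right_diff_distrib del: fact_Suc)
  also have "fact p / fact (Suc p) = (1 / of_nat (Suc p) :: rat)"
    by simp
  finally have eq: "of_nat p * (\<Sum>j\<le>d. (-1) ^ j * fact d / fact (d - j) * ?b (Suc (1 + j))) =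
     fact p * ?b (Suc p) - 1 / of_nat (Suc p) + 1 / 2" .
  have sgn: "(-1) ^ p * ?b (Suc p) = - ?b (Suc p)"
    using bernoulli_coeff_uminus[of "Suc p"] assms by simp
  have "of_nat p * bern_cont 1 (- of_nat p) =
      of_rat (- (of_nat p * (\<Sum>j\<le>d. (-1) ^ j * fact d / fact (d - j) * ?b (Suc (1 + j)))))"
    unfolding of_rat_minus of_rat_mult of_rat_of_nat_eq using bern_cont_neg[of 1 d]
    by (simp add: p of_rat_minus del: of_nat_Suc)
  also have "\<dots> = - (of_rat (fact p * ?b (Suc p)) - 1 / of_nat (Suc p) + 1 / 2)"
    unfolding eq by (simp add: of_rat_minus of_rat_add of_rat_diff of_rat_divide of_rat_mult)
  finally have "of_nat p * bern_cont 1 (- of_nat p) = \<dots>" .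
  moreover have "(-1) ^ p * bernoulli_num (p + 1) / of_nat (p + 1) = - (fact p * ?b (Suc p))"
    using sgn by (simp add: bernoulli_num_eq field_simps)
  moreover have "1 / (- of_nat p - 1) = - (1 / of_nat (Suc p) :: complex)"
  proof -
    have "- of_nat p - 1 = - (of_nat (Suc p) :: complex)" by simp
    thus ?thesis by (simp only: divide_minus_right)
  qed
  ultimately show ?thesis by (simp add: of_rat_minus)
qed

text \<open>The function \<open>f\<close> witnesses the existence behind the \<open>SOME\<close> in
  \<open>riemann_zeta\<close>, which therefore has the defining properties; the identity theorem on
  the connected punctured plane then carries agreement from the half-plane to
  \<open>s\<close>.\<close>

lemma riemann_zeta_unique:
  assumes "f holomorphic_on - {1}" "\<And>s. 1 < Re s \<Longrightarrow> (\<lambda>n. of_nat (Suc n) powr (- s)) sums f s"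
    and "s \<noteq> 1"
  shows "riemann_zeta s = f s"
proof -
  have "riemann_zeta holomorphic_on - {1} \<and>
     (\<forall>s::complex. 1 < Re s \<longrightarrow> (\<lambda>n. of_nat (Suc n) powr (- s)) sums riemann_zeta s)"
    unfolding riemann_zeta_def by (rule someI[of _ f]) (use assms in blast)
  hence zeta: "riemann_zeta holomorphic_on - {1}"
    "\<And>s. 1 < Re s \<Longrightarrow> (\<lambda>n. of_nat (Suc n) powr (- s)) sums riemann_zeta s" by auto
  show ?thesis
  proof (rule analytic_continuation_open[of "{s. 1 < Re s}" "- {1}" riemann_zeta f s])
    show "{s. 1 < Re s} \<noteq> {}" by (auto intro!: exI[of _ 2])
    show "{s. 1 < Re s} \<subseteq> - {1::complex}" by auto
    show "connected (- {1::complex})" by (rule connected_punctured_universe) simp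
    show "riemann_zeta z = f z" if "z \<in> {s. 1 < Re s}" for z
      using zeta(2) assms(2) that by (auto dest: sums_unique2)
  qed (use assms zeta(1) open_halfspace_Re_gt in auto)
qed

lemma zeta_neg_eq:
  assumes "p > 0"
  shows "zeta_neg p = (-1) ^ p * bernoulli_num (p + 1) / of_nat (p + 1)"
proof -
  let ?f = "\<lambda>s. 1 / (s - 1) + 1 / 2 - s * bern_cont 1 s"
  have "riemann_zeta (- of_nat p) = ?f (- of_nat p)"
  proof (rule riemann_zeta_unique)
    show "?f holomorphic_on - {1}"
      by (intro holomorphic_intros holomorphic_on_subset[OF bern_cont_holomorphic]) auto
    show "(\<lambda>n. of_nat (Suc n) powr (- s)) sums ?f s" if "1 < Re s" for s
      using zeta_sum_eq[OF that] bern_cont_eq[where k=1 and s=s and m=0] that by simp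
    show "- of_nat p \<noteq> (1 :: complex)"
      by (metis of_nat_1 of_nat_0 add.commute add_eq_0_iff of_nat_Suc of_nat_eq_iff nat.distinct(1))
  qed
  hence "riemann_zeta (- of_nat p) = of_rat ((-1) ^ p * bernoulli_num (p + 1) / of_nat (p + 1))"
    using zeta_cont_neg[OF assms] by simp
  \<comment> \<open>The \<open>THE\<close> in \<open>zeta_neg\<close> is well defined because the
    embedding of the rationals is injective.\<close>
  thus ?thesis unfolding zeta_neg_def by (intro the_equality) (auto simp: of_rat_eq_iff)
qed

section \<open>Beta sets of partitions\<close>

definition part_at :: "nat list \<Rightarrow> nat \<Rightarrow> nat" where
  "part_at l i = (if i < length l then l ! i else 0)"

text \<open>The classical beta numbers, with rows counted from 0. When \<open>N\<close> is the
  number of parts they are the hook lengths of the first column.\<close>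

definition beta_set :: "nat \<Rightarrow> nat list \<Rightarrow> nat set" where
  "beta_set N l = (\<lambda>i. part_at l i + (N - 1 - i)) ` {..<N}"

text \<open>The offset is the sum of the beta set of the empty partition, so \<open>n\<close> is the
  size of the encoded partition.\<close>

definition subsets_of_sum :: "nat \<Rightarrow> nat \<Rightarrow> nat set set" where
  "subsets_of_sum N n = {X. finite X \<and> card X = N \<and> \<Sum>X = n + \<Sum>{..<N}}"

lemma is_partition_Nil [simp]: "is_partition []"
  by (simp add: is_partition_def)

lemma is_partition_Cons:
  "is_partition (a # l) \<longleftrightarrow> a > 0 \<and> is_partition l \<and> (\<forall>x\<in>set l. x \<le> a)"
  by (auto simp: is_partition_def)

lemma is_partition_tl: "is_partition l \<Longrightarrow> is_partition (tl l)"
  by (cases l) (auto simp: is_partition_Cons)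

lemma part_at_Nil [simp]: "part_at [] i = 0"
  by (simp add: part_at_def)

lemma part_at_Suc: "part_at l (Suc i) = part_at (tl l) i"
  by (cases l) (auto simp: part_at_def)

lemma part_at_antimono: "is_partition l \<Longrightarrow> i \<le> j \<Longrightarrow> part_at l j \<le> part_at l i"
  by (auto simp: part_at_def is_partition_def sorted_wrt_iff_nth_less le_less)

lemma part_at_pos: "is_partition l \<Longrightarrow> part_at l i > 0 \<longleftrightarrow> i < length l"
  by (auto simp: part_at_def is_partition_def) (metis gr0I nth_mem)

lemma length_le_sum_list: "is_partition l \<Longrightarrow> length l \<le> sum_list l"
  by (induction l) (auto simp: is_partition_Cons)

lemma beta_number_less:
  assumes "is_partition l" "i < j" "j < N"
  shows "part_at l j + (N - 1 - j) < part_at l i + (N - 1 - i)"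
  using part_at_antimono[OF assms(1), of i j] assms(2,3) by linarith

lemma inj_on_beta_number:
  assumes "is_partition l"
  shows "inj_on (\<lambda>i. part_at l i + (N - 1 - i)) {..<N}"
  by (intro inj_onI) (metis beta_number_less[OF assms] lessThan_iff nat_neq_iff)

lemma finite_beta_set [simp]: "finite (beta_set N l)"
  by (simp add: beta_set_def)

lemma sum_beta_set:
  "is_partition l \<Longrightarrow> sum f (beta_set N l) = (\<Sum>i<N. f (part_at l i + (N - 1 - i)))"
  unfolding beta_set_def by (subst sum.reindex[OF inj_on_beta_number]) auto

lemma card_beta_set: "is_partition l \<Longrightarrow> card (beta_set N l) = N"
  unfolding beta_set_def by (subst card_image[OF inj_on_beta_number]) auto

lemma sum_part_at: "length l \<le> N \<Longrightarrow> (\<Sum>i<N. part_at l i) = sum_list l"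
proof (induction N arbitrary: l)
  case (Suc N)
  have "(\<Sum>i<Suc N. part_at l i) = part_at l 0 + (\<Sum>i<N. part_at (tl l) i)"
    unfolding sum.lessThan_Suc_shift part_at_Suc ..
  also have "(\<Sum>i<N. part_at (tl l) i) = sum_list (tl l)"
    using Suc.prems by (intro Suc.IH) auto
  finally show ?case by (cases l) (auto simp: part_at_def)
qed auto

lemma sum_elems_beta_set:
  assumes "is_partition l" "length l \<le> N"
  shows "\<Sum>(beta_set N l) = sum_list l + \<Sum>{..<N}"
proof -
  have "(\<Sum>i<N. N - 1 - i) = \<Sum>{..<N}"
    using sum.nat_diff_reindex[of "\<lambda>x. x" N] by simp
  thus ?thesis using assms by (simp only: sum_beta_set sum.distrib sum_part_at)
qed

text \<open>Lowering \<open>N\<close> and the row index together leaves \<open>N - 1 - i\<close>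
  unchanged. So dropping the first part just drops the largest bead, which allows inductions on
  \<open>N\<close> along \<open>tl\<close>.\<close>

lemma beta_set_Suc: "beta_set (Suc N) l = insert (part_at l 0 + N) (beta_set N (tl l))"
  unfolding beta_set_def lessThan_Suc_eq_insert_0 by (simp add: image_image part_at_Suc)

lemma beta_set_tl_less:
  assumes "is_partition l" "x \<in> beta_set N (tl l)"
  shows "x < part_at l 0 + N"
proof -
  obtain i where "i < N" "x = part_at l (Suc i) + (N - 1 - i)"
    using assms(2) by (auto simp: beta_set_def part_at_Suc)
  thus ?thesis using beta_number_less[OF assms(1), of 0 "Suc i" "Suc N"] by simp
qed

lemma Max_beta_set_Suc: "is_partition l \<Longrightarrow> Max (beta_set (Suc N) l) = part_at l 0 + N"
  unfolding beta_set_Suc by (intro Max_eqI) (auto dest: beta_set_tl_less)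

section \<open>The bijection between partitions and beta sets\<close>

lemma partition_eqI:
  assumes "is_partition l" "is_partition l'" "part_at l 0 = part_at l' 0" "tl l = tl l'"
  shows "l = l'"
proof (cases "l = []")
  case True
  thus ?thesis using assms part_at_pos[of l' 0] by auto
next
  case False
  hence "l' \<noteq> []" using assms part_at_pos[of l 0] by auto
  with False show ?thesis using assms(3,4) by (cases l; cases l') (auto simp: part_at_def)
qed

text \<open>The maximum of the beta set recovers the first part; delete it and use
  induction.\<close>

lemma beta_set_inj:
  assumes "is_partition l" "is_partition l'" "length l \<le> N" "length l' \<le> N"
    "beta_set N l = beta_set N l'"
  shows "l = l'"
  using assms
proof (induction N arbitrary: l l')
  case (Suc N)
  have eq: "part_at l 0 = part_at l' 0"
    using Max_beta_set_Suc[OF Suc.prems(1), of N] Max_beta_set_Suc[OF Suc.prems(2), of N] Suc.prems(5) by simp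
  have "beta_set N (tl l) = beta_set (Suc N) l - {part_at l 0 + N}"
    unfolding beta_set_Suc using beta_set_tl_less[OF Suc.prems(1), of "part_at l 0 + N" N] by auto
  moreover have "beta_set N (tl l') = beta_set (Suc N) l' - {part_at l' 0 + N}"
    unfolding beta_set_Suc using beta_set_tl_less[OF Suc.prems(2), of "part_at l' 0 + N" N] by auto
  ultimately have "beta_set N (tl l) = beta_set N (tl l')"
    using eq Suc.prems(5) by simp
  hence "tl l = tl l'"
    using Suc.prems(1-4) by (intro Suc.IH is_partition_tl) auto
  with eq Suc.prems show ?case by (simp add: partition_eqI)
qed auto

lemma beta_set_Nil: "beta_set N [] = {..<N}"
proof (induction N)
  case (Suc N)
  thus ?case by (simp add: beta_set_Suc lessThan_Suc)
qed (simp add: beta_set_def)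

text \<open>Decode from the top: the maximum \<open>x\<close> yields the first part
  \<open>x - N\<close>, and the rest is decoded by induction. Since \<open>X\<close> has
  \<open>N + 1\<close> elements up to \<open>x\<close>, this difference is not negative.\<close>

lemma beta_set_surj:
  assumes "finite X" "card X = N"
  shows "\<exists>l. is_partition l \<and> length l \<le> N \<and> X = beta_set N l"
  using assms
proof (induction N arbitrary: X)
  case 0
  thus ?case by (intro exI[of _ "[]"]) (auto simp: beta_set_def)
next
  case (Suc N)
  define x where "x = Max X"
  have ne: "X \<noteq> {}" using Suc.prems by auto
  have x: "x \<in> X" "\<And>y. y \<in> X \<Longrightarrow> y \<le> x"
    using Suc.prems ne by (auto simp: x_def)
  have "card (X - {x}) = N" using x Suc.prems by simp
  hence "\<exists>l. is_partition l \<and> length l \<le> N \<and> X - {x} = beta_set N l"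
    using Suc.prems(1) by (intro Suc.IH) auto
  then obtain l where l: "is_partition l" "length l \<le> N" "X - {x} = beta_set N l" by blast
  have "X \<subseteq> {..x}" using x by auto
  hence "card X \<le> Suc x" using card_mono[of "{..x}" X] by simp
  hence "x \<ge> N" using Suc.prems by simp
  show ?case
  proof (cases "x = N")
    case True
    hence "X \<subseteq> {..<Suc N}" using \<open>X \<subseteq> {..x}\<close> by auto
    hence "X = {..<Suc N}" using Suc.prems by (intro card_subset_eq) auto
    thus ?thesis by (intro exI[of _ "[]"]) (simp add: beta_set_Nil)
  next
    case False
    let ?l = "(x - N) # l"
    have "y \<le> x - N" if "y \<in> set l" for y
    proof -
      from that have "N > 0" using l(2) by (cases l) auto
      from that have "\<exists>i<length l. l ! i = y" by (simp only: in_set_conv_nth)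
      then obtain i where i: "i < length l" "l ! i = y" by blast
      have "y \<le> part_at l 0" using part_at_antimono[OF l(1), of 0 i] i by (simp add: part_at_def)
      moreover have "part_at l 0 + (N - 1) \<in> beta_set N l"
        unfolding beta_set_def using \<open>N > 0\<close> by (intro image_eqI[of _ _ 0]) auto
      hence "part_at l 0 + (N - 1) \<in> X - {x}" by (simp only: l(3))
      hence "part_at l 0 + (N - 1) < x"
        using x(2)[of "part_at l 0 + (N - 1)"] by auto
      ultimately show ?thesis by simp
    qed
    hence "is_partition ?l" using False \<open>x \<ge> N\<close> l(1) by (auto simp: is_partition_Cons)
    moreover have "X = beta_set (Suc N) ?l"
    proof -
      have "beta_set (Suc N) ?l = insert x (X - {x})"
        using \<open>x \<ge> N\<close> unfolding l(3) by (simp add: beta_set_Suc part_at_def)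
      thus ?thesis using x(1) by auto
    qed
    ultimately show ?thesis using l(2) by (intro exI[of _ ?l]) auto
  qed
qed

lemma bij_betw_beta_set:
  assumes "n \<le> N"
  shows "bij_betw (beta_set N) (partitions_of n) (subsets_of_sum N n)"
proof -
  have len: "length l \<le> N" if "l \<in> partitions_of n" for l
    using that length_le_sum_list[of l] assms by (auto simp: partitions_of_def)
  have "inj_on (beta_set N) (partitions_of n)"
    by (intro inj_onI beta_set_inj[of _ _ N]) (auto simp: len, auto simp: partitions_of_def)
  moreover have "beta_set N l \<in> subsets_of_sum N n" if "l \<in> partitions_of n" for l
    using that len[OF that] by (auto simp: subsets_of_sum_def partitions_of_def card_beta_set sum_elems_beta_set)
  moreover have "X \<in> beta_set N ` partitions_of n" if "X \<in> subsets_of_sum N n" for X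
  proof -
    from that have X: "finite X" "card X = N" "\<Sum>X = n + \<Sum>{..<N}"
      by (auto simp: subsets_of_sum_def)
    obtain l where l: "is_partition l" "length l \<le> N" "X = beta_set N l"
      using beta_set_surj[OF X(1,2)] by blast
    with X(3) have "l \<in> partitions_of n" by (simp add: sum_elems_beta_set partitions_of_def)
    with l show ?thesis by blast
  qed
  ultimately show ?thesis unfolding bij_betw_def by blast
qed

text \<open>The excess is the size of the encoded partition.\<close>

lemma sum_ge_triangular:
  assumes "finite X" "card X = N"
  shows "\<Sum>X \<ge> \<Sum>{..<N}"
  using beta_set_surj[OF assms] by (auto simp: sum_elems_beta_set)

text \<open>The padding zeros, of which there are at least \<open>h\<close>, fill the lowest
  positions.\<close>

lemma beta_set_superset:
  assumes "length l + h \<le> N"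
  shows "{..<h} \<subseteq> beta_set N l"
proof
  fix a assume a: "a \<in> {..<h}"
  have "a = part_at l (N - 1 - a) + (N - 1 - (N - 1 - a))" "N - 1 - a < N"
    using a assms by (auto simp: part_at_def)
  thus "a \<in> beta_set N l" unfolding beta_set_def by blast
qed

lemma finite_subsets_of_sum [simp]: "finite (subsets_of_sum N n)"
proof -
  have "x \<le> n + \<Sum>{..<N}" if "X \<in> subsets_of_sum N n" "x \<in> X" for X x
    using member_le_sum[of x X "\<lambda>x. x"] that by (auto simp: subsets_of_sum_def)
  hence "subsets_of_sum N n \<subseteq> Pow {..n + \<Sum>{..<N}}" by blast
  thus ?thesis by (rule finite_subset) simp
qed

section \<open>Hooks\<close>

definition hook_heads :: "nat \<Rightarrow> nat set \<Rightarrow> nat set" where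
  "hook_heads h X = {a\<in>X. h \<le> a \<and> a - h \<notin> X}"

text \<open>A slot is recorded by the position before the move; the head of the added hook is
  \<open>b + h\<close>.\<close>

definition hook_slots :: "nat \<Rightarrow> nat set \<Rightarrow> nat set" where
  "hook_slots h X = {b\<in>X. b + h \<notin> X}"

lemma finite_hook_heads [simp]: "finite X \<Longrightarrow> finite (hook_heads h X)"
  by (simp add: hook_heads_def)

lemma finite_hook_slots [simp]: "finite X \<Longrightarrow> finite (hook_slots h X)"
  by (simp add: hook_slots_def)

text \<open>Pairs of elements of \<open>X\<close> at distance \<open>h\<close> contribute equally to
  the sum of \<open>\<psi> (b + h)\<close> and to that of \<open>\<psi> a\<close>. What remains are
  the slots on one side, the heads and the elements below \<open>h\<close> on the other; by
  assumption the latter are all of \<open>{..<h}\<close>.\<close>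

lemma sum_hook_slots:
  fixes \<psi> :: "nat \<Rightarrow> 'a :: ab_group_add"
  assumes "finite X" "{..<h} \<subseteq> X"
  shows "(\<Sum>b\<in>hook_slots h X. \<psi> (b + h)) = (\<Sum>a\<in>hook_heads h X. \<psi> a) +
     ((\<Sum>b\<in>X. \<psi> (b + h) - \<psi> b) + (\<Sum>a<h. \<psi> a))"
proof -
  have "(\<Sum>b\<in>X. \<psi> (b + h)) = (\<Sum>b\<in>hook_slots h X. \<psi> (b + h)) + (\<Sum>b\<in>{b\<in>X. b + h \<in> X}. \<psi> (b + h))"
    using assms(1) by (subst sum.union_disjoint[symmetric]) (auto simp: hook_slots_def intro!: sum.cong)
  moreover have "(\<Sum>b\<in>{b\<in>X. b + h \<in> X}. \<psi> (b + h)) = (\<Sum>a\<in>{a\<in>X. h \<le> a \<and> a - h \<in> X}. \<psi> a)"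
    by (rule sum.reindex_bij_witness[of _ "\<lambda>a. a - h" "\<lambda>b. b + h"]) auto
  moreover have "(\<Sum>a\<in>X. \<psi> a) = (\<Sum>a\<in>hook_heads h X. \<psi> a) +
      (\<Sum>a\<in>{a\<in>X. h \<le> a \<and> a - h \<in> X}. \<psi> a) + (\<Sum>a<h. \<psi> a)"
  proof -
    have "X = hook_heads h X \<union> {a\<in>X. h \<le> a \<and> a - h \<in> X} \<union> {..<h}"
      using assms(2) by (auto simp: hook_heads_def)
    moreover have "sum \<psi> (hook_heads h X \<union> {a\<in>X. h \<le> a \<and> a - h \<in> X} \<union> {..<h}) =
      (\<Sum>a\<in>hook_heads h X. \<psi> a) + (\<Sum>a\<in>{a\<in>X. h \<le> a \<and> a - h \<in> X}. \<psi> a) + (\<Sum>a<h. \<psi> a)"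
      using assms(1) by (subst sum.union_disjoint, auto simp: hook_heads_def sum.union_disjoint)+
    ultimately show ?thesis by (simp only:)
  qed
  ultimately show ?thesis by (simp add: sum_subtractf algebra_simps)
qed

section \<open>Removing hooks, once and repeatedly\<close>

lemma finite_subsets_of_sumD: "X \<in> subsets_of_sum N n \<Longrightarrow> finite X"
  by (simp add: subsets_of_sum_def)

lemma move_bead:
  assumes "finite X" "a \<in> X" "c \<notin> X"
  shows "card (insert c (X - {a})) = card X" "\<Sum>(insert c (X - {a})) + a = \<Sum>X + c"
  using assms card_Suc_Diff1[of X a] sum.remove[of X a "\<lambda>x. x"] by (simp_all add: add_ac)

text \<open>Moving the head down by \<open>h\<close> is a bijection from partitions of
  \<open>n\<close> with a marked hook to partitions of \<open>n - h\<close> with a marked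
  slot.\<close>

lemma sum_hook_heads_remove:
  assumes "h > 0" "h \<le> n"
  shows "(\<Sum>X\<in>subsets_of_sum N n. \<Sum>a\<in>hook_heads h X. F X a) =
     (\<Sum>Y\<in>subsets_of_sum N (n - h). \<Sum>b\<in>hook_slots h Y. F (insert (b + h) (Y - {b})) (b + h))"
proof -
  have "(\<Sum>X\<in>subsets_of_sum N n. \<Sum>a\<in>hook_heads h X. F X a) =
     (\<Sum>(X, a)\<in>Sigma (subsets_of_sum N n) (hook_heads h). F X a)"
    by (subst sum.Sigma) (auto dest: finite_subsets_of_sumD)
  also have "\<dots> = (\<Sum>(Y, b)\<in>Sigma (subsets_of_sum N (n - h)) (hook_slots h).
      F (insert (b + h) (Y - {b})) (b + h))"
  proof (rule sum.reindex_bij_witness[where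
        i = "\<lambda>(Y, b). (insert (b + h) (Y - {b}), b + h)" and
        j = "\<lambda>(X, a). (insert (a - h) (X - {a}), a - h)"])
    fix x assume "x \<in> Sigma (subsets_of_sum N n) (hook_heads h)"
    then obtain X a where x: "x = (X, a)" "X \<in> subsets_of_sum N n" "a \<in> hook_heads h X" by auto
    hence 1: "a \<in> X" "h \<le> a" "a - h \<notin> X" "finite X"
      by (auto simp: hook_heads_def subsets_of_sum_def)
    from 1 assms have 2: "insert a (insert (a - h) (X - {a}) - {a - h}) = X" by auto
    show "(case case x of (X, a) \<Rightarrow> (insert (a - h) (X - {a}), a - h) of
        (Y, b) \<Rightarrow> (insert (b + h) (Y - {b}), b + h)) = x"
      using 1 2 x(1) by simp
    show "(case case x of (X, a) \<Rightarrow> (insert (a - h) (X - {a}), a - h) of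
        (Y, b) \<Rightarrow> F (insert (b + h) (Y - {b})) (b + h)) = (case x of (X, a) \<Rightarrow> F X a)"
      using 1 2 x(1) by simp
    have "insert (a - h) (X - {a}) \<in> subsets_of_sum N (n - h)"
      using move_bead[of X a "a - h"] 1 x(2) assms by (auto simp: subsets_of_sum_def)
    moreover have "a - h \<in> hook_slots h (insert (a - h) (X - {a}))"
      using 1 assms by (auto simp: hook_slots_def)
    ultimately show "(case x of (X, a) \<Rightarrow> (insert (a - h) (X - {a}), a - h))
        \<in> Sigma (subsets_of_sum N (n - h)) (hook_slots h)"
      using x(1) by simp
  next
    fix y assume "y \<in> Sigma (subsets_of_sum N (n - h)) (hook_slots h)"
    then obtain Y b where y: "y = (Y, b)" "Y \<in> subsets_of_sum N (n - h)" "b \<in> hook_slots h Y" by auto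
    hence 1: "b \<in> Y" "b + h \<notin> Y" "finite Y"
      by (auto simp: hook_slots_def subsets_of_sum_def)
    from 1 assms have 2: "insert b (insert (b + h) (Y - {b}) - {b + h}) = Y" by auto
    show "(case case y of (Y, b) \<Rightarrow> (insert (b + h) (Y - {b}), b + h) of
        (X, a) \<Rightarrow> (insert (a - h) (X - {a}), a - h)) = y"
      using 1 2 y(1) by simp
    have "insert (b + h) (Y - {b}) \<in> subsets_of_sum N n"
      using move_bead[of Y b "b + h"] 1 y(2) assms by (auto simp: subsets_of_sum_def)
    moreover have "b + h \<in> hook_heads h (insert (b + h) (Y - {b}))"
      using 1 assms by (auto simp: hook_heads_def)
    ultimately show "(case y of (Y, b) \<Rightarrow> (insert (b + h) (Y - {b}), b + h))
        \<in> Sigma (subsets_of_sum N n) (hook_heads h)"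
      using y(1) by simp
  qed
  also have "\<dots> = (\<Sum>Y\<in>subsets_of_sum N (n - h). \<Sum>b\<in>hook_slots h Y. F (insert (b + h) (Y - {b})) (b + h))"
    by (subst sum.Sigma) (auto dest: finite_subsets_of_sumD)
  finally show ?thesis .
qed

text \<open>Otherwise removing the hook would give \<open>N\<close> distinct numbers with a sum
  below the minimum.\<close>

lemma hook_heads_empty:
  assumes "X \<in> subsets_of_sum N n" "n < h"
  shows "hook_heads h X = {}"
proof (rule ccontr)
  assume "hook_heads h X \<noteq> {}"
  then obtain a where a: "a \<in> X" "h \<le> a" "a - h \<notin> X" by (auto simp: hook_heads_def)
  have X: "finite X" "card X = N" "\<Sum>X = n + \<Sum>{..<N}"
    using assms by (auto simp: subsets_of_sum_def)
  let ?Y = "insert (a - h) (X - {a})"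
  have "card ?Y = N" "\<Sum>?Y + a = \<Sum>X + (a - h)"
    using move_bead[OF X(1) a(1,3)] X(2) by auto
  moreover from this have "\<Sum>?Y \<ge> \<Sum>{..<N}"
    using X(1) by (intro sum_ge_triangular) auto
  ultimately show False using X(3) a(2) assms(2) by linarith
qed

text \<open>A partition of \<open>n\<close> has at most \<open>n\<close> parts, so at least
  \<open>h\<close> of the \<open>N\<close> rows are empty.\<close>

lemma subsets_of_sum_superset:
  assumes "X \<in> subsets_of_sum N n" "n + h \<le> N"
  shows "{..<h} \<subseteq> X"
proof -
  have "bij_betw (beta_set N) (partitions_of n) (subsets_of_sum N n)"
    using assms by (intro bij_betw_beta_set) auto
  then obtain l where "l \<in> partitions_of n" "X = beta_set N l"
    using assms(1) by (auto simp: bij_betw_def)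
  thus ?thesis using assms(2) length_le_sum_list[of l]
    by (auto intro!: beta_set_superset simp: partitions_of_def)
qed

text \<open>The assumption on \<open>F\<close> says that adding a hook to \<open>Y\<close> has the
  effect of raising the counter \<open>r\<close>. Removing the hook thus leads to a sum over slots
  at counter \<open>r + 1\<close>. By \<open>sum_hook_slots\<close> this is a sum over heads,
  treated by induction on \<open>n\<close>, plus the telescoping term kept on the right. The process
  ends when \<open>n < h\<close>.\<close>

lemma sum_hook_heads_iterate:
  fixes F :: "nat set \<Rightarrow> nat \<Rightarrow> nat \<Rightarrow> 'a :: ab_group_add"
  assumes F: "\<And>Y b r. \<lbrakk>finite Y; b \<in> Y; b + h \<notin> Y\<rbrakk> \<Longrightarrow>
      F (insert (b + h) (Y - {b})) r (b + h) = F Y (Suc r) (b + h)"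
    and "h > 0" "n \<le> N"
  shows "(\<Sum>X\<in>subsets_of_sum N n. \<Sum>a\<in>hook_heads h X. F X r a) =
    (\<Sum>k\<in>{1..n div h}. \<Sum>Y\<in>subsets_of_sum N (n - k * h).
       (\<Sum>b\<in>Y. F Y (r + k) (b + h) - F Y (r + k) b) + (\<Sum>a<h. F Y (r + k) a))"
  using assms(3)
proof (induction n arbitrary: r rule: less_induct)
  case (less n r)
  show ?case
  proof (cases "n < h")
    case True
    thus ?thesis by (simp add: hook_heads_empty)
  next
    case False
    have nh: "n div h = Suc ((n - h) div h)"
      using False \<open>h > 0\<close> by (intro le_div_geq) auto
    let ?D = "\<lambda>r Y. (\<Sum>b\<in>Y. F Y r (b + h) - F Y r b) + (\<Sum>a<h. F Y r a)"
    have "(\<Sum>X\<in>subsets_of_sum N n. \<Sum>a\<in>hook_heads h X. F X r a) =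
       (\<Sum>Y\<in>subsets_of_sum N (n - h). \<Sum>b\<in>hook_slots h Y. F (insert (b + h) (Y - {b})) r (b + h))"
      using False \<open>h > 0\<close> by (intro sum_hook_heads_remove) auto
    also have "\<dots> = (\<Sum>Y\<in>subsets_of_sum N (n - h). \<Sum>b\<in>hook_slots h Y. F Y (Suc r) (b + h))"
    proof (rule sum.cong[OF refl], rule sum.cong[OF refl])
      fix Y b assume "Y \<in> subsets_of_sum N (n - h)" "b \<in> hook_slots h Y"
      thus "F (insert (b + h) (Y - {b})) r (b + h) = F Y (Suc r) (b + h)"
        by (intro F) (auto simp: subsets_of_sum_def hook_slots_def)
    qed
    also have "\<dots> = (\<Sum>Y\<in>subsets_of_sum N (n - h). (\<Sum>a\<in>hook_heads h Y. F Y (Suc r) a) + ?D (Suc r) Y)"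
    proof (rule sum.cong[OF refl])
      fix Y assume Y: "Y \<in> subsets_of_sum N (n - h)"
      hence "finite Y" "{..<h} \<subseteq> Y"
        using False less.prems subsets_of_sum_superset[OF Y, of h] by (auto simp: subsets_of_sum_def)
      thus "(\<Sum>b\<in>hook_slots h Y. F Y (Suc r) (b + h)) =
          (\<Sum>a\<in>hook_heads h Y. F Y (Suc r) a) + ?D (Suc r) Y"
        by (rule sum_hook_slots[where \<psi> = "F Y (Suc r)"])
    qed
    also have "\<dots> = (\<Sum>Y\<in>subsets_of_sum N (n - h). \<Sum>a\<in>hook_heads h Y. F Y (Suc r) a) +
       (\<Sum>Y\<in>subsets_of_sum N (n - h). ?D (Suc r) Y)"
      by (rule sum.distrib)
    finally have step: "(\<Sum>X\<in>subsets_of_sum N n. \<Sum>a\<in>hook_heads h X. F X r a) =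
       (\<Sum>Y\<in>subsets_of_sum N (n - h). \<Sum>a\<in>hook_heads h Y. F Y (Suc r) a) +
       (\<Sum>Y\<in>subsets_of_sum N (n - h). ?D (Suc r) Y)" .
    have "(\<Sum>Y\<in>subsets_of_sum N (n - h). \<Sum>a\<in>hook_heads h Y. F Y (Suc r) a) =
       (\<Sum>k\<in>{1..(n - h) div h}. \<Sum>Y\<in>subsets_of_sum N (n - h - k * h). ?D (Suc r + k) Y)"
      using False \<open>h > 0\<close> less.prems by (intro less.IH) auto
    \<comment> \<open>Removing \<open>k\<close> more hooks after the first is removing
      \<open>k + 1\<close> in total; the index shifts by one and leaves room for the summand at
      1.\<close>
    also have "\<dots> = (\<Sum>k\<in>{2..n div h}. \<Sum>Y\<in>subsets_of_sum N (n - k * h). ?D (r + k) Y)"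
      using nh by (intro sum.reindex_bij_witness[of _ "\<lambda>k. k - 1" Suc]) auto
    finally have IH: "(\<Sum>Y\<in>subsets_of_sum N (n - h). \<Sum>a\<in>hook_heads h Y. F Y (Suc r) a) =
       (\<Sum>k\<in>{2..n div h}. \<Sum>Y\<in>subsets_of_sum N (n - k * h). ?D (r + k) Y)" .
    have "{1..n div h} = insert 1 {2..n div h}"
      unfolding nh by (simp add: atLeastAtMost_insertL[symmetric] numeral_2_eq_2)
    hence "(\<Sum>k\<in>{1..n div h}. \<Sum>Y\<in>subsets_of_sum N (n - k * h). ?D (r + k) Y) =
       (\<Sum>Y\<in>subsets_of_sum N (n - 1 * h). ?D (r + 1) Y) +
       (\<Sum>k\<in>{2..n div h}. \<Sum>Y\<in>subsets_of_sum N (n - k * h). ?D (r + k) Y)"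
      by (simp only:) (rule sum.insert, auto)
    thus ?thesis unfolding step IH by (simp only: mult_1_left Suc_eq_plus1 add.commute)
  qed
qed

text \<open>The cells of row \<open>i\<close> correspond to the gaps below the bead of that row, and
  the hook length is the distance from the bead to the gap.\<close>

lemma sum_hook_length_row:
  assumes l: "is_partition l" "length l \<le> N" and i: "i < length l"
  shows "(\<Sum>j\<in>{1..l ! i}. \<phi> (hook_length l (Suc i, j))) =
    (\<Sum>b | b < part_at l i + (N - 1 - i) \<and> b \<notin> beta_set N l. \<phi> (part_at l i + (N - 1 - i) - b))"
proof -
  let ?x = "\<lambda>i. part_at l i + (N - 1 - i)"
  let ?B = "{b. b < ?x i \<and> b \<notin> beta_set N l}"
  \<comment> \<open>The conjugate partition: \<open>c j\<close> is the length of column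
    \<open>j\<close>, with columns counted from 1.\<close>
  define c where "c j = card {i. part_at l i \<ge> j}" for j
  have c: "{i. part_at l i \<ge> j} = {..<c j}" "c j \<le> length l" if "j > 0" for j
  proof -
    have sub: "{i. part_at l i \<ge> j} \<subseteq> {..<length l}" using that by (auto simp: part_at_def split: if_splits)
    hence fin: "finite {i. part_at l i \<ge> j}" by (rule finite_subset) auto
    show "c j \<le> length l" using card_mono[OF _ sub] by (simp add: c_def)
    show "{i. part_at l i \<ge> j} = {..<c j}"
    proof (rule ccontr)
      assume ne: "{i. part_at l i \<ge> j} \<noteq> {..<c j}"
      have "\<not> {..<c j} \<subseteq> {i. part_at l i \<ge> j}"
        using card_subset_eq[OF fin, of "{..<c j}"] ne by (auto simp: c_def)
      then obtain k where k: "k < c j" "part_at l k < j" by force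
      hence "{i. part_at l i \<ge> j} \<subseteq> {..<k}"
        using part_at_antimono[OF l(1), of k] by (force simp: not_le)
      hence "c j \<le> k" using card_mono[of "{..<k}"] by (simp add: c_def)
      with k show False by simp
    qed
  qed
  have c_iff: "part_at l i \<ge> j \<longleftrightarrow> i < c j" if "j > 0" for i j
    using c(1)[OF that] by auto
  have c_mono: "c j' \<le> c j" if "0 < j" "j \<le> j'" for j j'
  proof (rule ccontr)
    assume "\<not> c j' \<le> c j"
    hence "j' \<le> part_at l (c j)" using c_iff[of j' "c j"] that by simp
    thus False using c_iff[of j "c j"] that by simp
  qed
  have li: "part_at l i = l ! i" using i by (simp add: part_at_def)
  \<comment> \<open>The first summand is the arm. The second is the leg plus one for the cell
    itself, as rows are counted from 0 here but from 1 in \<open>hook_length\<close>.\<close>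
  have hook: "hook_length l (Suc i, j) = (l ! i - j) + (c j - i)" if j: "j \<in> {1..l ! i}" for j
  proof -
    have yd: "(a, b) \<in> young_diagram l \<longleftrightarrow> a \<ge> 1 \<and> b \<ge> 1 \<and> b \<le> part_at l (a - 1)" for a b
      unfolding young_diagram_def part_at_def by auto
    have "{(i', j'). (i', j') \<in> young_diagram l \<and> ((i' = Suc i \<and> j \<le> j') \<or> (j' = j \<and> Suc i \<le> i'))} =
       {Suc i} \<times> {j..l ! i} \<union> {Suc (Suc i)..c j} \<times> {j}"
    proof (rule set_eqI)
      fix x :: "nat \<times> nat"
      obtain a b where x: "x = (a, b)" by force
      have "j \<le> part_at l (a - 1) \<longleftrightarrow> a \<le> c j" if "a \<ge> 1"
        using c_iff[of j "a - 1"] j that by auto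
      thus "x \<in> {(i', j'). (i', j') \<in> young_diagram l \<and> ((i' = Suc i \<and> j \<le> j') \<or> (j' = j \<and> Suc i \<le> i'))}
         \<longleftrightarrow> x \<in> {Suc i} \<times> {j..l ! i} \<union> {Suc (Suc i)..c j} \<times> {j}"
        unfolding x using j li by (cases "a = Suc i"; cases "b = j") (simp_all add: yd, auto)
    qed
    hence "hook_length l (Suc i, j) = card ({Suc i} \<times> {j..l ! i} \<union> {Suc (Suc i)..c j} \<times> {j})"
      by (simp add: hook_length_def)
    also have "\<dots> = (Suc (l ! i) - j) + (c j - Suc i)"
      by (subst card_Un_disjoint) auto
    also have "\<dots> = (l ! i - j) + (c j - i)"
      using j c_iff[of j i] li by auto
    finally show ?thesis .
  qed
  \<comment> \<open>The gap belonging to column \<open>j\<close>: it lies above the beads of all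
    rows that miss this column and below those of all rows that meet it.\<close>
  define g where "g j = N + j - 1 - c j" for j
  have cN: "c j \<le> N" if "j > 0" for j using c(2)[OF that] l(2) by simp
  have g_hook: "g j < ?x i \<and> hook_length l (Suc i, j) = ?x i - g j" if j: "j \<in> {1..l ! i}" for j
  proof -
    have "i < c j" "c j \<le> N" using c_iff[of j i] cN[of j] li j by auto
    thus ?thesis unfolding hook[OF j] g_def using j li by auto
  qed
  have g_notin: "g j \<notin> beta_set N l" if "j > 0" for j
  proof
    assume "g j \<in> beta_set N l"
    then obtain k where k: "k < N" "g j = part_at l k + (N - 1 - k)" by (auto simp: beta_set_def)
    show False using c_iff[OF that, of k] cN[OF that] k that
      by (cases "k < c j") (auto simp: g_def)
  qed
  have g_inj: "inj_on g {1..l ! i}"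
  proof (rule linorder_inj_onI)
    fix j j' assume "j < j'" "j \<in> {1..l ! i}" "j' \<in> {1..l ! i}"
    thus "g j \<noteq> g j'" using c_mono[of j j'] cN[of j] by (auto simp: g_def)
  qed auto
  have "g ` {1..l ! i} = ?B"
  proof (rule card_subset_eq)
    show "g ` {1..l ! i} \<subseteq> ?B" using g_hook g_notin by auto
    \<comment> \<open>Surjectivity of \<open>g\<close> by counting. The beads below that of row
      \<open>i\<close> belong to the \<open>N - 1 - i\<close> later rows, so exactly
      \<open>part_at l i\<close> of the lower positions are gaps.\<close>
    have "beta_set N l \<inter> {..<?x i} = ?x ` {i<..<N}"
    proof -
      have "?x k < ?x i \<longleftrightarrow> i < k" if "k < N" for k
        using beta_number_less[OF l(1), of i k N] beta_number_less[OF l(1), of k i N] that i l(2)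
        by (cases i k rule: linorder_cases) auto
      thus ?thesis unfolding beta_set_def by auto
    qed
    hence "card (beta_set N l \<inter> {..<?x i}) = card (?x ` {i<..<N})"
      by (rule arg_cong)
    also have "\<dots> = card {i<..<N}"
      by (intro card_image inj_on_subset[OF inj_on_beta_number[OF l(1)]]) auto
    also have "\<dots> = N - 1 - i"
      by simp
    finally have card: "card (beta_set N l \<inter> {..<?x i}) = N - 1 - i" .
    have "?B = {..<?x i} - (beta_set N l \<inter> {..<?x i})" by auto
    hence "card ?B = card ({..<?x i} - (beta_set N l \<inter> {..<?x i}))"
      by (rule arg_cong)
    also have "\<dots> = ?x i - (N - 1 - i)"
      by (subst card_Diff_subset) (auto simp: card[simplified])
    finally have "card ?B = ?x i - (N - 1 - i)" .
    thus "card (g ` {1..l ! i}) = card ?B"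
      unfolding card_image[OF g_inj] li by simp
  qed auto
  hence "bij_betw g {1..l ! i} ?B" using g_inj by (simp add: bij_betw_def)
  hence "(\<Sum>b\<in>?B. \<phi> (?x i - b)) = (\<Sum>j\<in>{1..l ! i}. \<phi> (?x i - g j))"
    by (rule sum.reindex_bij_betw[symmetric])
  also have "\<dots> = (\<Sum>j\<in>{1..l ! i}. \<phi> (hook_length l (Suc i, j)))"
    using g_hook by (intro sum.cong) auto
  finally show ?thesis by simp
qed

text \<open>By rows the left side is a sum over pairs of a bead and a lower gap; grouping these by
  their distance \<open>h\<close> gives the hook heads.\<close>

lemma sum_hook_length:
  fixes \<phi> :: "nat \<Rightarrow> 'a :: comm_semiring_1"
  assumes l: "l \<in> partitions_of n" and "n \<le> N"
  shows "(\<Sum>\<xi>\<in>young_diagram l. \<phi> (hook_length l \<xi>)) =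
    (\<Sum>h\<in>{1..n}. \<phi> h * of_nat (card (hook_heads h (beta_set N l))))"
proof -
  have part: "is_partition l" "length l \<le> N"
    using l length_le_sum_list[of l] assms(2) by (auto simp: partitions_of_def)
  let ?x = "\<lambda>i. part_at l i + (N - 1 - i)" and ?X = "beta_set N l"
  have "bij_betw (\<lambda>(i, j). (Suc i, j)) (Sigma {..<length l} (\<lambda>i. {1..l ! i})) (young_diagram l)"
    by (rule bij_betwI[of _ _ _ "\<lambda>(i, j). (i - 1, j)"]) (auto simp: young_diagram_def)
  hence "(\<Sum>\<xi>\<in>young_diagram l. \<phi> (hook_length l \<xi>)) =
     (\<Sum>(i, j)\<in>Sigma {..<length l} (\<lambda>i. {1..l ! i}). \<phi> (hook_length l (Suc i, j)))"
    by (subst sum.reindex_bij_betw[symmetric]) (auto intro: sum.cong)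
  also have "\<dots> = (\<Sum>i<length l. \<Sum>j\<in>{1..l ! i}. \<phi> (hook_length l (Suc i, j)))"
    by (intro sum.Sigma[symmetric]) auto
  also have "\<dots> = (\<Sum>i<length l. \<Sum>b | b < ?x i \<and> b \<notin> ?X. \<phi> (?x i - b))"
    using part by (intro sum.cong sum_hook_length_row) auto
  also have "\<dots> = (\<Sum>i<N. \<Sum>b | b < ?x i \<and> b \<notin> ?X. \<phi> (?x i - b))"
  proof (intro sum.mono_neutral_left ballI)
    \<comment> \<open>The bead of an empty row has no gap below it, so all \<open>N\<close> rows may
      be included.\<close>
    fix i assume i: "i \<in> {..<N} - {..<length l}"
    have "b \<in> ?X" if "b < ?x i" for b
      using beta_set_superset[of l "N - length l" N] part(2) that i by (auto simp: part_at_def)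
    thus "(\<Sum>b | b < ?x i \<and> b \<notin> ?X. \<phi> (?x i - b)) = 0" by (intro sum.neutral) auto
  qed (use part in auto)
  also have "\<dots> = (\<Sum>x\<in>?X. \<Sum>b | b < x \<and> b \<notin> ?X. \<phi> (x - b))"
    using part(1) by (rule sum_beta_set[symmetric])
  also have "\<dots> = (\<Sum>x\<in>?X. \<Sum>h\<in>{h\<in>{1..n}. x \<in> hook_heads h ?X}. \<phi> h)"
  proof (rule sum.cong[OF refl])
    fix x assume x: "x \<in> ?X"
    have le: "h \<le> n" if "x \<in> hook_heads h ?X" for h
    proof (rule ccontr)
      assume "\<not> h \<le> n"
      moreover have "?X \<in> subsets_of_sum N n"
        using bij_betw_beta_set[OF assms(2)] l by (auto simp: bij_betw_def)
      ultimately show False using hook_heads_empty[of ?X N n h] that by auto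
    qed
    show "(\<Sum>b | b < x \<and> b \<notin> ?X. \<phi> (x - b)) = (\<Sum>h\<in>{h\<in>{1..n}. x \<in> hook_heads h ?X}. \<phi> h)"
      using le x by (intro sum.reindex_bij_witness[of _ "\<lambda>h. x - h" "\<lambda>b. x - b"])
        (auto simp: hook_heads_def Suc_le_eq)
  qed
  also have "\<dots> = (\<Sum>h\<in>{1..n}. \<Sum>x\<in>{x\<in>?X. x \<in> hook_heads h ?X}. \<phi> h)"
    by (rule sum.swap_restrict) auto
  also have "\<dots> = (\<Sum>h\<in>{1..n}. \<phi> h * of_nat (card (hook_heads h ?X)))"
  proof -
    have "{x\<in>?X. x \<in> hook_heads h ?X} = hook_heads h ?X" for h by (auto simp: hook_heads_def)
    thus ?thesis by (simp add: mult.commute)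
  qed
  finally show ?thesis .
qed

section \<open>The functions \<open>Q\<^sub>k\<close> on beta sets\<close>

text \<open>For the bead of row \<open>i\<close>, counted from 1, this is the argument
  \<open>\<lambda>\<^sub>i - i + 1/2\<close> of the powers in \<open>Q_fun\<close>; the
  \<open>N\<close> cancels.\<close>

definition bead_pos :: "nat \<Rightarrow> nat \<Rightarrow> rat" where
  "bead_pos N a = of_nat a - of_nat N + 1 / 2"

definition Q_set :: "nat \<Rightarrow> nat \<Rightarrow> nat set \<Rightarrow> rat" where
  "Q_set N k X = (if k = 0 then 1 else
     1 / fact (k - 1) * ((\<Sum>x\<in>X. bead_pos N x ^ (k - 1)) - (\<Sum>a<N. bead_pos N a ^ (k - 1))) + beta k)"

lemma Q_fun_eq_Q_set:
  assumes "is_partition l" "length l \<le> N"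
  shows "Q_fun k l = Q_set N k (beta_set N l)"
proof (cases "k = 0")
  case False
  let ?d = "k - 1"
  let ?t = "\<lambda>i. bead_pos N (part_at l i + (N - 1 - i)) ^ ?d - bead_pos N (N - 1 - i) ^ ?d"
  have "(\<Sum>x\<in>beta_set N l. bead_pos N x ^ ?d) - (\<Sum>a<N. bead_pos N a ^ ?d) = (\<Sum>i<N. ?t i)"
    using assms(1) sum.nat_diff_reindex[of "\<lambda>a. bead_pos N a ^ ?d" N]
    by (simp add: sum_beta_set sum_subtractf)
  also have "\<dots> = (\<Sum>i<length l. ?t i)"
    using assms(2) by (intro sum.mono_neutral_right) (auto simp: part_at_def)
  also have "\<dots> = (\<Sum>i<length l. (of_nat (l ! i) - of_nat (Suc i) + 1/2) ^ ?d - (- of_nat (Suc i) + 1/2) ^ ?d)"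
    using assms(2) by (intro sum.cong) (auto simp: part_at_def bead_pos_def of_nat_diff algebra_simps)
  also have "\<dots> = (\<Sum>i=1..length l. (of_nat (l ! (i - 1)) - of_nat i + 1/2) ^ ?d - (- of_nat i + 1/2) ^ ?d)"
    by (rule sum.reindex_bij_witness[of _ "\<lambda>i. i - 1" Suc]) auto
  finally show ?thesis using False by (simp add: Q_fun_def Q_set_def)
qed (simp add: Q_fun_def Q_set_def)

text \<open>The increment is written in terms of the head \<open>b + h\<close> alone, so that it can
  serve as the translation vector attached to the marked hook.\<close>

lemma Q_set_move_bead:
  assumes "finite Y" "b \<in> Y" "b + h \<notin> Y"
  shows "Q_set N (Suc n) (insert (b + h) (Y - {b})) = Q_set N (Suc n) Y +
     (bead_pos N (b + h) ^ n - (bead_pos N (b + h) - of_nat h) ^ n) / fact n"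
proof -
  have "(\<Sum>x\<in>insert (b + h) (Y - {b}). bead_pos N x ^ n) =
     (\<Sum>x\<in>Y. bead_pos N x ^ n) - bead_pos N b ^ n + bead_pos N (b + h) ^ n"
    using assms sum.remove[of Y b "\<lambda>x. bead_pos N x ^ n"] by simp
  moreover have "bead_pos N b = bead_pos N (b + h) - of_nat h" by (simp add: bead_pos_def)
  ultimately show ?thesis
    by (simp add: Q_set_def add_divide_distrib[symmetric] diff_divide_distrib[symmetric] algebra_simps)
qed

section \<open>The coefficients \<open>beta k\<close> and sums of half-integer powers\<close>

lemma beta_fps: "Abs_fps beta * (fps_exp (1/2) - fps_exp (- (1/2))) = fps_X"
proof -
  define D where "D = fps_exp (1/2) - fps_exp (- (1/2) :: rat)"
  define S where "S = fps_const (1/2) * D"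
  have sub: "subdegree S = 1"
  proof (rule subdegreeI)
    show "fps_nth S 1 \<noteq> 0" by (simp add: S_def D_def)
    show "fps_nth S i = 0" if "i < 1" for i using that by (simp add: S_def D_def)
  qed
  have "Abs_fps beta = (fps_const (1/2) * fps_X) / S"
    by (rule fps_ext) (simp only: beta_def S_def D_def fps_nth_Abs_fps)
  moreover have "(fps_const (1/2) * fps_X) / S * S = fps_const (1/2) * fps_X"
  proof (rule fps_times_divide_eq)
    show "S \<noteq> 0" using sub by auto
    show "subdegree S \<le> subdegree (fps_const (1/2 :: rat) * fps_X)"
      unfolding sub by simp
  qed
  ultimately have "Abs_fps beta * S = fps_const (1/2) * fps_X"
    by (simp only:)
  hence "fps_const (1/2) * (Abs_fps beta * D) = fps_const (1/2) * fps_X"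
    by (simp only: S_def mult.left_commute)
  hence "Abs_fps beta * D = fps_X"
    by (subst (asm) mult_left_cancel) auto
  thus ?thesis by (simp only: D_def)
qed

lemma beta_0 [simp]: "beta 0 = 1"
proof -
  have "fps_nth (Abs_fps beta * (fps_exp (1/2) - fps_exp (- (1/2)))) 1 = fps_nth fps_X 1"
    by (simp only: beta_fps)
  thus ?thesis by (simp add: fps_mult_nth)
qed

text \<open>The exponential generating series is geometric: times e^(z/2) - e^(-z/2) it telescopes
  to e^(hz) - 1. Multiplying by the series of \<open>beta\<close> turns the first factor into z by
  \<open>beta_fps\<close>.\<close>

lemma sum_half_integer_powers:
  "(\<Sum>a<h. (of_nat a + 1/2) ^ d :: rat) =
     (\<Sum>k\<le>d. beta k * fact d / fact (Suc d - k) * of_nat h ^ (Suc d - k))"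
proof -
  let ?S = "fps_exp (1/2) - fps_exp (- (1/2) :: rat)"
  let ?T = "\<Sum>a<h. fps_exp (of_nat a + 1/2 :: rat)"
  have "?T * ?S = fps_exp (of_nat h) - 1"
  proof -
    have "?T * ?S = (\<Sum>a<h. fps_exp (of_nat (Suc a)) - fps_exp (of_nat a))"
      unfolding sum_distrib_right
      by (intro sum.cong) (auto simp: right_diff_distrib fps_exp_add_mult[symmetric] algebra_simps)
    also have "\<dots> = fps_exp (of_nat h) - 1"
      by (subst sum_lessThan_telescope) simp
    finally show ?thesis .
  qed
  hence "fps_X * ?T = Abs_fps beta * (fps_exp (of_nat h) - 1)"
    using beta_fps by (metis (no_types, lifting) mult.assoc mult.commute)
  hence "fps_nth (fps_X * ?T) (Suc d) = fps_nth (Abs_fps beta * (fps_exp (of_nat h) - 1)) (Suc d)"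
    by simp
  also have "\<dots> = (\<Sum>k\<le>d. beta k * (of_nat h ^ (Suc d - k) / fact (Suc d - k)))"
    unfolding fps_mult_nth atLeast0AtMost sum.atMost_Suc
    by (auto intro!: sum.cong simp: Suc_diff_le simp del: fact_Suc)
  also have "fps_nth (fps_X * ?T) (Suc d) = (\<Sum>a<h. (of_nat a + 1/2) ^ d) / fact d"
    by (simp add: fps_sum_nth sum_divide_distrib)
  finally have "(\<Sum>a<h. (of_nat a + 1/2) ^ d) =
     fact d * (\<Sum>k\<le>d. beta k * (of_nat h ^ (Suc d - k) / fact (Suc d - k)) :: rat)"
    by (simp add: field_simps)
  thus ?thesis by (simp add: sum_distrib_left mult_ac)
qed

text \<open>If \<open>{..<h} \<subseteq> Y\<close>, this is the amount by which the sum of \<open>\<psi>\<close> over the places where a hook of length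
  \<open>h\<close> can be added exceeds the sum over the hooks present.\<close>

definition hook_diff :: "nat \<Rightarrow> nat set \<Rightarrow> (nat \<Rightarrow> 'a :: ab_group_add) \<Rightarrow> 'a" where
  "hook_diff h Y \<psi> = (\<Sum>b\<in>Y. \<psi> (b + h) - \<psi> b) + (\<Sum>a<h. \<psi> a)"

lemma power_add_diff:
  "(x + y) ^ d - x ^ d = (\<Sum>c<d. of_nat (d choose c) * x ^ c * y ^ (d - c) :: 'a :: comm_ring_1)"
  unfolding binomial_ring lessThan_Suc_atMost[symmetric] sum.lessThan_Suc by simp

text \<open>The binomial theorem reduces the telescoping sum to power sums over \<open>Y\<close>.
  Subtracting the same identity for the empty partition makes these the \<open>Q_set\<close> without
  their constants, and \<open>sum_half_integer_powers\<close> supplies exactly the missing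
  \<open>beta k\<close>.\<close>

lemma hook_diff_power:
  "hook_diff h Y (\<lambda>a. bead_pos N a ^ d) =
     (\<Sum>k\<le>d. Q_set N k Y * fact d / fact (Suc d - k) * of_nat h ^ (Suc d - k))"
proof -
  let ?s = "bead_pos N" and ?h = "of_nat h :: rat"
  have sh: "?s (b + h) = ?s b + ?h" for b by (simp add: bead_pos_def)
  let ?C = "\<lambda>c. of_nat (d choose c) * ?h ^ (d - c)"
  have G: "(\<Sum>b\<in>Z. ?s (b + h) ^ d - ?s b ^ d) = (\<Sum>c<d. ?C c * (\<Sum>b\<in>Z. ?s b ^ c))" for Z
    unfolding sh power_add_diff
    by (subst sum.swap) (simp add: sum_distrib_left mult_ac)
  \<comment> \<open>For the beta set of the empty partition, shifting by \<open>h\<close> and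
    filling up from below adds the positions from \<open>N\<close> to \<open>N + h - 1\<close>,
    where \<open>bead_pos\<close> is \<open>a + 1/2\<close>.\<close>
  have "(\<Sum>b<N. ?s (b + h) ^ d) + (\<Sum>a<h. ?s a ^ d) = (\<Sum>b<N. ?s b ^ d) + (\<Sum>a<h. (of_nat a + 1/2) ^ d)"
  proof -
    have 1: "(\<Sum>b<m + k. f b) = (\<Sum>b<k. f b) + (\<Sum>b<m. f (b + k))" for f :: "nat \<Rightarrow> rat" and m k
      by (induction m) (auto simp: add_ac)
    have "(\<Sum>b<N. ?s (b + h) ^ d) + (\<Sum>a<h. ?s a ^ d) = (\<Sum>b<h + N. ?s b ^ d)"
      using 1[of "\<lambda>b. ?s b ^ d" N h] by (simp add: add_ac)
    also have "\<dots> = (\<Sum>b<N. ?s b ^ d) + (\<Sum>a<h. ?s (a + N) ^ d)" by (rule 1)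
    finally show ?thesis by (simp add: bead_pos_def)
  qed
  hence vac: "(\<Sum>c<d. ?C c * (\<Sum>b<N. ?s b ^ c)) + (\<Sum>a<h. ?s a ^ d) = (\<Sum>a<h. (of_nat a + 1/2) ^ d)"
    unfolding G[symmetric] by (simp add: sum_subtractf algebra_simps)
  have Qc: "fact c * (Q_set N (Suc c) Y - beta (Suc c)) = (\<Sum>b\<in>Y. ?s b ^ c) - (\<Sum>b<N. ?s b ^ c)" for c
    by (simp add: Q_set_def)
  have "hook_diff h Y (\<lambda>a. ?s a ^ d) = (\<Sum>c<d. ?C c * (\<Sum>b\<in>Y. ?s b ^ c)) + (\<Sum>a<h. ?s a ^ d)"
    unfolding hook_diff_def G ..
  also have "\<dots> = (\<Sum>c<d. ?C c * (fact c * (Q_set N (Suc c) Y - beta (Suc c)))) + (\<Sum>a<h. (of_nat a + 1/2) ^ d)"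
    unfolding vac[symmetric] Qc by (simp add: algebra_simps sum_subtractf)
  also have "(\<Sum>c<d. ?C c * (fact c * (Q_set N (Suc c) Y - beta (Suc c)))) =
     (\<Sum>c<d. (Q_set N (Suc c) Y - beta (Suc c)) * fact d / fact (d - c) * ?h ^ (d - c))"
    by (intro sum.cong refl) (auto simp: binomial_fact field_simps)
  also have "\<dots> = (\<Sum>k\<le>d. (Q_set N k Y - beta k) * fact d / fact (Suc d - k) * ?h ^ (Suc d - k))"
  proof -
    \<comment> \<open>With \<open>k = c + 1\<close> the range acquires a summand
      \<open>k = 0\<close>; it vanishes since both terms are 1.\<close>
    have "Q_set N 0 Y - beta 0 = 0" by (simp add: Q_set_def)
    thus ?thesis
      unfolding lessThan_Suc_atMost[symmetric] sum.lessThan_Suc_shift by simp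
  qed
  finally show ?thesis
    unfolding sum_half_integer_powers sum.distrib[symmetric] by (simp add: algebra_simps diff_divide_distrib)
qed

section \<open>Monomials and Taylor's formula\<close>

definition mpow :: "(nat \<Rightarrow> 'a) \<Rightarrow> monomial \<Rightarrow> 'a :: comm_semiring_1" where
  "mpow X m = (\<Prod>n\<in>Poly_Mapping.keys m. X n ^ Poly_Mapping.lookup m n)"

definition mfact :: "monomial \<Rightarrow> rat" where
  "mfact m = (\<Prod>n\<in>Poly_Mapping.keys m. fact (Poly_Mapping.lookup m n))"

definition monom_box :: "monomial \<Rightarrow> monomial set" where
  "monom_box x = {m. \<forall>n. Poly_Mapping.lookup m n \<le> Poly_Mapping.lookup x n}"

section \<open>Powers, factorials and degrees of monomials; the divisors of a monomial\<close>

lemma mpow_superset: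
  "finite A \<Longrightarrow> Poly_Mapping.keys m \<subseteq> A \<Longrightarrow> mpow X m = (\<Prod>n\<in>A. X n ^ Poly_Mapping.lookup m n)"
  unfolding mpow_def by (rule prod.mono_neutral_left) (auto simp: in_keys_iff)

lemma mfact_superset:
  "finite A \<Longrightarrow> Poly_Mapping.keys m \<subseteq> A \<Longrightarrow> mfact m = (\<Prod>n\<in>A. fact (Poly_Mapping.lookup m n))"
  unfolding mfact_def by (rule prod.mono_neutral_left) (auto simp: in_keys_iff)

lemma mpow_0 [simp]: "mpow X 0 = 1"
  by (simp add: mpow_def)

lemma mfact_0 [simp]: "mfact 0 = 1"
  by (simp add: mfact_def)

lemma mpow_add: "mpow X (a + b) = mpow X a * mpow X b"
proof -
  let ?A = "Poly_Mapping.keys a \<union> Poly_Mapping.keys b"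
  have "Poly_Mapping.keys (a + b) \<subseteq> ?A" by (rule Poly_Mapping.keys_add)
  thus ?thesis
    by (simp add: mpow_superset[of ?A] lookup_add power_add prod.distrib)
qed

lemma mpow_single [simp]: "mpow X (Poly_Mapping.single n k) = X n ^ k"
  by (simp add: mpow_superset[of "{n}"])

lemma mpow_mult: "mpow (\<lambda>n. X n * Y n) m = mpow X m * mpow Y m"
  by (simp add: mpow_def power_mult_distrib prod.distrib)

lemma monomial_decomp:
  "Poly_Mapping.lookup m n \<noteq> 0 \<Longrightarrow> (m - Poly_Mapping.single n 1) + Poly_Mapping.single n 1 = (m :: monomial)"
  by (rule poly_mapping_eqI) (auto simp: lookup_add lookup_minus lookup_single when_def)

lemma mfact_decomp:
  assumes "Poly_Mapping.lookup m n \<noteq> 0"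
  shows "mfact m = mfact (m - Poly_Mapping.single n 1) * of_nat (Poly_Mapping.lookup m n)"
proof -
  have n: "n \<in> Poly_Mapping.keys m" using assms by (simp add: in_keys_iff)
  have sub: "Poly_Mapping.keys (m - Poly_Mapping.single n 1) \<subseteq> Poly_Mapping.keys m"
    by (auto simp: in_keys_iff lookup_minus)
  have "mfact m = fact (Poly_Mapping.lookup m n) * (\<Prod>i\<in>Poly_Mapping.keys m - {n}. fact (Poly_Mapping.lookup m i))"
    unfolding mfact_def using n by (simp add: prod.remove)
  moreover have "mfact (m - Poly_Mapping.single n 1) =
      fact (Poly_Mapping.lookup m n - 1) * (\<Prod>i\<in>Poly_Mapping.keys m - {n}. fact (Poly_Mapping.lookup m i))"
    unfolding mfact_superset[OF finite_keys sub] using n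
    by (subst prod.remove[of _ n])
       (auto simp: lookup_minus lookup_single when_def intro!: prod.cong)
  moreover have "(fact (Poly_Mapping.lookup m n) :: rat) = fact (Poly_Mapping.lookup m n - 1) * of_nat (Poly_Mapping.lookup m n)"
    using assms by (subst fact_reduce) auto
  ultimately show ?thesis by simp
qed

lemma u_degree_superset:
  "finite A \<Longrightarrow> Poly_Mapping.keys m \<subseteq> A \<Longrightarrow> u_degree m = (\<Sum>n\<in>A. Poly_Mapping.lookup m n)"
  unfolding u_degree_def by (rule sum.mono_neutral_left) (auto simp: in_keys_iff)

lemma u_degree_decomp:
  assumes "Poly_Mapping.lookup m n \<noteq> 0"
  shows "u_degree m = Suc (u_degree (m - Poly_Mapping.single n 1))"
proof -
  have n: "n \<in> Poly_Mapping.keys m" using assms by (simp add: in_keys_iff)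
  have sub: "Poly_Mapping.keys (m - Poly_Mapping.single n 1) \<subseteq> Poly_Mapping.keys m"
    by (auto simp: in_keys_iff lookup_minus)
  have "u_degree m = Poly_Mapping.lookup m n + (\<Sum>i\<in>Poly_Mapping.keys m - {n}. Poly_Mapping.lookup m i)"
    unfolding u_degree_def using n by (simp add: sum.remove)
  moreover have "u_degree (m - Poly_Mapping.single n 1) =
      Poly_Mapping.lookup m n - 1 + (\<Sum>i\<in>Poly_Mapping.keys m - {n}. Poly_Mapping.lookup m i)"
    unfolding u_degree_superset[OF finite_keys sub] using n
    by (subst sum.remove[of _ n])
       (auto simp: lookup_minus lookup_single when_def intro!: sum.cong)
  ultimately show ?thesis using assms by simp
qed

lemma u_degree_0 [simp]: "u_degree 0 = 0"
  by (simp add: u_degree_def)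

lemma u_weight_0 [simp]: "u_weight 0 = 0"
  by (simp add: u_weight_def)

lemma u_degree_eq_0_iff: "u_degree m = 0 \<longleftrightarrow> m = 0"
proof
  assume "u_degree m = 0"
  hence "Poly_Mapping.lookup m n = 0" for n by (auto simp: u_degree_def in_keys_iff)
  thus "m = 0" by (intro poly_mapping_eqI) simp
qed simp

lemma monom_box_keys: "m \<in> monom_box x \<Longrightarrow> Poly_Mapping.keys m \<subseteq> Poly_Mapping.keys x"
  unfolding monom_box_def by (auto simp: in_keys_iff intro: gr0I dest: spec) (metis le_zero_eq not_gr_zero)

text \<open>Divisors of \<open>x\<close> become choice functions on its variables, the index set
  that arises when a product of sums is multiplied out; finiteness follows as well.\<close>

lemma monom_box_bij:
  "bij_betw (\<lambda>m. restrict (Poly_Mapping.lookup m) (Poly_Mapping.keys x)) (monom_box x) (PiE (Poly_Mapping.keys x) (\<lambda>n. {..Poly_Mapping.lookup x n}))"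
proof (rule bij_betw_imageI)
  show "inj_on (\<lambda>m. restrict (Poly_Mapping.lookup m) (Poly_Mapping.keys x)) (monom_box x)"
  proof (intro inj_onI poly_mapping_eqI)
    fix m m' n assume m: "m \<in> monom_box x" "m' \<in> monom_box x"
      and eq: "restrict (Poly_Mapping.lookup m) (Poly_Mapping.keys x) = restrict (Poly_Mapping.lookup m') (Poly_Mapping.keys x)"
    show "Poly_Mapping.lookup m n = Poly_Mapping.lookup m' n"
    proof (cases "n \<in> Poly_Mapping.keys x")
      case True
      thus ?thesis using fun_cong[OF eq, of n] by simp
    next
      case False
      hence "n \<notin> Poly_Mapping.keys m" "n \<notin> Poly_Mapping.keys m'" using m[THEN monom_box_keys] by auto
      thus ?thesis by (simp add: in_keys_iff)
    qed
  qed
  show "(\<lambda>m. restrict (Poly_Mapping.lookup m) (Poly_Mapping.keys x)) ` monom_box x = PiE (Poly_Mapping.keys x) (\<lambda>n. {..Poly_Mapping.lookup x n})"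
  proof (intro equalityI subsetI)
    fix g assume g: "g \<in> PiE (Poly_Mapping.keys x) (\<lambda>n. {..Poly_Mapping.lookup x n})"
    define m where "m = Abs_poly_mapping (\<lambda>n. if n \<in> Poly_Mapping.keys x then g n else 0)"
    have m: "Poly_Mapping.lookup m n = (if n \<in> Poly_Mapping.keys x then g n else 0)" for n
      unfolding m_def by (subst lookup_Abs_poly_mapping) auto
    have "m \<in> monom_box x" using g by (auto simp: monom_box_def m)
    moreover have "g = restrict (Poly_Mapping.lookup m) (Poly_Mapping.keys x)"
      using g by (auto simp: fun_eq_iff m PiE_def extensional_def)
    ultimately show "g \<in> (\<lambda>m. restrict (Poly_Mapping.lookup m) (Poly_Mapping.keys x)) ` monom_box x" by blast
  qed (auto simp: monom_box_def)
qed

lemma finite_monom_box [simp]: "finite (monom_box x)"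
  using bij_betw_finite[OF monom_box_bij[of x]] by (simp add: finite_PiE)

text \<open>The multivariate binomial theorem: one binomial expansion per variable, multiplied out
  over the divisors of \<open>x\<close>.\<close>

lemma mpow_plus:
  fixes P y :: "nat \<Rightarrow> 'a :: comm_ring_1"
  shows "mpow (\<lambda>n. P n + y n) x = (\<Sum>m\<in>monom_box x.
    (\<Prod>n\<in>Poly_Mapping.keys x. of_nat (Poly_Mapping.lookup x n choose Poly_Mapping.lookup m n)) * mpow y m * mpow P (x - m))"
proof -
  let ?t = "\<lambda>n j. of_nat (Poly_Mapping.lookup x n choose j) * y n ^ j * P n ^ (Poly_Mapping.lookup x n - j)"
  have "mpow (\<lambda>n. P n + y n) x = (\<Prod>n\<in>Poly_Mapping.keys x. \<Sum>j\<in>{..Poly_Mapping.lookup x n}. ?t n j)"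
    unfolding mpow_def by (intro prod.cong refl) (simp add: add.commute[of "P _"] binomial_ring)
  also have "\<dots> = (\<Sum>g\<in>PiE (Poly_Mapping.keys x) (\<lambda>n. {..Poly_Mapping.lookup x n}). \<Prod>n\<in>Poly_Mapping.keys x. ?t n (g n))"
    by (rule prod_sum_PiE) auto
  also have "\<dots> = (\<Sum>m\<in>monom_box x. \<Prod>n\<in>Poly_Mapping.keys x. ?t n (restrict (Poly_Mapping.lookup m) (Poly_Mapping.keys x) n))"
    by (rule sum.reindex_bij_betw[OF monom_box_bij, symmetric])
  also have "\<dots> = (\<Sum>m\<in>monom_box x.
    (\<Prod>n\<in>Poly_Mapping.keys x. of_nat (Poly_Mapping.lookup x n choose Poly_Mapping.lookup m n)) * mpow y m * mpow P (x - m))"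
  proof (rule sum.cong[OF refl])
    fix m assume m: "m \<in> monom_box x"
    have "mpow y m = (\<Prod>n\<in>Poly_Mapping.keys x. y n ^ Poly_Mapping.lookup m n)"
      by (rule mpow_superset[OF finite_keys monom_box_keys[OF m]])
    moreover have "mpow P (x - m) = (\<Prod>n\<in>Poly_Mapping.keys x. P n ^ (Poly_Mapping.lookup x n - Poly_Mapping.lookup m n))"
      by (subst mpow_superset[of "Poly_Mapping.keys x"]) (auto simp: in_keys_iff lookup_minus)
    ultimately show "(\<Prod>n\<in>Poly_Mapping.keys x. ?t n (restrict (Poly_Mapping.lookup m) (Poly_Mapping.keys x) n)) =
      (\<Prod>n\<in>Poly_Mapping.keys x. of_nat (Poly_Mapping.lookup x n choose Poly_Mapping.lookup m n)) * mpow y m * mpow P (x - m)"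
      by (simp add: prod.distrib)
  qed
  finally show ?thesis .
qed

section \<open>Evaluation as a ring homomorphism\<close>

definition R_poly_eval :: "(nat \<Rightarrow> rat) \<Rightarrow> R_poly \<Rightarrow> rat" where
  "R_poly_eval P f = (\<Sum>m\<in>Poly_Mapping.keys f. Poly_Mapping.lookup f m * mpow P m)"

lemma R_eval_eq: "R_eval f l = R_poly_eval (\<lambda>n. Q_fun (n + 1) l) f"
  by (simp add: R_eval_def R_poly_eval_def mpow_def)

lemma R_poly_eval_superset:
  "finite A \<Longrightarrow> Poly_Mapping.keys f \<subseteq> A \<Longrightarrow> R_poly_eval P f = (\<Sum>m\<in>A. Poly_Mapping.lookup f m * mpow P m)"
  unfolding R_poly_eval_def by (rule sum.mono_neutral_left) (auto simp: in_keys_iff)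

lemma R_poly_eval_add: "R_poly_eval P (f + g) = R_poly_eval P f + R_poly_eval P g"
proof -
  let ?A = "Poly_Mapping.keys f \<union> Poly_Mapping.keys g"
  have "Poly_Mapping.keys (f + g) \<subseteq> ?A" by (rule Poly_Mapping.keys_add)
  thus ?thesis
    by (simp add: R_poly_eval_superset[of ?A] lookup_add ring_distribs sum.distrib)
qed

lemma R_poly_eval_0 [simp]: "R_poly_eval P 0 = 0"
  by (simp add: R_poly_eval_def)

lemma R_poly_eval_sum: "R_poly_eval P (sum f A) = (\<Sum>x\<in>A. R_poly_eval P (f x))"
  by (induction A rule: infinite_finite_induct) (auto simp: R_poly_eval_add)

lemma R_poly_eval_single [simp]: "R_poly_eval P (Poly_Mapping.single m c) = c * mpow P m"
  by (simp add: R_poly_eval_superset[of "{m}"])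

lemma R_poly_expand: "f = (\<Sum>m\<in>Poly_Mapping.keys f. Poly_Mapping.single m (Poly_Mapping.lookup f m))"
proof (rule poly_mapping_eqI)
  fix k
  have "Poly_Mapping.lookup (\<Sum>m\<in>Poly_Mapping.keys f. Poly_Mapping.single m (Poly_Mapping.lookup f m)) k = (\<Sum>m\<in>Poly_Mapping.keys f. if m = k then Poly_Mapping.lookup f k else 0)"
    by (auto simp: lookup_sum lookup_single when_def intro!: sum.cong)
  thus "Poly_Mapping.lookup f k = Poly_Mapping.lookup (\<Sum>m\<in>Poly_Mapping.keys f. Poly_Mapping.single m (Poly_Mapping.lookup f m)) k"
    by (simp add: in_keys_iff)
qed

lemma R_poly_eval_mult: "R_poly_eval P (f * g) = R_poly_eval P f * R_poly_eval P g"
proof -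
  have "f * g = (\<Sum>m\<in>Poly_Mapping.keys f. Poly_Mapping.single m (Poly_Mapping.lookup f m)) * (\<Sum>m\<in>Poly_Mapping.keys g. Poly_Mapping.single m (Poly_Mapping.lookup g m))"
    using R_poly_expand[of f] R_poly_expand[of g] by simp
  also have "R_poly_eval P \<dots> = (\<Sum>m\<in>Poly_Mapping.keys f. \<Sum>n\<in>Poly_Mapping.keys g. (Poly_Mapping.lookup f m * mpow P m) * (Poly_Mapping.lookup g n * mpow P n))"
    by (simp add: sum_product R_poly_eval_sum mult_single mpow_add mult_ac)
  also have "\<dots> = R_poly_eval P f * R_poly_eval P g"
    by (simp add: R_poly_eval_def sum_product)
  finally show ?thesis .
qed

lemma R_poly_eval_const [simp]: "R_poly_eval P (R_const c) = c"
  by (simp add: R_const_def)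

lemma R_eval_Q_sym: "R_poly_eval (\<lambda>n. Q_fun (n + 1) l) (Q_sym k) = Q_fun k l"
proof (cases "k = 0")
  case True
  thus ?thesis using R_poly_eval_single[of _ 0 1] by (simp add: Q_sym_def Q_fun_def)
next
  case False
  thus ?thesis by (simp add: Q_sym_def)
qed

section \<open>Iterated partial derivatives on monomials\<close>

lemma additive_funpow:
  fixes D :: "'a :: ab_group_add \<Rightarrow> 'a"
  shows "Modules.additive D \<Longrightarrow> Modules.additive (D ^^ k)"
  by (induction k) (auto simp: Modules.additive_def)

lemma deriv_Q_superset:
  assumes "finite A" "Poly_Mapping.keys f \<subseteq> A"
  shows "deriv_Q k f = (\<Sum>m\<in>A. Poly_Mapping.single (m - Poly_Mapping.single (k - 1) 1) (of_nat (Poly_Mapping.lookup m (k - 1)) * Poly_Mapping.lookup f m))"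
  unfolding deriv_Q_def using assms
  by (intro sum.mono_neutral_left) (auto simp: in_keys_iff)

lemma additive_deriv_Q: "Modules.additive (deriv_Q k)"
proof
  fix f g :: R_poly
  let ?A = "Poly_Mapping.keys f \<union> Poly_Mapping.keys g"
  have "Poly_Mapping.keys (f + g) \<subseteq> ?A" by (rule Poly_Mapping.keys_add)
  thus "deriv_Q k (f + g) = deriv_Q k f + deriv_Q k g"
    by (simp add: deriv_Q_superset[of ?A] lookup_add ring_distribs single_add sum.distrib)
qed

lemma additive_deriv_p: "Modules.additive (deriv_p r)"
  using additive_deriv_Q[of "r + 1"] by (auto simp: Modules.additive_def deriv_p_def ring_distribs)

lemma deriv_p_single:
  "deriv_p r (Poly_Mapping.single m c) = Poly_Mapping.single (m - Poly_Mapping.single r 1) (of_nat (Poly_Mapping.lookup m r) / fact r * c)"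
  unfolding deriv_p_def by (subst deriv_Q_superset[of "{m}"]) (auto simp: R_const_def mult_single)

text \<open>Binomial coefficient times factorial is the falling factorial, which acquires the factor
  \<open>n - k\<close> from the next derivative.\<close>

lemma choose_fact_step:
  "of_nat (n - k) * (of_nat (n choose k) * fact k) = (of_nat (n choose Suc k) * fact (Suc k) :: rat)"
proof -
  have "(n - k) * (n choose k) = Suc k * (n choose Suc k)"
    by (simp only: binomial_absorption binomial_absorb_comp)
  hence "of_nat (n - k) * of_nat (n choose k) = (of_nat (Suc k) * of_nat (n choose Suc k) :: rat)"
    by (metis of_nat_mult)
  thus ?thesis by (simp add: mult_ac del: of_nat_Suc)
qed

text \<open>Subtraction of exponents is truncated; once \<open>k\<close> exceeds the exponent of
  \<open>r\<close>, the binomial coefficient is 0 and the formula stays correct.\<close>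

lemma deriv_p_funpow_single:
  "(deriv_p r ^^ k) (Poly_Mapping.single m c) =
     Poly_Mapping.single (m - Poly_Mapping.single r k) (of_nat (Poly_Mapping.lookup m r choose k) * fact k / fact r ^ k * c)"
proof (induction k)
  case (Suc k)
  have "m - Poly_Mapping.single r k - Poly_Mapping.single r 1 = m - Poly_Mapping.single r (Suc k)"
    by (rule poly_mapping_eqI) (auto simp: lookup_minus lookup_single when_def)
  moreover have "of_nat (Poly_Mapping.lookup (m - Poly_Mapping.single r k) r) / fact r *
      (of_nat (Poly_Mapping.lookup m r choose k) * fact k / fact r ^ k * c) =
      of_nat (Poly_Mapping.lookup m r choose Suc k) * fact (Suc k) / fact r ^ Suc k * c"
    unfolding choose_fact_step[symmetric] by (simp add: lookup_minus)
  ultimately show ?case by (simp only: funpow.simps o_def Suc.IH deriv_p_single)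
qed simp

definition deriv_coeff :: "monomial \<Rightarrow> monomial \<Rightarrow> rat" where
  "deriv_coeff x m = (\<Prod>r\<in>Poly_Mapping.keys m. of_nat (Poly_Mapping.lookup x r choose Poly_Mapping.lookup m r) * fact (Poly_Mapping.lookup m r) / fact r ^ Poly_Mapping.lookup m r)"

text \<open>Distinctness ensures that derivations already applied have not touched the exponents of
  the variables still to come.\<close>

lemma fold_deriv_p_single:
  assumes "distinct rs"
  shows "fold (\<lambda>r. deriv_p r ^^ Poly_Mapping.lookup m r) rs (Poly_Mapping.single x c) =
    Poly_Mapping.single (x - (\<Sum>r\<in>set rs. Poly_Mapping.single r (Poly_Mapping.lookup m r)))
      (c * (\<Prod>r\<in>set rs. of_nat (Poly_Mapping.lookup x r choose Poly_Mapping.lookup m r) * fact (Poly_Mapping.lookup m r) / fact r ^ Poly_Mapping.lookup m r))"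
  using assms
proof (induction rs arbitrary: x c)
  case (Cons r rs)
  let ?x = "x - Poly_Mapping.single r (Poly_Mapping.lookup m r)"
  have "x - Poly_Mapping.single r (Poly_Mapping.lookup m r) - (\<Sum>r\<in>set rs. Poly_Mapping.single r (Poly_Mapping.lookup m r)) = x - (\<Sum>r\<in>set (r # rs). Poly_Mapping.single r (Poly_Mapping.lookup m r))"
    using Cons.prems by (intro poly_mapping_eqI) (simp add: lookup_minus lookup_add)
  moreover have "(\<Prod>r\<in>set rs. of_nat (Poly_Mapping.lookup ?x r choose Poly_Mapping.lookup m r) * fact (Poly_Mapping.lookup m r) / fact r ^ Poly_Mapping.lookup m r) =
      (\<Prod>r\<in>set rs. of_nat (Poly_Mapping.lookup x r choose Poly_Mapping.lookup m r) * fact (Poly_Mapping.lookup m r) / fact r ^ Poly_Mapping.lookup m r :: rat)"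
    using Cons.prems
    by (intro prod.cong refl) (auto simp: lookup_minus lookup_single when_def)
  ultimately show ?case
    using Cons.prems by (simp add: deriv_p_funpow_single Cons.IH mult_ac)
qed simp

lemma deriv_monomial_single: "deriv_monomial m (Poly_Mapping.single x c) = Poly_Mapping.single (x - m) (c * deriv_coeff x m)"
  unfolding deriv_monomial_def deriv_coeff_def
  by (subst fold_deriv_p_single) (simp_all flip: R_poly_expand)

lemma additive_deriv_monomial: "Modules.additive (deriv_monomial m)"
proof -
  have "Modules.additive (fold (\<lambda>r. deriv_p r ^^ Poly_Mapping.lookup m r) rs)" for rs
  proof (induction rs)
    case (Cons r rs)
    thus ?case using additive_funpow[OF additive_deriv_p[of r], of "Poly_Mapping.lookup m r"]
      by (auto simp: Modules.additive_def)
  qed (auto simp: Modules.additive_def)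
  thus ?thesis by (simp add: deriv_monomial_def)
qed

lemma deriv_monomial_eq:
  "deriv_monomial m f = (\<Sum>x\<in>Poly_Mapping.keys f. Poly_Mapping.single (x - m) (Poly_Mapping.lookup f x * deriv_coeff x m))"
proof -
  have "deriv_monomial m f = deriv_monomial m (\<Sum>x\<in>Poly_Mapping.keys f. Poly_Mapping.single x (Poly_Mapping.lookup f x))"
    using R_poly_expand[of f] by simp
  also have "\<dots> = (\<Sum>x\<in>Poly_Mapping.keys f. deriv_monomial m (Poly_Mapping.single x (Poly_Mapping.lookup f x)))"
    by (rule Modules.additive.sum[OF additive_deriv_monomial])
  finally show ?thesis by (simp add: deriv_monomial_single)
qed

lemma deriv_coeff_eq_0:
  assumes "m \<notin> monom_box x"
  shows "deriv_coeff x m = 0"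
proof -
  obtain r where "Poly_Mapping.lookup m r > Poly_Mapping.lookup x r" using assms by (auto simp: monom_box_def not_le)
  thus ?thesis unfolding deriv_coeff_def by (auto simp: in_keys_iff intro!: bexI[of _ r])
qed

lemma deriv_monomial_0 [simp]: "deriv_monomial 0 f = f"
  by (simp add: deriv_monomial_def)

text \<open>A finite set outside which \<open>deriv_monomial m f\<close> vanishes. The monomial 0 is
  inserted so that the undifferentiated term is always present, also for
  \<open>f = 0\<close>.\<close>

definition deriv_support :: "R_poly \<Rightarrow> monomial set" where
  "deriv_support f = insert 0 (\<Union>x\<in>Poly_Mapping.keys f. monom_box x)"

lemma finite_deriv_support [simp]: "finite (deriv_support f)"
  by (simp add: deriv_support_def)

lemma deriv_monomial_eq_0: "m \<notin> deriv_support f \<Longrightarrow> deriv_monomial m f = 0"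
  unfolding deriv_monomial_eq by (intro sum.neutral) (auto simp: deriv_support_def deriv_coeff_eq_0)

text \<open>Taylor's formula in the coordinates \<open>p\<^sub>n\<close>: a translation of
  \<open>p\<^sub>n\<close> by \<open>v n\<close> is one of the variable \<open>n\<close>, that is of
  \<open>Q\<^sub>k\<close> with \<open>k = n + 1\<close>, by \<open>v n / n!\<close>.\<close>

lemma R_poly_eval_taylor:
  "R_poly_eval (\<lambda>n. P n + v n / fact n) f =
    (\<Sum>m\<in>deriv_support f. mpow v m / mfact m * R_poly_eval P (deriv_monomial m f))"
proof -
  have "R_poly_eval (\<lambda>n. P n + v n / fact n) f = (\<Sum>x\<in>Poly_Mapping.keys f. \<Sum>m\<in>deriv_support f.
      mpow v m / mfact m * (Poly_Mapping.lookup f x * deriv_coeff x m * mpow P (x - m)))"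
    unfolding R_poly_eval_def
  proof (rule sum.cong[OF refl])
    fix x assume x: "x \<in> Poly_Mapping.keys f"
    have "Poly_Mapping.lookup f x * mpow (\<lambda>n. P n + v n / fact n) x = (\<Sum>m\<in>monom_box x.
       mpow v m / mfact m * (Poly_Mapping.lookup f x * deriv_coeff x m * mpow P (x - m)))"
      unfolding mpow_plus sum_distrib_left
    proof (rule sum.cong[OF refl])
      fix m assume m: "m \<in> monom_box x"
      note sub = monom_box_keys[OF m]
      have "deriv_coeff x m = (\<Prod>r\<in>Poly_Mapping.keys x. of_nat (Poly_Mapping.lookup x r choose Poly_Mapping.lookup m r) * fact (Poly_Mapping.lookup m r) / fact r ^ Poly_Mapping.lookup m r)"
        unfolding deriv_coeff_def using sub by (intro prod.mono_neutral_left) (auto simp: in_keys_iff)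
      hence key: "mpow v m / mfact m * deriv_coeff x m =
         (\<Prod>n\<in>Poly_Mapping.keys x. of_nat (Poly_Mapping.lookup x n choose Poly_Mapping.lookup m n)) * mpow (\<lambda>n. v n / fact n) m"
        unfolding mpow_superset[OF finite_keys sub] mfact_superset[OF finite_keys sub]
        by (simp add: prod.distrib[symmetric] prod_dividef[symmetric] power_divide mult_ac)
      show "Poly_Mapping.lookup f x * ((\<Prod>n\<in>Poly_Mapping.keys x. of_nat (Poly_Mapping.lookup x n choose Poly_Mapping.lookup m n)) * mpow (\<lambda>n. v n / fact n) m * mpow P (x - m))
        = mpow v m / mfact m * (Poly_Mapping.lookup f x * deriv_coeff x m * mpow P (x - m))"
        unfolding key[symmetric] by (simp only: mult_ac)
    qed
    also have "\<dots> = (\<Sum>m\<in>deriv_support f. mpow v m / mfact m * (Poly_Mapping.lookup f x * deriv_coeff x m * mpow P (x - m)))"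
      using x by (intro sum.mono_neutral_left) (auto simp: deriv_support_def deriv_coeff_eq_0)
    finally show "Poly_Mapping.lookup f x * mpow (\<lambda>n. P n + v n / fact n) x =
       (\<Sum>m\<in>deriv_support f. mpow v m / mfact m * (Poly_Mapping.lookup f x * deriv_coeff x m * mpow P (x - m)))" .
  qed
  also have "\<dots> = (\<Sum>m\<in>deriv_support f. mpow v m / mfact m * R_poly_eval P (deriv_monomial m f))"
    by (subst sum.swap) (simp add: deriv_monomial_eq R_poly_eval_sum sum_distrib_left)
  finally show ?thesis .
qed

section \<open>The series \<open>\<rho>\<close>\<close>

text \<open>The coefficient of the variable \<open>n\<close> in U(t) - U(t-1), as a polynomial in t;
  it is 0 for \<open>n = 0\<close>.\<close>

definition X_poly :: "nat \<Rightarrow> rat poly" where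
  "X_poly n = [:0, 1:] ^ n - [:-1, 1:] ^ n"

definition U_diff :: "rat poly useries" where
  "U_diff m = U_series [:0, 1:] m - U_series [:-1, 1:] m"

section \<open>The coefficients of the exponential series\<close>

lemma inj_single_one: "inj (\<lambda>n. Poly_Mapping.single n (1 :: nat))"
  by (rule injI) (metis lookup_single_eq lookup_single_not_eq zero_neq_one)

lemma U_diff_single: "U_diff (Poly_Mapping.single n 1) = X_poly n"
proof -
  have "U_series s (Poly_Mapping.single n 1) = (if n = 0 then 0 else s ^ n)" for s
  proof -
    have "{k. 1 \<le> k \<and> Poly_Mapping.single n (1::nat) = Poly_Mapping.single k 1} = (if n = 0 then {} else {n})"
      using inj_single_one by (auto simp: inj_def)
    thus ?thesis by (simp add: U_series_def)
  qed
  thus ?thesis by (simp add: U_diff_def X_poly_def)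
qed

lemma U_diff_eq_0:
  assumes "\<And>n. m \<noteq> Poly_Mapping.single n 1"
  shows "U_diff m = 0"
  using assms by (simp add: U_diff_def U_series_def)

text \<open>\<open>U_diff\<close> is supported on single variables, so in a product it can only take
  one variable out of \<open>m\<close>.\<close>

lemma useries_mult_U_diff:
  "useries_mult U_diff G m = (\<Sum>n\<in>Poly_Mapping.keys m. X_poly n * G (m - Poly_Mapping.single n 1))"
proof -
  let ?S = "{(a, b). a + b = m}" and ?i = "\<lambda>n. (Poly_Mapping.single n (1 :: nat), m - Poly_Mapping.single n 1)"
  have "?S \<subseteq> monom_box m \<times> monom_box m"
    by (auto simp: monom_box_def lookup_add)
  hence fin: "finite ?S" by (rule finite_subset) simp
  have inj: "inj_on ?i (Poly_Mapping.keys m)"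
    using inj_single_one by (auto simp: inj_on_def)
  have "useries_mult U_diff G m = (\<Sum>(a, b)\<in>?S. U_diff a * G b)"
    by (simp add: useries_mult_def)
  also have "\<dots> = (\<Sum>(a, b)\<in>?i ` Poly_Mapping.keys m. U_diff a * G b)"
  proof (intro sum.mono_neutral_right ballI fin subsetI)
    fix ab assume "ab \<in> ?i ` Poly_Mapping.keys m"
    then obtain n where "n \<in> Poly_Mapping.keys m" "ab = ?i n" by blast
    thus "ab \<in> ?S" using monomial_decomp[of m n] by (simp add: in_keys_iff add.commute)
  next
    fix ab assume ab: "ab \<in> ?S - ?i ` Poly_Mapping.keys m"
    obtain a b where [simp]: "ab = (a, b)" by force
    have m: "a + b = m" using ab by simp
    have "U_diff a = 0"
    proof (rule U_diff_eq_0)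
      fix n show "a \<noteq> Poly_Mapping.single n 1"
      proof
        assume a: "a = Poly_Mapping.single n 1"
        have "Poly_Mapping.lookup m n \<noteq> 0" using m a by (auto simp: lookup_add)
        moreover have "b = m - Poly_Mapping.single n 1" using m a by (metis add_diff_cancel_left')
        ultimately have "(a, b) \<in> ?i ` Poly_Mapping.keys m" using a by (auto simp: in_keys_iff)
        thus False using ab by simp
      qed
    qed
    thus "(case ab of (a, b) \<Rightarrow> U_diff a * G b) = 0" by simp
  qed
  also have "\<dots> = (\<Sum>n\<in>Poly_Mapping.keys m. X_poly n * G (m - Poly_Mapping.single n 1))"
    by (subst sum.reindex[OF inj]) (simp add: U_diff_single[simplified])
  finally show ?thesis .
qed

text \<open>The multinomial theorem. In the induction step, the exponents of the variables that can
  be taken out add up to the degree \<open>Suc d\<close>, which completes the factorial.\<close>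

lemma useries_power_U_diff:
  "(useries_mult U_diff ^^ d) useries_one m =
     (if u_degree m = d then Polynomial.smult (fact d / mfact m) (mpow X_poly m) else 0)"
proof (induction d arbitrary: m)
  case 0
  show ?case by (auto simp: useries_one_def u_degree_eq_0_iff)
next
  case (Suc d)
  have "(useries_mult U_diff ^^ Suc d) useries_one m =
      (\<Sum>n\<in>Poly_Mapping.keys m. X_poly n * (if u_degree (m - Poly_Mapping.single n 1) = d then
        Polynomial.smult (fact d / mfact (m - Poly_Mapping.single n 1)) (mpow X_poly (m - Poly_Mapping.single n 1)) else 0))"
    by (simp only: funpow.simps o_def useries_mult_U_diff Suc.IH)
  also have "\<dots> = (\<Sum>n\<in>Poly_Mapping.keys m. if u_degree m = Suc d then
        Polynomial.smult (of_nat (Poly_Mapping.lookup m n) * (fact d / mfact m)) (mpow X_poly m) else 0)"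
  proof (rule sum.cong[OF refl])
    fix n assume "n \<in> Poly_Mapping.keys m"
    hence n: "Poly_Mapping.lookup m n \<noteq> 0" by (simp add: in_keys_iff)
    have "X_poly n * mpow X_poly (m - Poly_Mapping.single n 1) = mpow X_poly m"
      using mpow_add[of X_poly "m - Poly_Mapping.single n 1" "Poly_Mapping.single n 1"] monomial_decomp[OF n] by (simp add: mult.commute)
    moreover have "fact d / mfact (m - Poly_Mapping.single n 1) = of_nat (Poly_Mapping.lookup m n) * (fact d / mfact m)"
      using n by (simp add: mfact_decomp[OF n])
    ultimately show "X_poly n * (if u_degree (m - Poly_Mapping.single n 1) = d then
        Polynomial.smult (fact d / mfact (m - Poly_Mapping.single n 1)) (mpow X_poly (m - Poly_Mapping.single n 1)) else 0) =
      (if u_degree m = Suc d then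
        Polynomial.smult (of_nat (Poly_Mapping.lookup m n) * (fact d / mfact m)) (mpow X_poly m) else 0)"
      by (simp add: u_degree_decomp[OF n])
  qed
  also have "\<dots> = (if u_degree m = Suc d then
      Polynomial.smult (of_nat (u_degree m) * (fact d / mfact m)) (mpow X_poly m) else 0)"
  proof -
    have "(\<Sum>n\<in>Poly_Mapping.keys m. Polynomial.smult (of_nat (Poly_Mapping.lookup m n) * (fact d / mfact m)) (mpow X_poly m)) =
        Polynomial.smult (of_nat (u_degree m) * (fact d / mfact m)) (mpow X_poly m)"
      unfolding u_degree_def of_nat_sum sum_distrib_right smult_sum ..
    thus ?thesis by auto
  qed
  also have "\<dots> = (if u_degree m = Suc d then
      Polynomial.smult (fact (Suc d) / mfact m) (mpow X_poly m) else 0)"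
    by simp
  finally show ?case .
qed

text \<open>A monomial occurs only in the power equal to its degree, where the factorial
  cancels.\<close>

lemma useries_exp_U_diff: "useries_exp U_diff m = Polynomial.smult (1 / mfact m) (mpow X_poly m)"
proof -
  have "useries_exp U_diff m = (\<Sum>d\<in>{u_degree m}.
     Polynomial.smult (1 / fact d) ((useries_mult U_diff ^^ d) useries_one m))"
    unfolding useries_exp_def
    by (rule Sum_any.expand_superset) (auto simp: useries_power_U_diff)
  thus ?thesis by (simp add: useries_power_U_diff)
qed

section \<open>The integral from v to v + 1\<close>

abbreviation shift_integral :: "rat poly \<Rightarrow> rat poly" where
  "shift_integral \<equiv> poly_integral [:0, 1:] [:1, 1:]"

lemma rho_gen_eq: "rho_gen m = shift_integral (Polynomial.smult (1 / mfact m) (mpow X_poly m))"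
  unfolding rho_gen_def using useries_exp_U_diff[of m] by (simp add: U_diff_def[abs_def])

lemma pderiv_antideriv: "pderiv (poly_antideriv P) = P"
proof (rule poly_eqI)
  fix k
  have "coeff (poly_antideriv P) (Suc k) = (\<Sum>i\<le>degree P. if i = k then coeff P i / of_nat (i + 1) else 0)"
    unfolding poly_antideriv_def coeff_sum by (intro sum.cong) auto
  also have "\<dots> = coeff P k / of_nat (k + 1)"
    by (auto simp: coeff_eq_0)
  finally show "coeff (pderiv (poly_antideriv P)) k = coeff P k"
    by (simp add: coeff_pderiv del: of_nat_Suc)
qed

text \<open>Antiderivatives differ by a constant, which cancels between the two end points, so any
  convenient one may replace \<open>poly_antideriv\<close>.\<close>

lemma shift_integral_eqI:
  assumes "pderiv A = P"
  shows "shift_integral P = pcompose A [:1, 1:] - A"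
proof -
  have "pderiv (A - poly_antideriv P) = 0"
    by (simp add: pderiv_diff pderiv_antideriv assms)
  then obtain c where "A - poly_antideriv P = [:c:]"
    by (metis pderiv_iszero)
  hence "A = poly_antideriv P + [:c:]" by (simp add: algebra_simps)
  thus ?thesis by (simp add: poly_integral_def pcompose_add)
qed

lemma shift_integral_add: "shift_integral (P + Q) = shift_integral P + shift_integral Q"
  using shift_integral_eqI[of "poly_antideriv P + poly_antideriv Q" "P + Q"]
  by (simp add: pderiv_add pderiv_antideriv pcompose_add poly_integral_def)

lemma shift_integral_smult: "shift_integral (Polynomial.smult c P) = Polynomial.smult c (shift_integral P)"
  using shift_integral_eqI[of "Polynomial.smult c (poly_antideriv P)" "Polynomial.smult c P"]
  by (simp add: pderiv_smult pderiv_antideriv pcompose_smult poly_integral_def smult_diff_right)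

lemma shift_integral_sum: "shift_integral (sum f A) = (\<Sum>x\<in>A. shift_integral (f x))"
proof (induction A rule: infinite_finite_induct)
  case empty
  show ?case using shift_integral_smult[of 0 0] by simp
qed (use shift_integral_smult[of 0 0] in \<open>auto simp: shift_integral_add\<close>)

lemma pcompose_power: "pcompose (P ^ n) Q = pcompose P Q ^ n"
  by (induction n) (auto simp: pcompose_mult pcompose_1)

lemma coeff_power_0: "coeff ([:0, 1 :: rat:] ^ n) k = (if k = n then 1 else 0)"
proof -
  have "[:0, 1 :: rat:] ^ n = monom 1 n" by (simp add: monom_altdef)
  thus ?thesis by simp
qed

lemma coeff_power_1: "coeff ([:1, 1 :: rat:] ^ n) k = of_nat (n choose k)"
  by (cases "k \<le> n") (auto simp: coeff_linear_poly_power coeff_eq_0 degree_linear_power)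

lemma coeff_shift_integral_power:
  "coeff (shift_integral ([:0, 1:] ^ d)) k =
     (if k \<le> d then of_nat (Suc d choose k) / of_nat (Suc d) else 0)"
proof -
  let ?A = "Polynomial.smult (1 / of_nat (Suc d)) ([:0, 1 :: rat:] ^ Suc d)"
  have "pderiv ?A = [:0, 1:] ^ d"
    by (simp only: pderiv_smult pderiv_power_Suc) (simp add: pderiv_pCons del: of_nat_Suc)
  from shift_integral_eqI[OF this]
  have "shift_integral ([:0, 1:] ^ d) =
     Polynomial.smult (1 / of_nat (Suc d)) ([:1, 1:] ^ Suc d - [:0, 1:] ^ Suc d)"
    by (simp add: pcompose_smult smult_diff_right pcompose_power pcompose_pCons del: power_Suc of_nat_Suc)
  thus ?thesis
    by (auto simp: coeff_power_1 coeff_power_0 simp del: power_Suc of_nat_Suc)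
qed

lemma coeff_shift_integral:
  "coeff (shift_integral P) k =
     (\<Sum>d\<le>degree P. coeff P d * (if k \<le> d then of_nat (Suc d choose k) / of_nat (Suc d) else 0))"
proof -
  have "P = (\<Sum>d\<le>degree P. Polynomial.smult (coeff P d) ([:0, 1:] ^ d))"
    using poly_as_sum_of_monoms[of P] by (simp add: monom_altdef)
  hence "coeff (shift_integral P) k =
      coeff (shift_integral (\<Sum>d\<le>degree P. Polynomial.smult (coeff P d) ([:0, 1:] ^ d))) k" by simp
  also have "\<dots> = (\<Sum>d\<le>degree P. coeff P d * coeff (shift_integral ([:0, 1:] ^ d)) k)"
    by (simp add: shift_integral_sum shift_integral_smult coeff_sum)
  finally show ?thesis by (simp only: coeff_shift_integral_power)
qed

lemma coeff_shift_integral_eq_0: "k > degree P \<Longrightarrow> coeff (shift_integral P) k = 0"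
  unfolding coeff_shift_integral by (intro sum.neutral) auto

section \<open>Degree bounds and reflection symmetry\<close>

lemma X_poly_0 [simp]: "X_poly 0 = 0"
  by (simp add: X_poly_def)

lemma degree_X_poly:
  assumes "n > 0"
  shows "degree (X_poly n) \<le> n - 1"
proof (rule degree_le, intro allI impI)
  fix i assume i: "n - 1 < i"
  show "coeff (X_poly n) i = 0"
  proof (cases "i = n")
    case True
    thus ?thesis by (simp add: X_poly_def coeff_linear_power coeff_power_0)
  next
    case False
    hence "i > n" using i by simp
    thus ?thesis by (simp add: X_poly_def coeff_power_0 coeff_eq_0 degree_linear_power)
  qed
qed

text \<open>A variable \<open>n > 0\<close> has weight \<open>n + 1\<close> and contributes at most
  \<open>n - 1\<close> to the degree in t, since the leading terms in \<open>X_poly n\<close>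
  cancel.\<close>

lemma degree_mpow_X_poly:
  assumes "0 \<notin> Poly_Mapping.keys m"
  shows "degree (mpow X_poly m) + 2 * u_degree m \<le> u_weight m"
proof -
  have "degree (mpow X_poly m) \<le> (\<Sum>n\<in>Poly_Mapping.keys m. degree (X_poly n ^ Poly_Mapping.lookup m n))"
    unfolding mpow_def using degree_prod_sum_le[OF finite_keys, of "\<lambda>n. X_poly n ^ Poly_Mapping.lookup m n" m] by (simp add: o_def)
  also have "\<dots> \<le> (\<Sum>n\<in>Poly_Mapping.keys m. (n - 1) * Poly_Mapping.lookup m n)"
  proof (rule sum_mono)
    fix n assume "n \<in> Poly_Mapping.keys m"
    hence "n > 0" using assms by (cases n) auto
    have "degree (X_poly n ^ Poly_Mapping.lookup m n) \<le> degree (X_poly n) * Poly_Mapping.lookup m n" by (rule degree_power_le)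
    also have "\<dots> \<le> (n - 1) * Poly_Mapping.lookup m n" using degree_X_poly[OF \<open>n > 0\<close>] by simp
    finally show "degree (X_poly n ^ Poly_Mapping.lookup m n) \<le> (n - 1) * Poly_Mapping.lookup m n" .
  qed
  finally have "degree (mpow X_poly m) + 2 * u_degree m \<le>
      (\<Sum>n\<in>Poly_Mapping.keys m. (n - 1) * Poly_Mapping.lookup m n + 2 * Poly_Mapping.lookup m n)"
    by (simp add: u_degree_def sum.distrib sum_distrib_left)
  also have "\<dots> = u_weight m"
    unfolding u_weight_def
  proof (rule sum.cong[OF refl])
    fix n assume "n \<in> Poly_Mapping.keys m"
    hence "n > 0" using assms by (cases n) auto
    thus "(n - 1) * Poly_Mapping.lookup m n + 2 * Poly_Mapping.lookup m n = (n + 1) * Poly_Mapping.lookup m n"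
      by (cases n) (auto simp: algebra_simps)
  qed
  finally show ?thesis .
qed

lemma mpow_X_poly_eq_0: "0 \<in> Poly_Mapping.keys m \<Longrightarrow> mpow X_poly m = 0"
  unfolding mpow_def by (rule prod_zero) (auto simp: in_keys_iff intro!: bexI[of _ 0])

text \<open>The map from t to 1 - t exchanges t and t - 1 up to sign, giving \<open>n\<close> signs
  from the powers and one from the exchange.\<close>

lemma X_poly_reflect: "pcompose (X_poly n) [:1, -1:] = Polynomial.smult ((-1) ^ (n + 1)) (X_poly n)"
proof -
  have 1: "[:1, -1 :: rat:] = Polynomial.smult (-1) [:-1, 1:]" by simp
  have 2: "[:0, -1 :: rat:] = Polynomial.smult (-1) [:0, 1:]" by simp
  have "pcompose (X_poly n) [:1, -1:] = [:1, -1:] ^ n - [:0, -1:] ^ n"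
    by (simp add: X_poly_def pcompose_diff pcompose_power pcompose_pCons)
  also have "\<dots> = Polynomial.smult ((-1) ^ n) ([:-1, 1:] ^ n - [:0, 1:] ^ n)"
    by (simp only: 1 2 smult_power smult_diff_right)
  also have "\<dots> = Polynomial.smult ((-1) ^ (n + 1)) (X_poly n)"
    by (simp add: X_poly_def smult_diff_right)
  finally show ?thesis .
qed

lemma mpow_X_poly_reflect:
  "pcompose (mpow X_poly m) [:1, -1:] = Polynomial.smult ((-1) ^ u_weight m) (mpow X_poly m)"
proof -
  have "pcompose (mpow X_poly m) [:1, -1:] = (\<Prod>n\<in>Poly_Mapping.keys m. (Polynomial.smult ((-1) ^ (n + 1)) (X_poly n)) ^ Poly_Mapping.lookup m n)"
    by (simp only: mpow_def pcompose_prod pcompose_power X_poly_reflect)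
  also have "\<dots> = (\<Prod>n\<in>Poly_Mapping.keys m. Polynomial.smult ((-1) ^ ((n + 1) * Poly_Mapping.lookup m n)) (X_poly n ^ Poly_Mapping.lookup m n))"
    by (simp only: smult_power[symmetric] power_mult)
  also have "\<dots> = Polynomial.smult ((-1) ^ u_weight m) (mpow X_poly m)"
    by (simp only: prod_smult u_weight_def mpow_def power_sum)
  finally show ?thesis .
qed

text \<open>The same map carries the interval from -v to 1 - v onto that from v to v + 1.\<close>

lemma shift_integral_reflect:
  "pcompose (shift_integral P) [:0, -1:] = shift_integral (pcompose P [:1, -1:])"
proof -
  let ?A = "poly_antideriv P"
  have "pderiv (- pcompose ?A [:1, -1:]) = pcompose P [:1, -1:]"
    by (simp add: pderiv_minus pderiv_pcompose pderiv_antideriv pderiv_pCons)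
  hence "shift_integral (pcompose P [:1, -1:]) =
      pcompose (- pcompose ?A [:1, -1:]) [:1, 1:] - (- pcompose ?A [:1, -1:])"
    by (rule shift_integral_eqI)
  also have "\<dots> = pcompose ?A [:1, -1:] - pcompose ?A [:0, -1:]"
    by (simp add: pcompose_uminus pcompose_assoc[symmetric] pcompose_pCons)
  also have "\<dots> = pcompose (shift_integral P) [:0, -1:]"
    by (simp add: poly_integral_def pcompose_diff pcompose_assoc[symmetric] pcompose_pCons)
  finally show ?thesis by simp
qed

lemma rho_series_eq:
  "rho_series k m = fact k / mfact m * coeff (shift_integral (mpow X_poly m)) k"
  by (simp add: rho_series_def rho_gen_eq shift_integral_smult)

text \<open>The parity comes from the symmetry \<open>t \<mapsto> 1 - t\<close> of the integrand.\<close>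

lemma rho_series_nonzeroD:
  assumes "rho_series k m \<noteq> 0"
  shows "k + 2 * u_degree m \<le> u_weight m" "even (u_weight m + k)"
proof -
  have nz: "coeff (shift_integral (mpow X_poly m)) k \<noteq> 0"
    using assms by (simp add: rho_series_eq)
  have "0 \<notin> Poly_Mapping.keys m"
    using nz by (auto simp: mpow_X_poly_eq_0 coeff_shift_integral)
  from degree_mpow_X_poly[OF this] show "k + 2 * u_degree m \<le> u_weight m"
    using coeff_shift_integral_eq_0[of "mpow X_poly m" k] nz by linarith
  have "(-1) ^ k * coeff (shift_integral (mpow X_poly m)) k =
      coeff (pcompose (shift_integral (mpow X_poly m)) [:0, -1:]) k"
    by (simp add: coeff_pcompose_linear)
  also have "\<dots> = (-1) ^ u_weight m * coeff (shift_integral (mpow X_poly m)) k"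
    by (simp add: shift_integral_reflect mpow_X_poly_reflect shift_integral_smult)
  finally have "(-1) ^ k = ((-1) ^ u_weight m :: rat)" using nz by simp
  thus "even (u_weight m + k)"
    by (cases "even k"; cases "even (u_weight m)") auto
qed

lemma rho_series_0: "rho_series k 0 = (if k = 0 then 1 else 0)"
  using coeff_shift_integral_power[of 0 k] by (simp add: rho_series_eq)

section \<open>Hook differences expressed by the series rho\<close>

lemma hook_diff_sum: "hook_diff h Y (\<lambda>a. \<Sum>x\<in>A. f x a) = (\<Sum>x\<in>A. hook_diff h Y (f x))"
  unfolding hook_diff_def
  by (simp add: sum_subtractf sum.distrib sum.swap[of _ Y] sum.swap[of _ "{..<h}"])

lemma hook_diff_cmult:
  fixes c :: "'a :: comm_ring"
  shows "hook_diff h Y (\<lambda>a. c * f a) = c * hook_diff h Y f"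
  unfolding hook_diff_def by (simp add: sum_distrib_left right_diff_distrib distrib_left)

text \<open>Apply \<open>hook_diff_power\<close> to each power of t. Its coefficients match those of
  the integral, because \<open>fact d / fact (Suc d - k)\<close> is \<open>fact k\<close> times the
  binomial coefficient over \<open>Suc d\<close>; rescaling by \<open>h\<close> leaves
  \<open>h / h ^ k\<close> for every \<open>d\<close>. The common bound \<open>K\<close> gives all
  sums the same range.\<close>

lemma hook_diff_poly:
  assumes "h > 0" "degree P \<le> K"
  shows "hook_diff h Y (\<lambda>a. poly P (bead_pos N a / of_nat h)) =
    (\<Sum>k\<le>K. Q_set N k Y * (fact k * coeff (shift_integral P) k) * of_nat h / of_nat h ^ k)"
proof -
  let ?h = "of_nat h :: rat"
  have "hook_diff h Y (\<lambda>a. poly P (bead_pos N a / ?h)) =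
     (\<Sum>d\<le>degree P. coeff P d / ?h ^ d * hook_diff h Y (\<lambda>a. bead_pos N a ^ d))"
    unfolding poly_altdef hook_diff_sum hook_diff_cmult[symmetric] by (simp add: power_divide)
  also have "\<dots> = (\<Sum>d\<le>degree P. \<Sum>k\<le>K. Q_set N k Y * (fact k * (coeff P d *
      (if k \<le> d then of_nat (Suc d choose k) / of_nat (Suc d) else 0))) * ?h / ?h ^ k)"
  proof (rule sum.cong[OF refl])
    fix d assume d: "d \<in> {..degree P}"
    have "coeff P d / ?h ^ d * hook_diff h Y (\<lambda>a. bead_pos N a ^ d) =
       (\<Sum>k\<le>d. coeff P d / ?h ^ d * (Q_set N k Y * fact d / fact (Suc d - k) * ?h ^ (Suc d - k)))"
      by (simp only: hook_diff_power sum_distrib_left)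
    also have "\<dots> = (\<Sum>k\<le>d. Q_set N k Y * (fact k * (coeff P d * (of_nat (Suc d choose k) / of_nat (Suc d)))) * ?h / ?h ^ k)"
    proof (rule sum.cong[OF refl])
      fix k assume "k \<in> {..d}"
      hence k: "k \<le> d" by simp
      have "coeff P d / ?h ^ d * (Q_set N k Y * fact d / fact (Suc d - k) * ?h ^ (Suc d - k)) =
          Q_set N k Y * coeff P d * (fact d / fact (Suc d - k)) * (?h ^ (Suc d - k) / ?h ^ d)"
        by (simp only: divide_inverse mult_ac)
      also have "?h ^ (Suc d - k) / ?h ^ d = ?h / ?h ^ k"
        using k assms(1) by (simp add: Suc_diff_le power_diff field_simps)
      also have "(fact d / fact (Suc d - k) :: rat) = fact k * (of_nat (Suc d choose k) / of_nat (Suc d))"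
        using k by (subst binomial_fact) (auto simp del: of_nat_Suc)
      finally show "coeff P d / ?h ^ d * (Q_set N k Y * fact d / fact (Suc d - k) * ?h ^ (Suc d - k)) =
        Q_set N k Y * (fact k * (coeff P d * (of_nat (Suc d choose k) / of_nat (Suc d)))) * ?h / ?h ^ k"
        by (simp only: divide_inverse mult_ac)
    qed
    also have "\<dots> = (\<Sum>k\<le>K. Q_set N k Y * (fact k * (coeff P d *
      (if k \<le> d then of_nat (Suc d choose k) / of_nat (Suc d) else 0))) * ?h / ?h ^ k)"
      using d assms(2) by (intro sum.mono_neutral_cong_left) auto
    finally show "coeff P d / ?h ^ d * hook_diff h Y (\<lambda>a. bead_pos N a ^ d) = \<dots>" .
  qed
  also have "\<dots> = (\<Sum>k\<le>K. Q_set N k Y * (fact k * coeff (shift_integral P) k) * ?h / ?h ^ k)"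
    unfolding coeff_shift_integral
    by (subst sum.swap) (simp add: sum_distrib_left sum_distrib_right sum_divide_distrib)
  finally show ?thesis .
qed

text \<open>The amount by which \<open>p\<^sub>n\<close> falls when the hook of length
  \<open>h\<close> with head \<open>a\<close> is removed.\<close>

definition hook_shift :: "nat \<Rightarrow> nat \<Rightarrow> nat \<Rightarrow> nat \<Rightarrow> rat" where
  "hook_shift N h a n = bead_pos N a ^ n - (bead_pos N a - of_nat h) ^ n"

lemma hook_shift_eq:
  assumes "h > 0"
  shows "hook_shift N h a n = of_nat h ^ n * poly (X_poly n) (bead_pos N a / of_nat h)"
  using assms
  by (simp add: hook_shift_def X_poly_def right_diff_distrib power_mult_distrib[symmetric] distrib_left)

lemma poly_mpow: "poly (mpow X m) t = mpow (\<lambda>n. poly (X n) t) m"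
  by (simp add: mpow_def poly_prod)

lemma mpow_power: "mpow (\<lambda>n. c ^ n) m = c ^ (u_weight m - u_degree m)"
proof -
  have "u_weight m - u_degree m = (\<Sum>n\<in>Poly_Mapping.keys m. n * Poly_Mapping.lookup m n)"
    by (simp add: u_weight_def u_degree_def sum.distrib)
  thus ?thesis by (simp add: mpow_def power_mult power_sum)
qed

lemma mpow_const: "mpow (\<lambda>n. c) m = c ^ u_degree m"
  by (simp add: mpow_def u_degree_def power_sum)

text \<open>Taylor's formula with translation \<open>r\<close> times \<open>hook_shift\<close>. Each
  variable yields a factor \<open>r\<close>, and the substitution of t/h for t extracts the sum of
  \<open>n\<close> times its exponent, which is weight minus degree, as a power of \<open>h\<close>;
  then \<open>hook_diff_poly\<close> applies.\<close>

lemma hook_diff_R_poly_eval: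
  assumes "h > 0" and K: "\<And>m. m \<in> deriv_support f \<Longrightarrow> degree (mpow X_poly m) \<le> K"
  shows "hook_diff h Y (\<lambda>a. R_poly_eval (\<lambda>n. P n + of_nat r * hook_shift N h a n / fact n) f) =
    (\<Sum>m\<in>deriv_support f. \<Sum>k\<le>K. rho_series k m * Q_set N k Y * R_poly_eval P (deriv_monomial m f) *
       (of_nat r ^ u_degree m * of_nat h ^ (u_weight m - u_degree m) * of_nat h / of_nat h ^ k))"
proof -
  let ?h = "of_nat h :: rat" and ?r = "of_nat r :: rat"
  have "R_poly_eval (\<lambda>n. P n + ?r * hook_shift N h a n / fact n) f = (\<Sum>m\<in>deriv_support f.
     (?r ^ u_degree m * ?h ^ (u_weight m - u_degree m) / mfact m * R_poly_eval P (deriv_monomial m f)) *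
      poly (mpow X_poly m) (bead_pos N a / ?h))" for a
    unfolding R_poly_eval_taylor
    by (simp only: mpow_mult hook_shift_eq[OF assms(1)] mpow_const mpow_power poly_mpow)
       (simp add: mult_ac)
  hence "hook_diff h Y (\<lambda>a. R_poly_eval (\<lambda>n. P n + ?r * hook_shift N h a n / fact n) f) =
     (\<Sum>m\<in>deriv_support f.
     (?r ^ u_degree m * ?h ^ (u_weight m - u_degree m) / mfact m * R_poly_eval P (deriv_monomial m f)) *
      hook_diff h Y (\<lambda>a. poly (mpow X_poly m) (bead_pos N a / ?h)))"
    by (simp only: hook_diff_sum hook_diff_cmult)
  also have "\<dots> = (\<Sum>m\<in>deriv_support f. \<Sum>k\<le>K. rho_series k m * Q_set N k Y * R_poly_eval P (deriv_monomial m f) *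
       (?r ^ u_degree m * ?h ^ (u_weight m - u_degree m) * ?h / ?h ^ k))"
    by (intro sum.cong refl, subst hook_diff_poly[OF assms(1) K])
       (simp_all add: sum_distrib_left rho_series_eq mult_ac)
  finally show ?thesis .
qed

section \<open>Evaluation of the brackets\<close>

definition bracket_term :: "R_poly \<Rightarrow> monomial \<Rightarrow> nat \<Rightarrow> nat list \<Rightarrow> rat" where
  "bracket_term f m k l = rho_series k m * Q_fun k l * R_eval (deriv_monomial m f) l"

lemma sum_partitions_of_beta_set:
  "n \<le> N \<Longrightarrow> (\<Sum>l\<in>partitions_of n. g (beta_set N l)) = (\<Sum>X\<in>subsets_of_sum N n. g X)"
  by (rule sum.reindex_bij_betw[OF bij_betw_beta_set])

lemma partitions_ofD: "l \<in> partitions_of n \<Longrightarrow> is_partition l \<and> length l \<le> n"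
  using length_le_sum_list[of l] by (auto simp: partitions_of_def)

lemma R_eval_eq_Q_set:
  assumes "is_partition l" "length l \<le> N"
  shows "R_eval f l = R_poly_eval (\<lambda>n. Q_set N (n + 1) (beta_set N l)) f"
  using assms by (simp add: R_eval_eq Q_fun_eq_Q_set)

text \<open>\<open>sum_hook_heads_iterate\<close> with \<open>N = n\<close>, which suffices since
  partitions of \<open>n\<close> have at most \<open>n\<close> parts.\<close>

lemma sum_hook_heads_R_eval:
  assumes "h > 0" and K: "\<And>m. m \<in> deriv_support f \<Longrightarrow> degree (mpow X_poly m) \<le> K"
  shows "(\<Sum>l\<in>partitions_of n. of_nat (card (hook_heads h (beta_set n l))) * R_eval f l) =
    (\<Sum>r\<in>{1..n div h}. \<Sum>l\<in>partitions_of (n - r * h). \<Sum>m\<in>deriv_support f. \<Sum>k\<le>K.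
       bracket_term f m k l *
       (of_nat r ^ u_degree m * of_nat h ^ (u_weight m - u_degree m) * of_nat h / of_nat h ^ k))"
proof -
  \<comment> \<open>The value of \<open>f\<close> at \<open>Y\<close> as if \<open>r\<close> hooks
    with head \<open>a\<close> had been added. Really adding one raises the arguments by one
    \<open>hook_shift\<close>, that is, \<open>r\<close> by one.\<close>
  define F where "F Y r a = R_poly_eval (\<lambda>i. Q_set n (i + 1) Y + of_nat r * hook_shift n h a i / fact i) f"
    for Y r a
  have step: "F (insert (b + h) (Y - {b})) r (b + h) = F Y (Suc r) (b + h)"
    if "finite Y" "b \<in> Y" "b + h \<notin> Y" for Y b r
  proof -
    have "Q_set n (i + 1) (insert (b + h) (Y - {b})) + of_nat r * hook_shift n h (b + h) i / fact i =
      Q_set n (i + 1) Y + of_nat (Suc r) * hook_shift n h (b + h) i / fact i" for i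
      using Q_set_move_bead[OF that, of n i]
      by (simp add: hook_shift_def[symmetric] add_divide_distrib distrib_right)
    thus ?thesis by (simp add: F_def)
  qed
  have "(\<Sum>l\<in>partitions_of n. of_nat (card (hook_heads h (beta_set n l))) * R_eval f l) =
     (\<Sum>l\<in>partitions_of n. \<Sum>a\<in>hook_heads h (beta_set n l). F (beta_set n l) 0 a)"
    by (intro sum.cong refl) (auto simp: F_def R_eval_eq_Q_set[of _ n] dest!: partitions_ofD)
  also have "\<dots> = (\<Sum>X\<in>subsets_of_sum n n. \<Sum>a\<in>hook_heads h X. F X 0 a)"
    by (rule sum_partitions_of_beta_set) simp
  also have "\<dots> = (\<Sum>r\<in>{1..n div h}. \<Sum>Y\<in>subsets_of_sum n (n - r * h). hook_diff h Y (F Y r))"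
    using sum_hook_heads_iterate[where F = F and r = 0 and N = n and n = n, OF step] assms(1)
    by (simp add: hook_diff_def)
  also have "\<dots> = (\<Sum>r\<in>{1..n div h}. \<Sum>l\<in>partitions_of (n - r * h). hook_diff h (beta_set n l) (F (beta_set n l) r))"
    by (intro sum.cong refl sum_partitions_of_beta_set[symmetric]) auto
  also have "\<dots> = (\<Sum>r\<in>{1..n div h}. \<Sum>l\<in>partitions_of (n - r * h). \<Sum>m\<in>deriv_support f. \<Sum>k\<le>K.
       bracket_term f m k l *
       (of_nat r ^ u_degree m * of_nat h ^ (u_weight m - u_degree m) * of_nat h / of_nat h ^ k))"
  proof (rule sum.cong[OF refl], rule sum.cong[OF refl])
    fix r l assume "l \<in> partitions_of (n - r * h)"
    hence l: "is_partition l" "length l \<le> n"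
      using partitions_ofD[of l "n - r * h"] by auto
    have "hook_diff h (beta_set n l) (F (beta_set n l) r) = (\<Sum>m\<in>deriv_support f. \<Sum>k\<le>K.
       rho_series k m * Q_set n k (beta_set n l) *
         R_poly_eval (\<lambda>i. Q_set n (i + 1) (beta_set n l)) (deriv_monomial m f) *
       (of_nat r ^ u_degree m * of_nat h ^ (u_weight m - u_degree m) * of_nat h / of_nat h ^ k))"
      unfolding F_def by (rule hook_diff_R_poly_eval[OF assms(1)]) (rule K)
    thus "hook_diff h (beta_set n l) (F (beta_set n l) r) = (\<Sum>m\<in>deriv_support f. \<Sum>k\<le>K.
       bracket_term f m k l *
       (of_nat r ^ u_degree m * of_nat h ^ (u_weight m - u_degree m) * of_nat h / of_nat h ^ k))"
      by (simp only: bracket_term_def R_eval_eq_Q_set[OF l] Q_fun_eq_Q_set[OF l])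
  qed
  finally show ?thesis .
qed

section \<open>The operators rho evaluated on partitions\<close>

lemma rho_series_eq_0: "degree (mpow X_poly m) < k \<Longrightarrow> rho_series k m = 0"
  by (simp add: rho_series_eq coeff_shift_integral_eq_0)

text \<open>Every variable, also the one of index 0, has positive weight, so the weight bounds both
  the indices and the exponents that occur.\<close>

lemma finite_u_weight: "finite {m. u_weight m = w}"
proof (rule finite_subset)
  show "{m. u_weight m = w} \<subseteq> monom_box (\<Sum>n<w. Poly_Mapping.single n w)"
  proof
    fix m assume "m \<in> {m. u_weight m = w}"
    hence w: "u_weight m = w" by simp
    have "Poly_Mapping.lookup m n \<le> Poly_Mapping.lookup (\<Sum>n<w. Poly_Mapping.single n w) n" for n
    proof (cases "n \<in> Poly_Mapping.keys m")
      case True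
      hence "(n + 1) * Poly_Mapping.lookup m n \<le> w"
        unfolding w[symmetric] u_weight_def by (intro member_le_sum[of n _ "\<lambda>r. (r + 1) * Poly_Mapping.lookup m r"]) auto
      moreover have "Poly_Mapping.lookup m n > 0" using True by (simp add: in_keys_iff)
      ultimately have "n < w" "Poly_Mapping.lookup m n \<le> w"
        by (cases "Poly_Mapping.lookup m n"; simp)+
      thus ?thesis by (simp add: lookup_sum lookup_single when_def)
    qed (simp add: in_keys_iff)
    thus "m \<in> monom_box (\<Sum>n<w. Poly_Mapping.single n w)" by (simp add: monom_box_def)
  qed
qed simp

lemma rho_op_eq:
  assumes K: "\<And>m. m \<in> deriv_support f \<Longrightarrow> degree (mpow X_poly m) \<le> K"
  shows "rho_op i j f = (\<Sum>k\<le>K. Q_sym k *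
    (\<Sum>m\<in>deriv_support f. R_const (rho_part k i j m) * deriv_monomial m f))"
proof -
  have inner: "(\<Sum>m | rho_part k i j m \<noteq> 0. R_const (rho_part k i j m) * deriv_monomial m f) =
     (\<Sum>m\<in>deriv_support f. R_const (rho_part k i j m) * deriv_monomial m f)" for k
  proof (rule sum.mono_neutral_cong)
    have "{m. rho_part k i j m \<noteq> 0} \<subseteq> {m. u_weight m = i + 2 * j + k}"
      by (auto simp: rho_part_def split: if_splits)
    thus "finite {m. rho_part k i j m \<noteq> 0}"
      using finite_u_weight by (rule finite_subset)
  qed (auto simp: deriv_monomial_eq_0 R_const_def)
  show ?thesis unfolding rho_op_def inner
  proof (rule Sum_any.expand_superset)
    have "rho_part k i j m = 0" if "m \<in> deriv_support f" "k > K" for k m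
      using rho_series_eq_0[of m k] K[OF that(1)] that(2) by (auto simp: rho_part_def)
    thus "{k. Q_sym k * (\<Sum>m\<in>deriv_support f. R_const (rho_part k i j m) * deriv_monomial m f) \<noteq> 0} \<subseteq> {..K}"
      by (force simp: R_const_def not_le intro: sum.neutral)
  qed simp
qed

lemma R_eval_rho_op:
  assumes K: "\<And>m. m \<in> deriv_support f \<Longrightarrow> degree (mpow X_poly m) \<le> K"
  shows "R_eval (rho_op i j f) l = (\<Sum>m\<in>deriv_support f. \<Sum>k\<le>K.
    if u_degree m = j \<and> u_weight m = i + 2 * j + k then bracket_term f m k l else 0)"
proof -
  have "R_eval (rho_op i j f) l = (\<Sum>k\<le>K. \<Sum>m\<in>deriv_support f.
     Q_fun k l * (rho_part k i j m * R_eval (deriv_monomial m f) l))"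
    unfolding R_eval_eq
    by (subst rho_op_eq[OF K], assumption)
       (simp only: R_poly_eval_sum R_poly_eval_mult R_eval_Q_sym R_poly_eval_const sum_distrib_left)
  also have "\<dots> = (\<Sum>k\<le>K. \<Sum>m\<in>deriv_support f.
    if u_degree m = j \<and> u_weight m = i + 2 * j + k then bracket_term f m k l else 0)"
    by (intro sum.cong refl) (auto simp: rho_part_def bracket_term_def)
  finally show ?thesis by (subst sum.swap) simp
qed

section \<open>Brackets, Eisenstein series and divisor sums\<close>

lemma partitions_of_0: "partitions_of 0 = {[]}"
proof -
  have "l = []" if "l \<in> partitions_of 0" for l
    using partitions_ofD[OF that] by simp
  thus ?thesis by (auto simp: partitions_of_def)
qed

lemma q_bracket_eq: "q_bracket g = partition_series g * inverse (partition_series (\<lambda>_. 1))"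
  unfolding q_bracket_def
  by (rule fps_divide_unit) (simp add: partition_series_def partitions_of_0)

lemma partition_series_sum:
  "partition_series (\<lambda>l. \<Sum>x\<in>A. g x l) = (\<Sum>x\<in>A. partition_series (g x))"
  by (rule fps_ext) (simp add: partition_series_def fps_sum_nth, rule sum.swap)

lemma q_bracket_sum: "q_bracket (\<lambda>l. \<Sum>x\<in>A. g x l) = (\<Sum>x\<in>A. q_bracket (g x))"
  by (simp add: q_bracket_eq partition_series_sum sum_distrib_right)

lemma q_bracket_zero [simp]: "q_bracket (\<lambda>l. 0) = 0"
  using q_bracket_sum[of "\<lambda>_ _. 0" "{}"] by simp

lemma q_bracket_if: "q_bracket (\<lambda>l. if c then g l else 0) = (if c then q_bracket g else 0)"
  by (cases c) simp_all

lemma eisenstein_G_deriv_nth: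
  "fps_nth (eisenstein_G_deriv j k) n = of_nat n ^ j * fps_nth (eisenstein_G k) n"
proof -
  have "fps_nth (((\<lambda>F. fps_X * fps_deriv F) ^^ j) F) n = of_nat n ^ j * fps_nth F n" for F :: "rat fps"
    by (induction j) (cases n; simp)+
  thus ?thesis by (simp add: eisenstein_G_deriv_def)
qed

lemma eisenstein_G_nth:
  assumes "even k" "n > 0"
  shows "fps_nth (eisenstein_G k) n = (\<Sum>d | d dvd n. of_nat d ^ (k - 1))"
  using assms by (simp add: eisenstein_G_def divisor_sigma_def)

text \<open>Write \<open>t = r * d\<close>.\<close>

lemma sum_divisors_swap:
  fixes g :: "nat \<Rightarrow> nat \<Rightarrow> 'a :: comm_monoid_add"
  shows "(\<Sum>t\<in>{1..n}. \<Sum>d | d dvd t. g d (t div d)) = (\<Sum>d\<in>{1..n}. \<Sum>r\<in>{1..n div d}. g d r)"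
proof -
  have "(\<Sum>t\<in>{1..n}. \<Sum>d | d dvd t. g d (t div d)) =
      (\<Sum>(t, d)\<in>Sigma {1..n} (\<lambda>t. {d. d dvd t}). g d (t div d))"
    by (subst sum.Sigma) auto
  also have "\<dots> = (\<Sum>(d, r)\<in>Sigma {1..n} (\<lambda>d. {1..n div d}). g d r)"
  proof (rule sum.reindex_bij_witness[where i = "\<lambda>(d, r). (r * d, d)" and j = "\<lambda>(t, d). (d, t div d)"])
    fix x assume "x \<in> Sigma {1..n} (\<lambda>t. {d. d dvd t})"
    then obtain t d where x: "x = (t, d)" "1 \<le> t" "t \<le> n" "d dvd t" by auto
    have "d > 0" "d \<le> t" using x dvd_pos_nat[of t d] dvd_imp_le[of d t] by auto
    moreover have "t div d \<ge> 1" "t div d \<le> n div d"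
      using x \<open>d > 0\<close> \<open>d \<le> t\<close> div_greater_zero_iff[of t d] div_le_mono[of t n d] by simp_all
    ultimately show "(case x of (t, d) \<Rightarrow> (d, t div d)) \<in> Sigma {1..n} (\<lambda>d. {1..n div d})"
      and "(case case x of (t, d) \<Rightarrow> (d, t div d) of (d, r) \<Rightarrow> (r * d, d)) = x"
      and "(case case x of (t, d) \<Rightarrow> (d, t div d) of (d, r) \<Rightarrow> g d r) = (case x of (t, d) \<Rightarrow> g d (t div d))"
      using x by auto
  next
    fix y assume "y \<in> Sigma {1..n} (\<lambda>d. {1..n div d})"
    then obtain d r where y: "y = (d, r)" "1 \<le> d" "1 \<le> r" "r \<le> n div d" by auto
    have "r * d \<le> n div d * d" using y by simp
    also have "\<dots> \<le> n" by (rule div_times_less_eq_dividend)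
    finally show "(case y of (d, r) \<Rightarrow> (r * d, d)) \<in> Sigma {1..n} (\<lambda>t. {d. d dvd t})"
      and "(case case y of (d, r) \<Rightarrow> (r * d, d) of (t, d) \<Rightarrow> (d, t div d)) = y"
      using y by auto
  qed
  also have "\<dots> = (\<Sum>d\<in>{1..n}. \<Sum>r\<in>{1..n div d}. g d r)"
    by (subst sum.Sigma) auto
  finally show ?thesis .
qed

text \<open>The Cauchy product with its term at 0 separated; by \<open>0 ^ j\<close> the constant
  coefficient survives only when nothing is differentiated. In the remaining terms the divisor sum
  becomes a double sum over \<open>d\<close> and \<open>r\<close>.\<close>

lemma mult_eisenstein_G_deriv_nth:
  assumes "even k"
  shows "fps_nth (F * eisenstein_G_deriv j k) n =
    0 ^ j * fps_nth (eisenstein_G k) 0 * fps_nth F n +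
    (\<Sum>d\<in>{1..n}. \<Sum>r\<in>{1..n div d}. of_nat (r * d) ^ j * of_nat d ^ (k - 1) * fps_nth F (n - r * d))"
proof -
  have "fps_nth (F * eisenstein_G_deriv j k) n =
      (\<Sum>t=0..n. of_nat t ^ j * fps_nth (eisenstein_G k) t * fps_nth F (n - t))"
    unfolding mult.commute[of F] fps_mult_nth eisenstein_G_deriv_nth ..
  also have "{0..n} = insert 0 {1..n}" by auto
  also have "(\<Sum>t\<in>insert 0 {1..n}. of_nat t ^ j * fps_nth (eisenstein_G k) t * fps_nth F (n - t)) =
     0 ^ j * fps_nth (eisenstein_G k) 0 * fps_nth F n +
     (\<Sum>t\<in>{1..n}. of_nat t ^ j * fps_nth (eisenstein_G k) t * fps_nth F (n - t))"
    by (subst sum.insert) auto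
  also have "(\<Sum>t\<in>{1..n}. of_nat t ^ j * fps_nth (eisenstein_G k) t * fps_nth F (n - t)) =
     (\<Sum>t\<in>{1..n}. \<Sum>d | d dvd t. of_nat ((t div d) * d) ^ j * of_nat d ^ (k - 1) * fps_nth F (n - (t div d) * d))"
  proof (rule sum.cong[OF refl])
    fix t assume t: "t \<in> {1..n}"
    have "of_nat t ^ j * fps_nth (eisenstein_G k) t * fps_nth F (n - t) =
        (\<Sum>d | d dvd t. of_nat t ^ j * of_nat d ^ (k - 1) * fps_nth F (n - t))"
      using t assms by (simp add: eisenstein_G_nth sum_distrib_left sum_distrib_right)
    also have "\<dots> = (\<Sum>d | d dvd t. of_nat ((t div d) * d) ^ j * of_nat d ^ (k - 1) * fps_nth F (n - (t div d) * d))"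
      by (rule sum.cong[OF refl]) (simp only: mem_Collect_eq dvd_div_mult_self)
    finally show "of_nat t ^ j * fps_nth (eisenstein_G k) t * fps_nth F (n - t) = \<dots>" .
  qed
  also have "\<dots> = (\<Sum>d\<in>{1..n}. \<Sum>r\<in>{1..n div d}. of_nat (r * d) ^ j * of_nat d ^ (k - 1) * fps_nth F (n - r * d))"
    by (rule sum_divisors_swap[where g =
        "\<lambda>d r. of_nat (r * d) ^ j * of_nat d ^ (k - 1) * fps_nth F (n - r * d)"])
  finally show ?thesis .
qed

lemma u_degree_le_u_weight: "u_degree m \<le> u_weight m"
  unfolding u_degree_def u_weight_def by (intro sum_mono) simp

text \<open>The value of i that \<open>m\<close> and \<open>k\<close> determine in the weight
  condition of \<open>rho_part\<close>; the subtraction is exact whenever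
  \<open>rho_series k m\<close> is nonzero.\<close>

definition rho_index :: "monomial \<Rightarrow> nat \<Rightarrow> nat" where
  "rho_index m k = u_weight m - 2 * u_degree m - k"

text \<open>A pair of \<open>m\<close> and \<open>k\<close> with nonzero coefficient contributes to
  exactly one pair (i, j), so the sum over (i, j) can be replaced by one over \<open>m\<close> and
  \<open>k\<close>.\<close>

lemma Sum_any_rho_op:
  assumes K: "\<And>m. m \<in> deriv_support f \<Longrightarrow> degree (mpow X_poly m) \<le> K"
  shows "Sum_any (\<lambda>(i, j). q_bracket (R_eval (rho_op i j f)) * G i j) =
    (\<Sum>m\<in>deriv_support f. \<Sum>k\<le>K. q_bracket (bracket_term f m k) * G (rho_index m k) (u_degree m))"
proof -
  \<comment> \<open>Both i and j are at most the weight i + 2 j + k, so \<open>W\<close> confines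
    the support of the \<open>Sum_any\<close> to a finite square.\<close>
  define W where "W = Max (u_weight ` deriv_support f)"
  have W: "u_weight m \<le> W" if "m \<in> deriv_support f" for m
    unfolding W_def using that by (intro Max_ge) auto
  let ?c = "\<lambda>i j m k. u_degree m = j \<and> u_weight m = i + 2 * j + k"
  have br: "q_bracket (R_eval (rho_op i j f)) * G i j = (\<Sum>m\<in>deriv_support f. \<Sum>k\<le>K.
     if ?c i j m k then q_bracket (bracket_term f m k) * G i j else 0)" for i j
  proof -
    have "R_eval (rho_op i j f) = (\<lambda>l. \<Sum>m\<in>deriv_support f. \<Sum>k\<le>K. if ?c i j m k then bracket_term f m k l else 0)"
      by (rule ext, rule R_eval_rho_op) (rule K)
    hence "q_bracket (R_eval (rho_op i j f)) = (\<Sum>m\<in>deriv_support f. \<Sum>k\<le>K.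
        if ?c i j m k then q_bracket (bracket_term f m k) else 0)"
      by (simp only: q_bracket_sum q_bracket_if)
    thus ?thesis
      by (simp only: sum_distrib_right if_distrib[of "\<lambda>x. x * G i j"] mult_zero_left)
  qed
  have "Sum_any (\<lambda>(i, j). q_bracket (R_eval (rho_op i j f)) * G i j) =
    (\<Sum>(i, j)\<in>{..W} \<times> {..W}. q_bracket (R_eval (rho_op i j f)) * G i j)"
  proof (rule Sum_any.expand_superset)
    have zero: "q_bracket (R_eval (rho_op i j f)) * G i j = 0" if "\<not> (i \<le> W \<and> j \<le> W)" for i j
      unfolding br
    proof (intro sum.neutral ballI)
      fix m k assume "m \<in> deriv_support f"
      from W[OF this] u_degree_le_u_weight[of m] that
      show "(if ?c i j m k then q_bracket (bracket_term f m k) * G i j else 0) = 0" by auto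
    qed
    show "{ij. (case ij of (i, j) \<Rightarrow> q_bracket (R_eval (rho_op i j f)) * G i j) \<noteq> 0} \<subseteq> {..W} \<times> {..W}"
    proof
      fix ij assume "ij \<in> {ij. (case ij of (i, j) \<Rightarrow> q_bracket (R_eval (rho_op i j f)) * G i j) \<noteq> 0}"
      moreover obtain i j where "ij = (i, j)" by force
      ultimately show "ij \<in> {..W} \<times> {..W}" using zero[of i j] by auto
    qed
  qed simp
  also have "\<dots> = (\<Sum>m\<in>deriv_support f. \<Sum>k\<le>K. \<Sum>(i, j)\<in>{..W} \<times> {..W}.
     if ?c i j m k then q_bracket (bracket_term f m k) * G i j else 0)"
  proof -
    have "(\<Sum>(i, j)\<in>{..W} \<times> {..W}. q_bracket (R_eval (rho_op i j f)) * G i j) =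
       (\<Sum>m\<in>deriv_support f. \<Sum>x\<in>{..W} \<times> {..W}. \<Sum>k\<le>K.
         if ?c (fst x) (snd x) m k then q_bracket (bracket_term f m k) * G (fst x) (snd x) else 0)"
      unfolding br case_prod_unfold by (rule sum.swap)
    also have "\<dots> = (\<Sum>m\<in>deriv_support f. \<Sum>k\<le>K. \<Sum>x\<in>{..W} \<times> {..W}.
         if ?c (fst x) (snd x) m k then q_bracket (bracket_term f m k) * G (fst x) (snd x) else 0)"
      by (rule sum.cong[OF refl]) (rule sum.swap)
    finally show ?thesis by (simp only: case_prod_unfold)
  qed
  also have "\<dots> = (\<Sum>m\<in>deriv_support f. \<Sum>k\<le>K. q_bracket (bracket_term f m k) * G (rho_index m k) (u_degree m))"
  proof (rule sum.cong[OF refl], rule sum.cong[OF refl])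
    fix m k assume m: "m \<in> deriv_support f"
    show "(\<Sum>(i, j)\<in>{..W} \<times> {..W}. if ?c i j m k then q_bracket (bracket_term f m k) * G i j else 0) =
      q_bracket (bracket_term f m k) * G (rho_index m k) (u_degree m)"
    proof (cases "rho_series k m = 0")
      case True
      hence "bracket_term f m k = (\<lambda>l. 0)" by (simp add: bracket_term_def fun_eq_iff)
      hence "q_bracket (bracket_term f m k) = 0" by (simp only: q_bracket_zero)
      thus ?thesis by (auto simp: case_prod_unfold intro!: sum.neutral)
    next
      case False
      have wt: "u_weight m = rho_index m k + 2 * u_degree m + k"
        using rho_series_nonzeroD(1)[OF False] by (simp add: rho_index_def)
      have "(\<Sum>(i, j)\<in>{..W} \<times> {..W}. if ?c i j m k then q_bracket (bracket_term f m k) * G i j else 0) =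
         (\<Sum>(i, j)\<in>{(rho_index m k, u_degree m)}. q_bracket (bracket_term f m k) * G i j)"
        using W[OF m] u_degree_le_u_weight[of m] wt
        by (intro sum.mono_neutral_cong_right) (auto split: if_splits)
      thus ?thesis by simp
    qed
  qed
  finally show ?thesis .
qed

lemma bracket_term_0: "bracket_term f 0 k l = (if k = 0 then R_eval f l else 0)"
  by (simp add: bracket_term_def rho_series_0 Q_fun_def)

text \<open>For odd \<open>p\<close> the sign in \<open>zeta_neg_eq\<close> is negative, and half of
  the zeta value is minus the Bernoulli number over \<open>2 * (p + 1)\<close>.\<close>

lemma T_tilde_eq:
  assumes "odd p"
  shows "T_tilde p l = (\<Sum>\<xi>\<in>young_diagram l. of_nat (hook_length l \<xi>) ^ (p - 1)) +
    fps_nth (eisenstein_G (p + 1)) 0"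
proof -
  have "p > 0" using assms by (auto intro: gr0I)
  thus ?thesis using assms by (simp add: T_tilde_def zeta_neg_eq eisenstein_G_def)
qed

theorem theorem14p1:
  fixes f :: R_poly and p :: nat
  assumes "odd p"
  shows "q_bracket (\<lambda>l. T_tilde p l * R_eval f l) =
    Sum_any (\<lambda>(i, j). q_bracket (R_eval (rho_op i j f)) * eisenstein_G_deriv j (p + i + 1))"
proof -
  define K where "K = Max ((\<lambda>m. degree (mpow X_poly m)) ` deriv_support f)"
  have K: "degree (mpow X_poly m) \<le> K" if "m \<in> deriv_support f" for m
    unfolding K_def using that by (intro Max_ge) auto
  let ?M = "deriv_support f" and ?C = "bracket_term f"
  let ?G = "\<lambda>m k. eisenstein_G_deriv (u_degree m) (p + rho_index m k + 1)"
  let ?c0 = "fps_nth (eisenstein_G (p + 1)) 0"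
  let ?s = "\<lambda>m k n. fps_nth (partition_series (?C m k)) n"
  let ?w = "\<lambda>m k h r. of_nat (r * h) ^ u_degree m * of_nat h ^ (p + rho_index m k + 1 - 1) :: rat"
  have p: "p > 0" using assms by (auto intro: gr0I)
  have "partition_series (\<lambda>l. T_tilde p l * R_eval f l) =
    (\<Sum>m\<in>?M. \<Sum>k\<le>K. partition_series (?C m k) * ?G m k)"
  proof (rule fps_ext)
    fix n
    \<comment> \<open>Constant coefficients matter only in degree 0, hence for \<open>m = 0\<close>;
      there \<open>rho_series\<close> leaves only \<open>k = 0\<close>, and the term is
      \<open>f\<close> itself.\<close>
    have const: "(\<Sum>m\<in>?M. \<Sum>k\<le>K. 0 ^ u_degree m * fps_nth (eisenstein_G (p + rho_index m k + 1)) 0 * ?s m k n) =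
        (\<Sum>l\<in>partitions_of n. ?c0 * R_eval f l)"
    proof -
      have "(\<Sum>m\<in>?M. \<Sum>k\<le>K. 0 ^ u_degree m * fps_nth (eisenstein_G (p + rho_index m k + 1)) 0 * ?s m k n) =
        (\<Sum>m\<in>{0}. \<Sum>k\<le>K. 0 ^ u_degree m * fps_nth (eisenstein_G (p + rho_index m k + 1)) 0 * ?s m k n)"
        by (intro sum.mono_neutral_right) (auto simp: deriv_support_def u_degree_eq_0_iff power_0_left)
      also have "\<dots> = (\<Sum>k\<in>{0}. fps_nth (eisenstein_G (p + rho_index 0 k + 1)) 0 * ?s 0 k n)"
      proof -
        have "(\<Sum>k\<in>{0}. fps_nth (eisenstein_G (p + rho_index 0 k + 1)) 0 * ?s 0 k n) =
            (\<Sum>k\<le>K. fps_nth (eisenstein_G (p + rho_index 0 k + 1)) 0 * ?s 0 k n)"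
          by (intro sum.mono_neutral_left) (auto simp: partition_series_def bracket_term_0)
        thus ?thesis by simp
      qed
      also have "\<dots> = (\<Sum>l\<in>partitions_of n. ?c0 * R_eval f l)"
        by (simp add: partition_series_def bracket_term_0 rho_index_def sum_distrib_left)
      finally show ?thesis .
    qed
    have "fps_nth (\<Sum>m\<in>?M. \<Sum>k\<le>K. partition_series (?C m k) * ?G m k) n =
       (\<Sum>m\<in>?M. \<Sum>k\<le>K. 0 ^ u_degree m * fps_nth (eisenstein_G (p + rho_index m k + 1)) 0 * ?s m k n +
         (\<Sum>h\<in>{1..n}. \<Sum>r\<in>{1..n div h}. ?w m k h r * ?s m k (n - r * h)))"
      unfolding fps_sum_nth
    proof (rule sum.cong[OF refl], rule sum.cong[OF refl])
      fix m k
      show "fps_nth (partition_series (?C m k) * ?G m k) n =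
        0 ^ u_degree m * fps_nth (eisenstein_G (p + rho_index m k + 1)) 0 * ?s m k n +
         (\<Sum>h\<in>{1..n}. \<Sum>r\<in>{1..n div h}. ?w m k h r * ?s m k (n - r * h))"
      proof (cases "rho_series k m = 0")
        case True
        hence "?C m k = (\<lambda>l. 0)" by (simp add: bracket_term_def fun_eq_iff)
        hence "partition_series (?C m k) = 0" by (simp add: partition_series_def fps_eq_iff)
        thus ?thesis by simp
      next
        case False
        \<comment> \<open>The weight and \<open>k\<close> have equal parity, so i is even and
          \<open>p + i + 1\<close> is even: the Eisenstein series set to 0 in odd weight never meet
          a nonzero coefficient.\<close>
        from rho_series_nonzeroD[OF False] have "even (rho_index m k)"
          by (auto simp: rho_index_def)
        hence "even (p + rho_index m k + 1)" using assms by simp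
        thus ?thesis by (rule mult_eisenstein_G_deriv_nth)
      qed
    qed
    also have "\<dots> = (\<Sum>l\<in>partitions_of n. ?c0 * R_eval f l) +
       (\<Sum>m\<in>?M. \<Sum>k\<le>K. \<Sum>h\<in>{1..n}. \<Sum>r\<in>{1..n div h}. ?w m k h r * ?s m k (n - r * h))"
      by (simp only: sum.distrib const)
    also have "(\<Sum>m\<in>?M. \<Sum>k\<le>K. \<Sum>h\<in>{1..n}. \<Sum>r\<in>{1..n div h}. ?w m k h r * ?s m k (n - r * h)) =
      (\<Sum>h\<in>{1..n}. \<Sum>r\<in>{1..n div h}. \<Sum>m\<in>?M. \<Sum>k\<le>K. ?w m k h r * ?s m k (n - r * h))"
    proof -
      have "(\<Sum>m\<in>?M. \<Sum>k\<le>K. \<Sum>h\<in>{1..n}. \<Sum>r\<in>{1..n div h}. ?w m k h r * ?s m k (n - r * h)) =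
         (\<Sum>m\<in>?M. \<Sum>h\<in>{1..n}. \<Sum>k\<le>K. \<Sum>r\<in>{1..n div h}. ?w m k h r * ?s m k (n - r * h))"
        by (rule sum.cong[OF refl], rule sum.swap)
      also have "\<dots> = (\<Sum>h\<in>{1..n}. \<Sum>m\<in>?M. \<Sum>k\<le>K. \<Sum>r\<in>{1..n div h}. ?w m k h r * ?s m k (n - r * h))"
        by (rule sum.swap)
      also have "\<dots> = (\<Sum>h\<in>{1..n}. \<Sum>m\<in>?M. \<Sum>r\<in>{1..n div h}. \<Sum>k\<le>K. ?w m k h r * ?s m k (n - r * h))"
        by (rule sum.cong[OF refl], rule sum.cong[OF refl], rule sum.swap)
      also have "\<dots> = (\<Sum>h\<in>{1..n}. \<Sum>r\<in>{1..n div h}. \<Sum>m\<in>?M. \<Sum>k\<le>K. ?w m k h r * ?s m k (n - r * h))"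
        by (rule sum.cong[OF refl], rule sum.swap)
      finally show ?thesis .
    qed
    also have "\<dots> = (\<Sum>h\<in>{1..n}. of_nat h ^ (p - 1) *
        (\<Sum>l\<in>partitions_of n. of_nat (card (hook_heads h (beta_set n l))) * R_eval f l))"
    proof (rule sum.cong[OF refl])
      fix h assume "h \<in> {1..n}"
      hence h: "h > 0" by simp
      let ?v = "\<lambda>m k r. of_nat r ^ u_degree m * of_nat h ^ (u_weight m - u_degree m) * of_nat h / of_nat h ^ k :: rat"
      \<comment> \<open>Weight minus degree is i + j + k, so the power of \<open>h\<close> on the
        right is (p - 1) + (i + j + k) + 1 - k = p + i + j, as in the coefficient of the
        differentiated Eisenstein series.\<close>
      have w: "?w m k h r * ?C m k l = of_nat h ^ (p - 1) * (?C m k l * ?v m k r)" for m k l r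
      proof (cases "rho_series k m = 0")
        case False
        have "u_weight m = rho_index m k + 2 * u_degree m + k"
          using rho_series_nonzeroD(1)[OF False] by (simp add: rho_index_def)
        hence "u_weight m - u_degree m = rho_index m k + u_degree m + k" by simp
        moreover have "(of_nat h ^ p :: rat) = of_nat h ^ (p - 1) * of_nat h"
          using p by (simp add: power_eq_if)
        ultimately have "?w m k h r = of_nat h ^ (p - 1) * ?v m k r"
          using h by (simp add: power_add power_mult_distrib mult_ac)
        thus ?thesis by (simp only: mult_ac)
      qed (simp add: bracket_term_def)
      have "(\<Sum>r\<in>{1..n div h}. \<Sum>m\<in>?M. \<Sum>k\<le>K. ?w m k h r * ?s m k (n - r * h)) =
        (\<Sum>r\<in>{1..n div h}. \<Sum>m\<in>?M. \<Sum>k\<le>K. \<Sum>l\<in>partitions_of (n - r * h).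
           of_nat h ^ (p - 1) * (?C m k l * ?v m k r))"
        by (simp only: partition_series_def fps_nth_Abs_fps sum_distrib_left w)
      also have "\<dots> = (\<Sum>r\<in>{1..n div h}. \<Sum>l\<in>partitions_of (n - r * h). \<Sum>m\<in>?M. \<Sum>k\<le>K.
           of_nat h ^ (p - 1) * (?C m k l * ?v m k r))"
      proof (rule sum.cong[OF refl])
        fix r
        have "(\<Sum>m\<in>?M. \<Sum>k\<le>K. \<Sum>l\<in>partitions_of (n - r * h). of_nat h ^ (p - 1) * (?C m k l * ?v m k r)) =
           (\<Sum>m\<in>?M. \<Sum>l\<in>partitions_of (n - r * h). \<Sum>k\<le>K. of_nat h ^ (p - 1) * (?C m k l * ?v m k r))"
          by (rule sum.cong[OF refl], rule sum.swap)
        also have "\<dots> = (\<Sum>l\<in>partitions_of (n - r * h). \<Sum>m\<in>?M. \<Sum>k\<le>K. of_nat h ^ (p - 1) * (?C m k l * ?v m k r))"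
          by (rule sum.swap)
        finally show "(\<Sum>m\<in>?M. \<Sum>k\<le>K. \<Sum>l\<in>partitions_of (n - r * h). of_nat h ^ (p - 1) * (?C m k l * ?v m k r)) = \<dots>" .
      qed
      also have "\<dots> = of_nat h ^ (p - 1) *
         (\<Sum>l\<in>partitions_of n. of_nat (card (hook_heads h (beta_set n l))) * R_eval f l)"
        by (subst sum_hook_heads_R_eval[OF h K], assumption) (simp only: sum_distrib_left)
      finally show "(\<Sum>r\<in>{1..n div h}. \<Sum>m\<in>?M. \<Sum>k\<le>K. ?w m k h r * ?s m k (n - r * h)) = \<dots>" .
    qed
    also have "\<dots> = (\<Sum>l\<in>partitions_of n. (\<Sum>\<xi>\<in>young_diagram l. of_nat (hook_length l \<xi>) ^ (p - 1)) * R_eval f l)"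
    proof -
      have "(\<Sum>l\<in>partitions_of n. (\<Sum>\<xi>\<in>young_diagram l. of_nat (hook_length l \<xi>) ^ (p - 1)) * R_eval f l) =
         (\<Sum>l\<in>partitions_of n. \<Sum>h\<in>{1..n}. of_nat h ^ (p - 1) * (of_nat (card (hook_heads h (beta_set n l))) * R_eval f l))"
      proof (rule sum.cong[OF refl])
        fix l assume l: "l \<in> partitions_of n"
        show "(\<Sum>\<xi>\<in>young_diagram l. of_nat (hook_length l \<xi>) ^ (p - 1)) * R_eval f l =
           (\<Sum>h\<in>{1..n}. of_nat h ^ (p - 1) * (of_nat (card (hook_heads h (beta_set n l))) * R_eval f l))"
          using sum_hook_length[OF l order_refl, of "\<lambda>h. of_nat h ^ (p - 1) :: rat"]
          by (simp only: sum_distrib_right mult.assoc)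
      qed
      thus ?thesis by (subst (asm) sum.swap) (simp add: sum_distrib_left)
    qed
    also have "(\<Sum>l\<in>partitions_of n. ?c0 * R_eval f l) + \<dots> =
        fps_nth (partition_series (\<lambda>l. T_tilde p l * R_eval f l)) n"
      by (simp add: partition_series_def T_tilde_eq[OF assms] sum.distrib[symmetric] algebra_simps)
    finally show "fps_nth (partition_series (\<lambda>l. T_tilde p l * R_eval f l)) n =
       fps_nth (\<Sum>m\<in>?M. \<Sum>k\<le>K. partition_series (?C m k) * ?G m k) n" by simp
  qed
  \<comment> \<open>The numerators agree; dividing by the generating series of all partitions turns
    both sides into brackets.\<close>
  hence "q_bracket (\<lambda>l. T_tilde p l * R_eval f l) =
      (\<Sum>m\<in>?M. \<Sum>k\<le>K. partition_series (?C m k) * ?G m k) * inverse (partition_series (\<lambda>_. 1))"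
    by (simp only: q_bracket_eq)
  also have "\<dots> = (\<Sum>m\<in>?M. \<Sum>k\<le>K. q_bracket (?C m k) * ?G m k)"
    unfolding sum_distrib_right q_bracket_eq by (intro sum.cong refl) (simp only: mult_ac)
  also have "\<dots> = Sum_any (\<lambda>(i, j). q_bracket (R_eval (rho_op i j f)) * eisenstein_G_deriv j (p + i + 1))"
    by (rule Sum_any_rho_op[symmetric]) (rule K)
  finally show ?thesis .
qed

end
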